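(* For $s\in\{226,3388,4390,4986\}$ let $c_s$ be the role assignment of the edges of the catalogue graph $G_s$ given by fixing labels on the blocks of $\Pi_{\mathrm{opp}}(G_s)$. Then $$|\mathcal I(c_{226})|=|\mathcal I(c_{4390})|=|\mathcal I(c_{4986})|=1,\qquad |\mathcal I(c_{3388})|\ge 43 .$$ Moreover, for $G=G_{3388}$ there is an assignment $c_{\mathrm{inc}}\in\mathcal I(c_{3388})$ with $c_{\mathrm{inc}}\ne c_{3388}$ and $\mathsf H(G,\Pi(c_{\mathrm{inc}}))=1$. It differs from $c_{3388}$ on exactly 12 directed edges and is obtained from $c_{3388}$ by exchanging the roles $0$ and $1$ on the edges $$(0,1),(18,1),(18,17),(14,17),(14,15),(1,15),(1,0),(17,0),(17,18),(15,18),(15,14),(0,14),$$ where the two roles that $c_{3388}$ assigns to these edges are the ones labelled $0$ and $1$.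
   Context: **Opposite-diamond partition.** $G=(V,E)$ is a finite loopless directed graph without parallel edges. An edge partition is an unlabelled collection of nonempty pairwise disjoint subsets (blocks) of $E$ with union $E$. A directed two-step diamond pattern is a quadruple of distinct vertices $(x,a,b,y)$ with $(x,a),(x,b),(a,y),(b,y)\in E$ (additional arcs allowed). Its opposite pairs are $\{(x,a),(b,y)\}$ and $\{(x,b),(a,y)\}$. $\Omega(G)$ is the undirected graph on vertex set $E$ joining two edges that form an opposite pair of some pattern. $\Pi_{\mathrm{opp}}(G)$ is the set of connected components of $\Omega(G)$. **Role assignments and incidence fibres.** Labelling the $q$ blocks of a partition by $q$ fixed distinct role labels identifies it with a map $c$ from $E$ to the label set. Put $d_r^+(v;c)=|\{(v,w)\in E:c(v,w)=r\}|$ and $d_r^-(v;c)=|\{(u,v)\in E:c(u,v)=r\}|$. The fixed-role incidence fibre $\mathcal I(c)$ is the set of all maps $c'$ from $E$ to the same label set with $d_r^\pm(v;c')=d_r^\pm(v;c)$ for all $v\in V$ and all labels $r$. $\Pi(c)$ is the underlying unlabelled partition into the fibres $c^{-1}(r)$. Exchanging roles $0$ and $1$ on a set of edges means that each edge of the set with role $0$ receives role $1$ and vice versa, all other edges being unchanged. **Catalogue graphs $G_s$.** Terms are generated by $\mathcal T::=\mathtt A\mid\mathtt V\mid \mathtt P(\mathcal T,\mathcal T)\mid \mathtt R(\mathcal T,\mathcal T)$, with size $|\mathtt A|=|\mathtt V|=1$, $|\mathtt P(s,t)|=|\mathtt R(s,t)|=1+|s|+|t|$. The symbol $\mathtt V$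 is a single consistently bound wildcard (placeholder): repeated occurrences in a pattern must match the same term. A state is a finite multiset of terms (components), written canonically as an ASCII string with its components sorted lexicographically, separated by semicolons and enclosed in braces. In a state, any component of the form $\mathtt R(p,q)$ (a represented rule) may be applied to any nonplaceholder occurrence (a subterm occurrence other than $\mathtt V$ itself) matching $p$ in any component; the occurrence is replaced by the corresponding instance of $q$ under the same binding of $\mathtt V$, and the components are sorted again. A state is valid when every non-rule component (outermost symbol not $\mathtt R$) is closed (contains no $\mathtt V$) and no rule contains $\mathtt V$ on its right without $\mathtt V$ on its left. Retain the rewrites leading to valid states whose changed component has size at most 255, and, starting from a seed state, explore all transitions whose source is at distance less than 3 from the seed. The rule signature of a canonical state is the ordered tuple of its components with outermost symbol $\mathtt R$; its data signature is the ordered tuple of the remaining components. A qualifying recurrent core is a cyclic strongly connected component of the explored transition graph with at least two distinct rule signatures, at least two distinct data signatures, and an internal transition changing the rule signature. For each row below the selected core is the unique largest qualifying core. The vertices of $G_s$ are the states of that core, numbered $0,1,2,\dots$ in lexicographic order of canonical state strings; the directed edges are the distinct ordered pairs of distinct core states joined by at least one internal one-step rewrite. The seeds are: - row 226: $\mathtt{\{A;R(A,R(A,A));R(V,A)\}}$ ($|V|=20$, $|E|=55$); - row 3388: $\mathtt{\{P(A,A);R(A,P(A,A));R(V,P(A,A))\}}$ ($|V|=29$, $|E|=108$); - row 4390: $\mathtt{\{P(A,A);R(P(A,V),V);R(V,P(A,V))\}}$ ($|V|=22$, $|E|=66$); - row 4986: $\mathtt{\{P(A,A);R(P(V,A),V);R(V,P(V,A))\}}$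 ($|V|=22$, $|E|=66$). **Relations.** Let $\Pi$ be an edge partition of $G$. For a relation $R\subseteq V\times V$ write $R(v)=\{w:(v,w)\in R\}$; composition is $(R\circ S)(v)=\bigcup_{w\in R(v)}S(w)$ ($R$ first). For a block $C\in\Pi$ let $T_C=C$ viewed as a relation on $V$, and for a nonempty word $w=C_1\cdots C_k$ in blocks let $T_w=T_{C_1}\circ\cdots\circ T_{C_k}$. The empty word $\varepsilon$, with $T_\varepsilon=\operatorname{Id}_V$, is admitted only as an offload word. **Behavioural quotient.** $Q_0$ is the indiscrete equivalence on $V$; $u,v$ are $Q_{t+1}$-equivalent iff for every $C\in\Pi$ the sets $\{[w]_{Q_t}:w\in T_C(u)\}$ and $\{[w]_{Q_t}:w\in T_C(v)\}$ agree. $Q$ is the stable equivalence and $\kappa_Q(v)$ the class of $v$. **Write-preserve-use (WPU) certificate.** It consists of: (W1, fork) a state $s\in V$, channels $A,B\in\Pi$ (possibly equal), $\ell\in T_A(s)$, $r\in T_B(s)$ with $\kappa_Q(\ell)\ne\kappa_Q(r)$; (W2–W3, offload) a word $o$, possibly $\varepsilon$, with $T_o(\ell)=\{p\}$, $T_o(r)=\{q\}$, $p\ne q$, $\kappa_Q(p)\neq\kappa_Q(q)$, and for each $C\in\{A,B\}$: $T_C(p)\ne\varnothing\iff T_C(q)\ne\varnothing$; (W4, persistent orbit) a nonempty word $z$ with $T_z\ne\operatorname{Id}_V$ such that, for the partial map $T_z^{(2)}(u,v)=(u',v')$ defined when $T_z(u)=\{u'\}$ and $T_z(v)=\{v'\}$,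 all iterates from $(p,q)$ are defined, the two entries always lie in different $Q$-classes, and at least one iterate differs from its predecessor (the resulting eventually periodic sequence is the persistent pair orbit); (W5, use) a nonempty word $u$ with $T_u\neq\operatorname{Id}_V$ such that, with $\beta_u(v)=\{\kappa_Q(w):w\in T_u(v)\}$, $\beta_u(p)\neq\beta_u(q)$ and $(\beta_u(p),\beta_u(q))\ne(\{\kappa_Q(p)\},\{\kappa_Q(q)\})$. **Record systems (W6).** A WPU certificate has class pair $\{\kappa_Q(p),\kappa_Q(q)\}$ and operational support equal to the set of all states occurring in its persistent pair orbit. A record system is a nonempty finite family of certificates with one common class pair $K$; its support is the union of their operational supports; its representatives in class $k\in K$ are the support states belonging to $k$, and both representative sets must be nonempty. **Translations.** Let $X,Y$ be distinct record systems with class pairs presented as ordered pairs $(x_0,x_1)$, $(y_0,y_1)$. A nonempty word $t$ induces a translation $X\to Y$ when for each $i\in\{0,1\}$, $T_t$ is single-valued on every representative of $x_i$, all images lie in the support of $Y$, and all have one common class $y_{\pi(i)}$, where $\pi$ is a permutation of $\{0,1\}$. Its gain in $\mathbb Z_2$ is the parity of $\pi$. **The property $\mathsf H$.** $\mathsf H(G,\Pi)=1$ iff there is a finite family of record systems such that: (E1) at least two record systems are present; (E2) some unordered pair $X,Y$ has translations in both directions; (E3) some two supports are strictly nested or have nonempty proper overlap (disjoint or equal supports do not qualify); (E4) there are distinct record systems $X,Y$, a certificate in $X$ whose persistent pair orbit has eventual period $m>1$, a coordinate $j\in\{0,1\}$ and a nonempty word $r$ such that, writing $(p_h,q_h)$,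 $0\le h<m$, for the periodic part and $x_h=p_h$ if $j=0$, $x_h=q_h$ if $j=1$, for every $h$ one has $T_r(x_h)=\{y_h\}$ with $y_h$ in the support of $Y$ and $\kappa_Q(y_h)$ in its class pair, and $(\kappa_Q(y_h))_{h=0}^{m-1}$ is nonconstant; (E5) the directed multigraph whose vertices are the record systems and whose arcs are translations labelled by gains has a closed directed walk of odd total gain. Otherwise $\mathsf H(G,\Pi)=0$. *)

theory Defs
  imports
    "HOL-Library.Multiset"
    "HOL-Library.Char_ord"
    "HOL-Library.List_Lexorder"
    "HOL-Combinatorics.Permutations"
    "Graph_Theory.Graph_Theory"
begin

text \<open>
  A finite loopless directed graph without parallel edges is a \<^typ>\<open>'v pair_pre_digraph\<close>
  of \<^theory>\<open>Graph_Theory.Pair_Digraph\<close>, with vertex set \<^const>\<open>pverts\<close> and edge set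
  \<^const>\<open>parcs\<close>. An edge partition is the set of its blocks, and a block is directly a relation
  on the vertices.
\<close>

section \<open>The catalogue graphs\<close>

datatype trm = TA | TV | TP trm trm | TR trm trm

primrec term_size :: "trm \<Rightarrow> nat" where
  "term_size TA = 1"
| "term_size TV = 1"
| "term_size (TP s t) = 1 + term_size s + term_size t"
| "term_size (TR s t) = 1 + term_size s + term_size t"

primrec show_trm :: "trm \<Rightarrow> string" where
  "show_trm TA = ''A''"
| "show_trm TV = ''V''"
| "show_trm (TP s t) = ''P('' @ show_trm s @ '','' @ show_trm t @ '')''"
| "show_trm (TR s t) = ''R('' @ show_trm s @ '','' @ show_trm t @ '')''"

lemma show_trm_append_inject:
  "show_trm s @ xs = show_trm t @ ys \<Longrightarrow> s = t \<and> xs = ys"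
proof (induction s arbitrary: t xs ys)
  case TA
  then show ?case by (cases t) auto
next
  case TV
  then show ?case by (cases t) auto
next
  case IH: (TP s1 s2)
  show ?case
  proof (cases t)
    case (TP t1 t2)
    then have "show_trm s1 @ (CHR '','' # show_trm s2 @ CHR '')'' # xs) =
        show_trm t1 @ (CHR '','' # show_trm t2 @ CHR '')'' # ys)"
      using IH(3) by simp
    from IH(1)[OF this] have "s1 = t1"
      and *: "show_trm s2 @ (CHR '')'' # xs) = show_trm t2 @ (CHR '')'' # ys)"
      by simp_all
    from IH(2)[OF *] \<open>s1 = t1\<close> TP show ?thesis
      by simp
  qed (use IH(3) in auto)
next
  case IH: (TR s1 s2)
  show ?case
  proof (cases t)
    case (TR t1 t2)
    then have "show_trm s1 @ (CHR '','' # show_trm s2 @ CHR '')'' # xs) =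
        show_trm t1 @ (CHR '','' # show_trm t2 @ CHR '')'' # ys)"
      using IH(3) by simp
    from IH(1)[OF this] have "s1 = t1"
      and *: "show_trm s2 @ (CHR '')'' # xs) = show_trm t2 @ (CHR '')'' # ys)"
      by simp_all
    from IH(2)[OF *] \<open>s1 = t1\<close> TR show ?thesis
      by simp
  qed (use IH(3) in auto)
qed

lemma show_trm_inject: "show_trm s = show_trm t \<longleftrightarrow> s = t"
  using show_trm_append_inject[of s "[]" t "[]"] by auto

text \<open>
  Terms are ordered by their ASCII strings, compared lexicographically; so
  \<^const>\<open>sorted_list_of_multiset\<close> lists the components of a state in canonical order.
\<close>

instantiation trm :: linorder
begin

definition less_eq_trm :: "trm \<Rightarrow> trm \<Rightarrow> bool" where
  "s \<le> t \<longleftrightarrow> show_trm s \<le> show_trm t"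

definition less_trm :: "trm \<Rightarrow> trm \<Rightarrow> bool" where
  "s < t \<longleftrightarrow> show_trm s < show_trm t"

instance
  by standard (auto simp: less_eq_trm_def less_trm_def show_trm_inject[symmetric])

end

type_synonym state = "trm multiset"

fun join :: "string \<Rightarrow> string list \<Rightarrow> string" where
  "join sep [] = []"
| "join sep [x] = x"
| "join sep (x # y # zs) = x @ sep @ join sep (y # zs)"

definition state_string :: "state \<Rightarrow> string" where
  "state_string S = ''{'' @ join '';'' (map show_trm (sorted_list_of_multiset S)) @ ''}''"

primrec has_V :: "trm \<Rightarrow> bool" where
  "has_V TA = False"
| "has_V TV = True"
| "has_V (TP s t) = (has_V s \<or> has_V t)"
| "has_V (TR s t) = (has_V s \<or> has_V t)"

primrec inst_V :: "trm \<Rightarrow> trm \<Rightarrow> trm" where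
  "inst_V u TA = TA"
| "inst_V u TV = u"
| "inst_V u (TP s t) = TP (inst_V u s) (inst_V u t)"
| "inst_V u (TR s t) = TR (inst_V u s) (inst_V u t)"

text \<open>
  One application of the rule \<open>TR p q\<close> inside a term. The binding \<open>u\<close> of the placeholder may
  itself contain \<^const>\<open>TV\<close> (when the rewritten component is a rule).
\<close>

inductive rewrites_to :: "trm \<Rightarrow> trm \<Rightarrow> trm \<Rightarrow> trm \<Rightarrow> bool" for p q where
  root: "inst_V u p \<noteq> TV \<Longrightarrow> rewrites_to p q (inst_V u p) (inst_V u q)"
| P_left: "rewrites_to p q s s' \<Longrightarrow> rewrites_to p q (TP s t) (TP s' t)"
| P_right: "rewrites_to p q t t' \<Longrightarrow> rewrites_to p q (TP s t) (TP s t')"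
| R_left: "rewrites_to p q s s' \<Longrightarrow> rewrites_to p q (TR s t) (TR s' t)"
| R_right: "rewrites_to p q t t' \<Longrightarrow> rewrites_to p q (TR s t) (TR s t')"

primrec valid_component :: "trm \<Rightarrow> bool" where
  "valid_component TA \<longleftrightarrow> True"
| "valid_component TV \<longleftrightarrow> False"
| "valid_component (TP s t) \<longleftrightarrow> \<not> has_V (TP s t)"
| "valid_component (TR p q) \<longleftrightarrow> (has_V q \<longrightarrow> has_V p)"

definition valid_state :: "state \<Rightarrow> bool" where
  "valid_state S \<longleftrightarrow> (\<forall>t \<in># S. valid_component t)"

definition retained :: "state rel" where
  "retained = {(S, S'). \<exists>p q t t'. TR p q \<in># S \<and> t \<in># S \<and> rewrites_to p q t t' \<and>
     S' = add_mset t' (S - {#t#}) \<and> valid_state S' \<and> term_size t' \<le> 255}"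

text \<open>\<open>(seed, S) \<in> retained ^^ n\<close> for some \<open>n < 3\<close> says that \<open>S\<close> is at distance less than 3.\<close>

definition explored :: "state \<Rightarrow> state pair_pre_digraph" where
  "explored seed = \<lparr>
     pverts = {S. \<exists>n \<le> 3. (seed, S) \<in> retained ^^ n},
     parcs = {(S, S'). (S, S') \<in> retained \<and> (\<exists>n < 3. (seed, S) \<in> retained ^^ n)}\<rparr>"

primrec is_rule :: "trm \<Rightarrow> bool" where
  "is_rule TA = False"
| "is_rule TV = False"
| "is_rule (TP s t) = False"
| "is_rule (TR s t) = True"

definition rule_signature :: "state \<Rightarrow> trm list" where
  "rule_signature S = filter is_rule (sorted_list_of_multiset S)"

definition data_signature :: "state \<Rightarrow> trm list" where
  "data_signature S = filter (\<lambda>t. \<not> is_rule t) (sorted_list_of_multiset S)"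

definition qualifying_core :: "state \<Rightarrow> state set \<Rightarrow> bool" where
  "qualifying_core seed C \<longleftrightarrow>
     C \<in> pre_digraph.sccs_verts (with_proj (explored seed)) \<and>
     (\<exists>S \<in> C. (S, S) \<in> (parcs (explored seed))\<^sup>+) \<and>
     (\<exists>S \<in> C. \<exists>S' \<in> C. rule_signature S \<noteq> rule_signature S') \<and>
     (\<exists>S \<in> C. \<exists>S' \<in> C. data_signature S \<noteq> data_signature S') \<and>
     (\<exists>S \<in> C. \<exists>S' \<in> C. (S, S') \<in> parcs (explored seed) \<and> rule_signature S \<noteq> rule_signature S')"

definition selected_core :: "state \<Rightarrow> state set" where
  "selected_core seed = (THE C. qualifying_core seed C \<and>
     (\<forall>C'. qualifying_core seed C' \<and> C' \<noteq> C \<longrightarrow> card C' < card C))"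

text \<open>The position of a core state in the lexicographic order of state strings, from 0.\<close>

definition state_number :: "state set \<Rightarrow> state \<Rightarrow> nat" where
  "state_number C S = card {S' \<in> C. state_string S' < state_string S}"

definition core_graph :: "state \<Rightarrow> nat pair_pre_digraph" where
  "core_graph seed = (let C = selected_core seed in \<lparr>
     pverts = state_number C ` C,
     parcs = {(state_number C S, state_number C S') | S S'.
       S \<in> C \<and> S' \<in> C \<and> S \<noteq> S' \<and> (S, S') \<in> parcs (explored seed)}\<rparr>)"

definition catalogue_seed :: "nat \<Rightarrow> state" where
  "catalogue_seed s =
    (if s = 226 then {# TA, TR TA (TR TA TA), TR TV TA #}
     else if s = 3388 then {# TP TA TA, TR TA (TP TA TA), TR TV (TP TA TA) #}
     else if s = 4390 then {# TP TA TA, TR (TP TA TV) TV, TR TV (TP TA TV) #}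
     else if s = 4986 then {# TP TA TA, TR (TP TV TA) TV, TR TV (TP TV TA) #}
     else {#})"

definition catalogue_graph :: "nat \<Rightarrow> nat pair_pre_digraph" where
  "catalogue_graph s = core_graph (catalogue_seed s)"


section \<open>Opposite-diamond partition, role assignments and incidence fibres\<close>

definition diamond :: "'v pair_pre_digraph \<Rightarrow> 'v \<Rightarrow> 'v \<Rightarrow> 'v \<Rightarrow> 'v \<Rightarrow> bool" where
  "diamond G x a b y \<longleftrightarrow> distinct [x, a, b, y] \<and> {x, a, b, y} \<subseteq> pverts G \<and>
     {(x, a), (x, b), (a, y), (b, y)} \<subseteq> parcs G"

definition Omega :: "'v pair_pre_digraph \<Rightarrow> ('v \<times> 'v) rel" where
  "Omega G = {(e, f). \<exists>x a b y. diamond G x a b y \<and>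
     ({e, f} = {(x, a), (b, y)} \<or> {e, f} = {(x, b), (a, y)})}"

definition opp_partition :: "'v pair_pre_digraph \<Rightarrow> ('v \<times> 'v) set set" where
  "opp_partition G = parcs G // {(e, f) \<in> parcs G \<times> parcs G. (e, f) \<in> (Omega G)\<^sup>*}"

text \<open>
  \<open>c\<close> arises from the partition \<open>P\<close> of \<open>E\<close> by labelling its blocks bijectively with the labels
  in \<open>R\<close>. Maps with domain \<open>E\<close> are extensional functions.
\<close>

definition labels_blocks :: "'e set \<Rightarrow> 'e set set \<Rightarrow> 'r set \<Rightarrow> ('e \<Rightarrow> 'r) \<Rightarrow> bool" where
  "labels_blocks E P R c \<longleftrightarrow> c \<in> extensional E \<and>
     (\<exists>lab. bij_betw lab P R \<and> (\<forall>C \<in> P. \<forall>e \<in> C. c e = lab C))"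

text \<open>The \<open>q\<close> fixed role labels of a partition into \<open>q\<close> blocks are \<open>0, \<dots>, q - 1\<close>.\<close>

definition role_labels :: "'v pair_pre_digraph \<Rightarrow> nat set" where
  "role_labels G = {..<card (opp_partition G)}"

definition opp_role_assignment :: "'v pair_pre_digraph \<Rightarrow> ('v \<times> 'v \<Rightarrow> nat) \<Rightarrow> bool" where
  "opp_role_assignment G c \<longleftrightarrow> labels_blocks (parcs G) (opp_partition G) (role_labels G) c"

definition role_outdegree ::
  "'v pair_pre_digraph \<Rightarrow> ('v \<times> 'v \<Rightarrow> 'r) \<Rightarrow> 'r \<Rightarrow> 'v \<Rightarrow> nat" where
  "role_outdegree G c r v = card {e \<in> parcs G. fst e = v \<and> c e = r}"

definition role_indegree ::
  "'v pair_pre_digraph \<Rightarrow> ('v \<times> 'v \<Rightarrow> 'r) \<Rightarrow> 'r \<Rightarrow> 'v \<Rightarrow> nat" where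
  "role_indegree G c r v = card {e \<in> parcs G. snd e = v \<and> c e = r}"

definition incidence_fibre ::
  "'v pair_pre_digraph \<Rightarrow> 'r set \<Rightarrow> ('v \<times> 'v \<Rightarrow> 'r) \<Rightarrow> ('v \<times> 'v \<Rightarrow> 'r) set" where
  "incidence_fibre G R c = {c' \<in> parcs G \<rightarrow>\<^sub>E R. \<forall>v \<in> pverts G. \<forall>r \<in> R.
     role_outdegree G c' r v = role_outdegree G c r v \<and>
     role_indegree G c' r v = role_indegree G c r v}"

definition fibre_partition :: "'e set \<Rightarrow> ('e \<Rightarrow> 'r) \<Rightarrow> 'e set set" where
  "fibre_partition E c = {{e \<in> E. c e = r} | r. r \<in> c ` E}"

definition exchange_roles :: "'r \<Rightarrow> 'r \<Rightarrow> 'e set \<Rightarrow> ('e \<Rightarrow> 'r) \<Rightarrow> 'e \<Rightarrow> 'r" where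
  "exchange_roles a b S c =
     (\<lambda>e. if e \<in> S \<and> c e = a then b else if e \<in> S \<and> c e = b then a else c e)"


section \<open>Words, behavioural quotient and certificates\<close>

text \<open>\<^const>\<open>relcomp\<close> applies its first argument first, as does the composition of words.\<close>

definition word_rel :: "'v pair_pre_digraph \<Rightarrow> 'v rel list \<Rightarrow> 'v rel" where
  "word_rel G w = foldr (O) w (Id_on (pverts G))"

definition is_word :: "'v rel set \<Rightarrow> 'v rel list \<Rightarrow> bool" where
  "is_word \<P> w \<longleftrightarrow> set w \<subseteq> \<P>"

primrec Q_approx :: "'v pair_pre_digraph \<Rightarrow> 'v rel set \<Rightarrow> nat \<Rightarrow> 'v rel" where
  "Q_approx G \<P> 0 = pverts G \<times> pverts G"
| "Q_approx G \<P> (Suc t) = {(u, v) \<in> pverts G \<times> pverts G. \<forall>C \<in> \<P>.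
     (\<lambda>w. Q_approx G \<P> t `` {w}) ` (C `` {u}) = (\<lambda>w. Q_approx G \<P> t `` {w}) ` (C `` {v})}"

definition Q_stable :: "'v pair_pre_digraph \<Rightarrow> 'v rel set \<Rightarrow> 'v rel" where
  "Q_stable G \<P> = Q_approx G \<P> (LEAST t. Q_approx G \<P> (Suc t) = Q_approx G \<P> t)"

definition kappa :: "'v pair_pre_digraph \<Rightarrow> 'v rel set \<Rightarrow> 'v \<Rightarrow> 'v set" where
  "kappa G \<P> v = Q_stable G \<P> `` {v}"

definition pair_map :: "'v rel \<Rightarrow> 'v \<times> 'v \<Rightarrow> ('v \<times> 'v) option" where
  "pair_map T uv =
    (if is_singleton (T `` {fst uv}) \<and> is_singleton (T `` {snd uv})
     then Some (the_elem (T `` {fst uv}), the_elem (T `` {snd uv})) else None)"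

primrec pair_iterate :: "'v rel \<Rightarrow> 'v \<times> 'v \<Rightarrow> nat \<Rightarrow> ('v \<times> 'v) option" where
  "pair_iterate T pq 0 = Some pq"
| "pair_iterate T pq (Suc n) = Option.bind (pair_iterate T pq n) (pair_map T)"

definition beta :: "'v pair_pre_digraph \<Rightarrow> 'v rel set \<Rightarrow> 'v rel list \<Rightarrow> 'v \<Rightarrow> 'v set set" where
  "beta G \<P> u v = kappa G \<P> ` (word_rel G u `` {v})"

record 'v certificate =
  fork_state :: 'v
  chan_A :: "'v rel"
  chan_B :: "'v rel"
  fork_l :: 'v
  fork_r :: 'v
  offload_word :: "'v rel list"
  off_p :: 'v
  off_q :: 'v
  orbit_word :: "'v rel list"
  use_word :: "'v rel list"

definition fork_ok :: "'v pair_pre_digraph \<Rightarrow> 'v rel set \<Rightarrow> 'v certificate \<Rightarrow> bool" where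
  "fork_ok G \<P> c \<longleftrightarrow> fork_state c \<in> pverts G \<and> chan_A c \<in> \<P> \<and> chan_B c \<in> \<P> \<and>
     fork_l c \<in> chan_A c `` {fork_state c} \<and> fork_r c \<in> chan_B c `` {fork_state c} \<and>
     kappa G \<P> (fork_l c) \<noteq> kappa G \<P> (fork_r c)"

definition offload_ok :: "'v pair_pre_digraph \<Rightarrow> 'v rel set \<Rightarrow> 'v certificate \<Rightarrow> bool" where
  "offload_ok G \<P> c \<longleftrightarrow> is_word \<P> (offload_word c) \<and>
     word_rel G (offload_word c) `` {fork_l c} = {off_p c} \<and>
     word_rel G (offload_word c) `` {fork_r c} = {off_q c} \<and>
     off_p c \<noteq> off_q c \<and> kappa G \<P> (off_p c) \<noteq> kappa G \<P> (off_q c) \<and>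
     (\<forall>C \<in> {chan_A c, chan_B c}. C `` {off_p c} \<noteq> {} \<longleftrightarrow> C `` {off_q c} \<noteq> {})"

definition orbit_iterate :: "'v pair_pre_digraph \<Rightarrow> 'v certificate \<Rightarrow> nat \<Rightarrow> ('v \<times> 'v) option" where
  "orbit_iterate G c = pair_iterate (word_rel G (orbit_word c)) (off_p c, off_q c)"

definition persistent_ok :: "'v pair_pre_digraph \<Rightarrow> 'v rel set \<Rightarrow> 'v certificate \<Rightarrow> bool" where
  "persistent_ok G \<P> c \<longleftrightarrow> is_word \<P> (orbit_word c) \<and> orbit_word c \<noteq> [] \<and>
     word_rel G (orbit_word c) \<noteq> Id_on (pverts G) \<and>
     (\<forall>n. \<exists>a b. orbit_iterate G c n = Some (a, b) \<and> kappa G \<P> a \<noteq> kappa G \<P> b) \<and>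
     (\<exists>n. orbit_iterate G c (Suc n) \<noteq> orbit_iterate G c n)"

definition use_ok :: "'v pair_pre_digraph \<Rightarrow> 'v rel set \<Rightarrow> 'v certificate \<Rightarrow> bool" where
  "use_ok G \<P> c \<longleftrightarrow> is_word \<P> (use_word c) \<and> use_word c \<noteq> [] \<and>
     word_rel G (use_word c) \<noteq> Id_on (pverts G) \<and>
     beta G \<P> (use_word c) (off_p c) \<noteq> beta G \<P> (use_word c) (off_q c) \<and>
     (beta G \<P> (use_word c) (off_p c), beta G \<P> (use_word c) (off_q c))
       \<noteq> ({kappa G \<P> (off_p c)}, {kappa G \<P> (off_q c)})"

definition wpu_certificate :: "'v pair_pre_digraph \<Rightarrow> 'v rel set \<Rightarrow> 'v certificate \<Rightarrow> bool" where
  "wpu_certificate G \<P> c \<longleftrightarrow>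
     fork_ok G \<P> c \<and> offload_ok G \<P> c \<and> persistent_ok G \<P> c \<and> use_ok G \<P> c"

text \<open>
  The persistent pair orbit as a total sequence; on a WPU certificate all iterates are defined.
\<close>

definition pair_orbit :: "'v pair_pre_digraph \<Rightarrow> 'v certificate \<Rightarrow> nat \<Rightarrow> 'v \<times> 'v" where
  "pair_orbit G c n = the (orbit_iterate G c n)"

definition cert_class_pair :: "'v pair_pre_digraph \<Rightarrow> 'v rel set \<Rightarrow> 'v certificate \<Rightarrow> 'v set set" where
  "cert_class_pair G \<P> c = {kappa G \<P> (off_p c), kappa G \<P> (off_q c)}"

definition cert_support :: "'v pair_pre_digraph \<Rightarrow> 'v certificate \<Rightarrow> 'v set" where
  "cert_support G c = range (fst \<circ> pair_orbit G c) \<union> range (snd \<circ> pair_orbit G c)"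


section \<open>Record systems and translations\<close>

text \<open>
  A record system is its set of certificates. Two record systems are distinct when these sets
  differ, even if their class pairs and supports coincide.
\<close>

type_synonym 'v record_sys = "'v certificate set"

definition sys_support :: "'v pair_pre_digraph \<Rightarrow> 'v record_sys \<Rightarrow> 'v set" where
  "sys_support G X = (\<Union>c \<in> X. cert_support G c)"

definition sys_class_pair :: "'v pair_pre_digraph \<Rightarrow> 'v rel set \<Rightarrow> 'v record_sys \<Rightarrow> 'v set set" where
  "sys_class_pair G \<P> X = (THE K. \<forall>c \<in> X. cert_class_pair G \<P> c = K)"

definition representatives :: "'v pair_pre_digraph \<Rightarrow> 'v record_sys \<Rightarrow> 'v set \<Rightarrow> 'v set" where
  "representatives G X k = sys_support G X \<inter> k"

definition record_system :: "'v pair_pre_digraph \<Rightarrow> 'v rel set \<Rightarrow> 'v record_sys \<Rightarrow> bool" where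
  "record_system G \<P> X \<longleftrightarrow> finite X \<and> X \<noteq> {} \<and> (\<forall>c \<in> X. wpu_certificate G \<P> c) \<and>
     (\<exists>K. \<forall>c \<in> X. cert_class_pair G \<P> c = K) \<and>
     (\<forall>k \<in> sys_class_pair G \<P> X. representatives G X k \<noteq> {})"

definition entry :: "'a \<times> 'a \<Rightarrow> nat \<Rightarrow> 'a" where
  "entry xy i = (if i = 0 then fst xy else snd xy)"

text \<open>
  \<open>pres\<close> presents each class pair as an ordered pair. The permutation \<open>\<pi>\<close> is determined by
  the word \<open>t\<close>, since the representative sets of a record system are nonempty.
\<close>

definition induces_translation ::
  "'v pair_pre_digraph \<Rightarrow> 'v rel set \<Rightarrow> ('v record_sys \<Rightarrow> 'v set \<times> 'v set) \<Rightarrow>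
   'v record_sys \<Rightarrow> 'v rel list \<Rightarrow> (nat \<Rightarrow> nat) \<Rightarrow> 'v record_sys \<Rightarrow> bool" where
  "induces_translation G \<P> pres X t \<pi> Y \<longleftrightarrow>
     X \<noteq> Y \<and> is_word \<P> t \<and> t \<noteq> [] \<and> \<pi> permutes {0, 1} \<and>
     (\<forall>i \<in> {0, 1}. \<forall>v \<in> representatives G X (entry (pres X) i).
        \<exists>w. word_rel G t `` {v} = {w} \<and> w \<in> sys_support G Y \<and>
            kappa G \<P> w = entry (pres Y) (\<pi> i))"

definition gain :: "(nat \<Rightarrow> nat) \<Rightarrow> nat" where
  "gain \<pi> = (if evenperm \<pi> then 0 else 1)"

definition translation_multigraph ::
  "'v pair_pre_digraph \<Rightarrow> 'v rel set \<Rightarrow> ('v record_sys \<Rightarrow> 'v set \<times> 'v set) \<Rightarrow> 'v record_sys set \<Rightarrow>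
   ('v record_sys, 'v record_sys \<times> 'v rel list \<times> (nat \<Rightarrow> nat) \<times> 'v record_sys) pre_digraph" where
  "translation_multigraph G \<P> pres F = \<lparr>
     verts = F,
     arcs = {(X, t, \<pi>, Y). X \<in> F \<and> Y \<in> F \<and> induces_translation G \<P> pres X t \<pi> Y},
     tail = (\<lambda>(X, t, \<pi>, Y). X),
     head = (\<lambda>(X, t, \<pi>, Y). Y)\<rparr>"


section \<open>The property H\<close>

definition eventual_period :: "(nat \<Rightarrow> 'a) \<Rightarrow> nat" where
  "eventual_period \<sigma> = (LEAST m. m > 0 \<and> (\<exists>N. \<forall>n \<ge> N. \<sigma> (n + m) = \<sigma> n))"

definition preperiod :: "(nat \<Rightarrow> 'a) \<Rightarrow> nat" where
  "preperiod \<sigma> = (LEAST N. \<forall>n \<ge> N. \<sigma> (n + eventual_period \<sigma>) = \<sigma> n)"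

definition cond_E1 :: "'v record_sys set \<Rightarrow> bool" where
  "cond_E1 F \<longleftrightarrow> card F \<ge> 2"

definition cond_E2 ::
  "'v pair_pre_digraph \<Rightarrow> 'v rel set \<Rightarrow> ('v record_sys \<Rightarrow> 'v set \<times> 'v set) \<Rightarrow> 'v record_sys set \<Rightarrow> bool" where
  "cond_E2 G \<P> pres F \<longleftrightarrow> (\<exists>X \<in> F. \<exists>Y \<in> F. X \<noteq> Y \<and>
     (\<exists>t \<pi>. induces_translation G \<P> pres X t \<pi> Y) \<and>
     (\<exists>t \<pi>. induces_translation G \<P> pres Y t \<pi> X))"

definition cond_E3 :: "'v pair_pre_digraph \<Rightarrow> 'v record_sys set \<Rightarrow> bool" where
  "cond_E3 G F \<longleftrightarrow> (\<exists>X \<in> F. \<exists>Y \<in> F.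
     sys_support G X \<subset> sys_support G Y \<or>
     (sys_support G X \<inter> sys_support G Y \<noteq> {} \<and>
      \<not> sys_support G X \<subseteq> sys_support G Y \<and> \<not> sys_support G Y \<subseteq> sys_support G X))"

definition cond_E4 :: "'v pair_pre_digraph \<Rightarrow> 'v rel set \<Rightarrow> 'v record_sys set \<Rightarrow> bool" where
  "cond_E4 G \<P> F \<longleftrightarrow> (\<exists>X \<in> F. \<exists>Y \<in> F. \<exists>c \<in> X. \<exists>j \<in> {0, 1}. \<exists>r y.
     X \<noteq> Y \<and> is_word \<P> r \<and> r \<noteq> [] \<and>
     (let m = eventual_period (pair_orbit G c); N = preperiod (pair_orbit G c) in
       m > 1 \<and>
       (\<forall>h < m. word_rel G r `` {entry (pair_orbit G c (N + h)) j} = {y h} \<and>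
          y h \<in> sys_support G Y \<and> kappa G \<P> (y h) \<in> sys_class_pair G \<P> Y) \<and>
       (\<exists>h < m. \<exists>h' < m. kappa G \<P> (y h) \<noteq> kappa G \<P> (y h'))))"

definition cond_E5 ::
  "'v pair_pre_digraph \<Rightarrow> 'v rel set \<Rightarrow> ('v record_sys \<Rightarrow> 'v set \<times> 'v set) \<Rightarrow> 'v record_sys set \<Rightarrow> bool" where
  "cond_E5 G \<P> pres F \<longleftrightarrow> (\<exists>X walk.
     pre_digraph.awalk (translation_multigraph G \<P> pres F) X walk X \<and>
     odd (\<Sum>(Y, t, \<pi>, Z) \<leftarrow> walk. gain \<pi>))"

text \<open>
  Quantifying existentially over \<open>pres\<close> is immaterial: changing the presentation of one record
  system flips the gain of every arc entering or leaving it, which preserves the parity of closed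
  walks, as there are no loops.
\<close>

definition property_H :: "'v pair_pre_digraph \<Rightarrow> 'v rel set \<Rightarrow> nat" where
  "property_H G \<P> = (if \<exists>F pres.
       finite F \<and> (\<forall>X \<in> F. record_system G \<P> X) \<and>
       (\<forall>X \<in> F. {fst (pres X), snd (pres X)} = sys_class_pair G \<P> X) \<and>
       cond_E1 F \<and> cond_E2 G \<P> pres F \<and> cond_E3 G F \<and> cond_E4 G \<P> F \<and> cond_E5 G \<P> pres F
     then 1 else 0)"

text \<open>The edges of the catalogue graph of row 3388 on which two roles are exchanged.\<close>

definition inc_edges :: "(nat \<times> nat) set" where
  "inc_edges = {(0,1), (18,1), (18,17), (14,17), (14,15), (1,15),
     (1,0), (17,0), (17,18), (15,18), (15,14), (0,14)}"

end

theory Submission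
  imports Defs "HOL-Library.Code_Binary_Nat"
begin

text \<open>
  All objects of the theorem are finite and are computed inside the logic by rewriting with code
  equations. Three ideas keep the computations small.

  The core of an exploration is certified by listing the expanded states in layers, the core being
  the first one, such that no rewrite leads back to an earlier layer: every other strongly connected
  component lies within one of the later layers, and these are smaller than the core.

  A singleton incidence fibre is certified by weights of role and endpoint. Their sum over all edges
  is constant on the fibre, and the given assignment is heaviest on every edge separately.

  For the property H, three certificates whose orbit word swaps two states suffice; a word that kills one
  state but not the other tells their behavioural classes apart, so the quotient need not be computed.
\<close>

section \<open>Executable rewriting\<close>

text \<open>The labelling of the blocks is an arbitrary bijection, so block numbers and role labels
  must be kept apart: all evaluated data refer to block numbers, and \<open>\<rho>\<close>
  translates them into the labels of the given assignment. A state first met at distance 3 has no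
  outgoing arc in the explored graph. A cyclic component therefore consists of states at distance at
  most 2, and only these are ever listed. Evaluation by rewriting is slow, so each finite fact is
  given a witness that one pass can check: the order of the edges inside a block shows that the
  block is connected, the order of the core states is their numbering, the order of the layers
  excludes return. Equality of behavioural classes would require the quotient. The certificates are
  arranged so that two classes are claimed equal only when they belong to the same state.\<close>

fun binding :: "trm \<Rightarrow> trm \<Rightarrow> trm option" where
  "binding TV t = Some t"
| "binding (TP p q) (TP s t) = (case binding p s of None \<Rightarrow> binding q t | Some u \<Rightarrow> Some u)"
| "binding (TR p q) (TR s t) = (case binding p s of None \<Rightarrow> binding q t | Some u \<Rightarrow> Some u)"
| "binding _ _ = None"

lemma binding_inst_V: "binding p (inst_V u p) = (if has_V p then Some u else None)"
  by (induction p) auto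

lemma inst_V_closed: "\<not> has_V p \<Longrightarrow> inst_V u p = p"
  by (induction p) auto

text \<open>\<open>binding\<close> only proposes a candidate, found at one occurrence of the
  placeholder. Instantiating \<open>p\<close> with it and comparing with \<open>t\<close> checks the
  other occurrences and the remaining structure at once.\<close>

definition root_rewrites :: "trm \<Rightarrow> trm \<Rightarrow> trm \<Rightarrow> trm list" where
  "root_rewrites p q t =
    (if t = TV then []
     else if has_V p then
       (case binding p t of
          None \<Rightarrow> []
        | Some u \<Rightarrow> if inst_V u p = t then [inst_V u q] else [])
     else if p = t then [q] else [])"

text \<open>For closed \<open>p\<close> and open \<open>q\<close> every \<open>u\<close> would give
  a different result. The premise, which validity grants for every rule, excludes this: either the
  match determines \<open>u\<close>, or \<open>q\<close> is closed as well.\<close>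

lemma set_root_rewrites:
  assumes "has_V q \<longrightarrow> has_V p"
  shows "set (root_rewrites p q t) = {inst_V u q | u. inst_V u p = t \<and> t \<noteq> TV}"
proof (cases "has_V p")
  case True
  then have "\<forall>u. inst_V u p = t \<longrightarrow> binding p t = Some u"
    using binding_inst_V[of p] by auto
  with True show ?thesis
    by (cases "binding p t") (auto simp: root_rewrites_def)
next
  case False
  with assms show ?thesis
    by (auto simp: root_rewrites_def inst_V_closed)
qed

primrec all_rewrites :: "trm \<Rightarrow> trm \<Rightarrow> trm \<Rightarrow> trm list" where
  "all_rewrites p q TA = root_rewrites p q TA"
| "all_rewrites p q TV = root_rewrites p q TV"
| "all_rewrites p q (TP s t) = root_rewrites p q (TP s t) @
     map (\<lambda>s'. TP s' t) (all_rewrites p q s) @ map (TP s) (all_rewrites p q t)"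
| "all_rewrites p q (TR s t) = root_rewrites p q (TR s t) @
     map (\<lambda>s'. TR s' t) (all_rewrites p q s) @ map (TR s) (all_rewrites p q t)"

lemma root_rewrites_subset: "set (root_rewrites p q t) \<subseteq> set (all_rewrites p q t)"
  by (cases t) auto

lemma rewrites_to_iff:
  assumes "has_V q \<longrightarrow> has_V p"
  shows "rewrites_to p q t t' \<longleftrightarrow> t' \<in> set (all_rewrites p q t)"
proof
  assume "rewrites_to p q t t'"
  then show "t' \<in> set (all_rewrites p q t)"
  proof induction
    case (root u)
    then have "inst_V u q \<in> set (root_rewrites p q (inst_V u p))"
      by (auto simp: set_root_rewrites[OF assms])
    then show ?case
      using root_rewrites_subset by blast
  qed auto
next
  have root: "rewrites_to p q t t'" if "t' \<in> set (root_rewrites p q t)" for t t'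
    using that by (auto simp: set_root_rewrites[OF assms] intro: rewrites_to.root)
  show "t' \<in> set (all_rewrites p q t) \<Longrightarrow> rewrites_to p q t t'"
    by (induction t arbitrary: t') (auto intro: root rewrites_to.intros)
qed

section \<open>The ASCII order on terms, computed by structural recursion\<close>

lemma append_less_append_iff:
  fixes xs ys :: "'a::linorder list"
  assumes "\<And>us vs. xs @ us \<noteq> ys @ vs"
  shows "xs @ us < ys @ vs \<longleftrightarrow> xs < ys"
  using assms
proof (induction xs arbitrary: ys)
  case Nil
  then show ?case by (metis append_Nil)
next
  case (Cons x xs)
  show ?case
  proof (cases ys)
    case Nil
    then show ?thesis using Cons.prems by (metis append_Nil)
  next
    case [simp]: (Cons y zs)
    show ?thesis
      using Cons.IH[of zs] Cons.prems by (cases "x = y") auto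
  qed
qed

text \<open>Printed terms are prefix-free by \<open>show_trm_append_inject\<close>. Different terms
  thus differ at a position inside both strings, and the suffixes decide only when the terms
  agree.\<close>

lemma show_trm_append_less_iff:
  "show_trm s @ xs < show_trm t @ ys \<longleftrightarrow> s < t \<or> s = t \<and> xs < ys"
proof (cases "s = t")
  case True
  have "us @ xs < us @ ys \<longleftrightarrow> xs < ys" for us :: string
    by (induction us) auto
  with True show ?thesis by auto
next
  case False
  then have "show_trm s @ us \<noteq> show_trm t @ vs" for us vs
    using show_trm_append_inject by blast
  from append_less_append_iff[OF this] False show ?thesis
    by (simp add: less_trm_def)
qed

text \<open>In ASCII the head symbols come in the order \<open>A\<close>, \<open>P\<close>,
  \<open>R\<close>, \<open>V\<close>; under equal heads, prefix-freeness leaves a lexicographic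
  comparison of the arguments.\<close>

lemma less_trm_simps [simp]:
  "t < TA \<longleftrightarrow> False"
  "TA < TV" "TA < TP a b" "TA < TR a b"
  "\<not> TV < TV" "\<not> TV < TP a b" "\<not> TV < TR a b"
  "TP a b < TV" "TP a b < TP c d \<longleftrightarrow> a < c \<or> a = c \<and> b < d" "TP a b < TR c d"
  "TR a b < TV" "\<not> TR a b < TP c d" "TR a b < TR c d \<longleftrightarrow> a < c \<or> a = c \<and> b < d"
proof -
  show "TP a b < TP c d \<longleftrightarrow> a < c \<or> a = c \<and> b < d" "TR a b < TR c d \<longleftrightarrow> a < c \<or> a = c \<and> b < d"
    by (simp_all add: less_trm_def[of "TP a b"] less_trm_def[of "TR a b"] show_trm_append_less_iff)
qed (cases t; simp add: less_trm_def less_char_def)+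

text \<open>As code equations these let \<open>sorted\<close> and \<open>insort\<close> run without
  printing any term.\<close>

lemma less_eq_trm_simps [simp, code]:
  "TA \<le> t \<longleftrightarrow> True"
  "TV \<le> TA \<longleftrightarrow> False" "TV \<le> TV \<longleftrightarrow> True" "TV \<le> TP a b \<longleftrightarrow> False" "TV \<le> TR a b \<longleftrightarrow> False"
  "TP a b \<le> TA \<longleftrightarrow> False" "TP a b \<le> TV \<longleftrightarrow> True"
  "TP a b \<le> TP c d \<longleftrightarrow> (if a = c then b \<le> d else a \<le> c)" "TP a b \<le> TR c d \<longleftrightarrow> True"
  "TR a b \<le> TA \<longleftrightarrow> False" "TR a b \<le> TV \<longleftrightarrow> True"
  "TR a b \<le> TP c d \<longleftrightarrow> False" "TR a b \<le> TR c d \<longleftrightarrow> (if a = c then b \<le> d else a \<le> c)"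
  by (cases t) (auto simp: le_less)

section \<open>Successors of a state as sorted lists\<close>

definition state_succs :: "trm list \<Rightarrow> trm list list" where
  "state_succs xs = concat (map (\<lambda>r. case r of
       TR p q \<Rightarrow> concat (map (\<lambda>t. map (\<lambda>t'. insort t' (remove1 t xs))
         (filter valid_component (all_rewrites p q t))) xs)
     | _ \<Rightarrow> []) xs)"

lemma set_state_succs:
  "set (state_succs xs) = {insort t' (remove1 t xs) | p q t t'.
     TR p q \<in> set xs \<and> t \<in> set xs \<and> valid_component t' \<and> t' \<in> set (all_rewrites p q t)}"
  by (fastforce simp: state_succs_def split: trm.splits)

text \<open>\<open>state_succs\<close> tests the validity of the changed component but not its size,
  so it covers all retained rewrites. Validity of the source makes every one of its rules eligible
  for \<open>rewrites_to_iff\<close>.\<close>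

lemma retained_imp_state_succs:
  assumes "(mset xs, S) \<in> retained" "list_all valid_component xs"
  obtains ys where "ys \<in> set (state_succs xs)" "S = mset ys"
proof -
  from assms obtain p q t t' where *: "TR p q \<in> set xs" "t \<in> set xs" "rewrites_to p q t t'"
    "S = add_mset t' (mset xs - {#t#})" "valid_state S"
    by (auto simp: retained_def)
  have "has_V q \<longrightarrow> has_V p"
    using * assms(2) by (auto simp: list_all_iff dest!: bspec)
  then have "t' \<in> set (all_rewrites p q t)"
    using * by (simp add: rewrites_to_iff)
  moreover have "valid_component t'"
    using * by (simp add: valid_state_def)
  ultimately have "insort t' (remove1 t xs) \<in> set (state_succs xs)"
    using * unfolding set_state_succs by blast
  moreover have "S = mset (insort t' (remove1 t xs))"
    using * by simp
  ultimately show ?thesis using that by blast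
qed

text \<open>In this direction the size bound has to be supplied; asking for it on all components of
  \<open>ys\<close> includes the changed one.\<close>

lemma state_succs_imp_retained:
  assumes "ys \<in> set (state_succs xs)" "list_all valid_component xs" "\<forall>t \<in> set ys. term_size t \<le> 255"
  shows "(mset xs, mset ys) \<in> retained"
proof -
  from assms(1) obtain p q t t' where *: "TR p q \<in> set xs" "t \<in> set xs" "valid_component t'"
    "t' \<in> set (all_rewrites p q t)" "ys = insort t' (remove1 t xs)"
    unfolding set_state_succs by blast
  have "has_V q \<longrightarrow> has_V p"
    using * assms(2) by (auto simp: list_all_iff dest!: bspec)
  then have "rewrites_to p q t t'"
    using * by (simp add: rewrites_to_iff)
  moreover have "valid_state (add_mset t' (mset xs - {#t#}))"
    using * assms(2) by (auto simp: valid_state_def list_all_iff dest: in_diffD)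
  ultimately show ?thesis
    using * assms(3) unfolding retained_def by (auto simp: set_insort_key)
qed

lemma sorted_state_succs: "sorted xs \<Longrightarrow> ys \<in> set (state_succs xs) \<Longrightarrow> sorted ys"
  unfolding set_state_succs by (auto simp: sorted_insort sorted_remove1)

section \<open>Strongly connected components of the explored graph\<close>

lemma rel_inv_rtrancl:
  assumes "(x, y) \<in> r\<^sup>*" "P x" "\<And>u v. (u, v) \<in> r \<Longrightarrow> P u \<Longrightarrow> P v"
  shows "P y"
  using assms by (induction rule: rtrancl_induct) auto

lemma relpow_converse_iff:
  fixes r :: "'a rel"
  shows "(x, y) \<in> (r\<inverse>) ^^ n \<longleftrightarrow> (y, x) \<in> r ^^ n"
proof (induction n arbitrary: y)
  case (Suc n)
  have "(y, x) \<in> r ^^ Suc n \<longleftrightarrow> (\<exists>z. (y, z) \<in> r \<and> (z, x) \<in> r ^^ n)"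
    by (meson relpow_Suc_D2 relpow_Suc_I2)
  with Suc show ?case by auto
qed auto

lemma arcs_ends_with_proj: "arcs_ends (with_proj G) = parcs G"
  by (auto simp: arcs_ends_def arc_to_ends_def)

lemma pair_wf_explored: "pair_wf_digraph (explored seed)"
proof
  fix e
  assume "e \<in> parcs (explored seed)"
  then obtain n where n: "n < 3" "(seed, fst e) \<in> retained ^^ n" "(fst e, snd e) \<in> retained"
    by (auto simp: explored_def)
  then have "(seed, snd e) \<in> retained ^^ Suc n"
    by auto
  with n show "fst e \<in> pverts (explored seed)" "snd e \<in> pverts (explored seed)"
    unfolding explored_def by (simp_all del: relpow.simps) (metis less_imp_le, metis Suc_leI)
qed

text \<open>Replaces the reachability of the graph library by a reflexive transitive closure. The
  vertex condition remains because the closure is reflexive at non-vertices too.\<close>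

lemma reachable_explored:
  "u \<rightarrow>\<^sup>*\<^bsub>with_proj (explored seed)\<^esub> v \<longleftrightarrow>
     u \<in> pverts (explored seed) \<and> (u, v) \<in> (parcs (explored seed))\<^sup>*"
proof -
  interpret pair_wf_digraph "explored seed"
    by (rule pair_wf_explored)
  have "u \<in> pverts (explored seed) \<and> (u, v) \<in> (parcs (explored seed))\<^sup>*"
    if "u \<rightarrow>\<^sup>*\<^bsub>with_proj (explored seed)\<^esub> v"
    using that reachable_rtranclI reachable_in_verts(1) arcs_ends_with_proj by fastforce
  moreover have "u \<rightarrow>\<^sup>*\<^bsub>with_proj (explored seed)\<^esub> v"
    if "(u, v) \<in> (parcs (explored seed))\<^sup>*" "u \<in> pverts (explored seed)"
    using that
  proof (induction rule: rtrancl_induct)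
    case base
    then show ?case by auto
  next
    case (step y z)
    then show ?case
      using reachable_adj_trans by (auto simp: arcs_ends_with_proj)
  qed
  ultimately show ?thesis by blast
qed

text \<open>\<open>As\<close> accumulates the earlier layers. Arcs inside a layer, to later layers,
  or to states outside all layers stay allowed.\<close>

fun layered :: "trm list list \<Rightarrow> trm list list list \<Rightarrow> bool" where
  "layered As [] \<longleftrightarrow> True"
| "layered As (B # Bs) \<longleftrightarrow>
     list_all (\<lambda>xs. list_all (\<lambda>ys. ys \<notin> set As) (state_succs xs)) B \<and> layered (As @ B) Bs"

lemma layered_no_return:
  assumes "layered As Bs" "xs \<in> set (concat (drop k Bs))" "ys \<in> set (state_succs xs)"
  shows "ys \<notin> set As \<union> set (concat (take k Bs))"
  using assms
proof (induction As Bs arbitrary: k rule: layered.induct)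
  case (1 As)
  then show ?case by simp
next
  case (2 As B Bs)
  have IH: "ys \<notin> set (As @ B) \<union> set (concat (take j Bs))" if "xs \<in> set (concat (drop j Bs))" for j
    using "2.IH"[of j] "2.prems"(1,3) that by simp
  show ?case
  proof (cases k)
    case 0
    with "2.prems"(2) consider "xs \<in> set B" | "xs \<in> set (concat (drop 0 Bs))"
      by auto
    then show ?thesis
    proof cases
      case 1
      with "2.prems"(1,3) 0 show ?thesis by (simp add: list_all_iff)
    next
      case 2
      with IH[OF 2] 0 show ?thesis by simp
    qed
  next
    case (Suc j)
    with "2.prems"(2) IH[of j] show ?thesis by simp
  qed
qed

text \<open>One round of backward search; forward search is the same on swapped edges. Filtering
  \<open>[0..<n]\<close> keeps the list sorted and free of repetitions, so that saturation is an
  equality with \<open>[0..<n]\<close>.\<close>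

definition grow :: "nat \<Rightarrow> (nat \<times> nat) list \<Rightarrow> nat list \<Rightarrow> nat list" where
  "grow n E vs = (let us = vs @ map fst (filter (\<lambda>e. snd e \<in> set vs) E) in
     filter (\<lambda>u. u \<in> set us) [0..<n])"

lemma set_grow: "set (grow n E vs) = {u. u < n \<and> (u \<in> set vs \<or> (\<exists>w. (u, w) \<in> set E \<and> w \<in> set vs))}"
  by (force simp: grow_def Let_def)

lemma grow_relpow:
  assumes "u \<in> set ((grow n E ^^ k) [v])"
  shows "\<exists>m \<le> k. (u, v) \<in> set E ^^ m"
  using assms
proof (induction k arbitrary: u)
  case 0
  then show ?case by auto
next
  case (Suc k)
  then consider "u \<in> set ((grow n E ^^ k) [v])"
    | w where "(u, w) \<in> set E" "w \<in> set ((grow n E ^^ k) [v])"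
    by (auto simp: set_grow)
  then show ?case
  proof cases
    case 1
    with Suc.IH show ?thesis using le_Suc_eq by blast
  next
    case 2
    with Suc.IH obtain m where "m \<le> k" "(w, v) \<in> set E ^^ m" by blast
    with 2(1) have "(u, v) \<in> set E ^^ Suc m" by (meson relpow_Suc_I2)
    with \<open>m \<le> k\<close> show ?thesis by (meson Suc_le_mono)
  qed
qed

lemma state_string_mset: "sorted xs \<Longrightarrow> state_string (mset xs) = ''{'' @ join '';'' (map show_trm xs) @ ''}''"
  by (simp add: state_string_def sorted_sort_id)

text \<open>With different lengths a separator could be compared with the closing text
  \<open>zs\<close>. Core states all have three components, so for them string order is the
  lexicographic order of component lists.\<close>

lemma join_less_iff:
  "length xs = length ys \<Longrightarrow>
    join [c] (map show_trm xs) @ zs < join [c] (map show_trm ys) @ zs \<longleftrightarrow> xs < ys"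
proof (induction xs ys rule: list_induct2)
  case Nil
  then show ?case by simp
next
  case (Cons x xs y ys)
  show ?case
  proof (cases xs)
    case Nil
    with Cons.hyps show ?thesis by (auto simp: show_trm_append_less_iff)
  next
    case (Cons x' xs')
    moreover then obtain y' ys' where "ys = y' # ys'"
      using Cons.hyps by (cases ys) auto
    ultimately show ?thesis
      using Cons.IH by (auto simp: show_trm_append_less_iff)
  qed
qed

text \<open>
  \<open>L\<close> lists the core in the order of its state strings and \<open>Os\<close> the other expanded states, split
  into layers smaller than the core so that no rewrite leads to an earlier layer.
\<close>

locale explored_core =
  fixes seed :: "trm list" and i0 :: nat and L :: "trm list list" and Os :: "trm list list list"
    and E :: "(nat \<times> nat) list"
  assumes seed_nth: "i0 < length L \<and> L ! i0 = seed"
    and well_formed: "list_all (\<lambda>xs. sorted xs \<and> list_all valid_component xs) (concat (L # Os))"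
    and core_shape: "list_all (\<lambda>xs. length xs = 3 \<and> list_all (\<lambda>t. term_size t \<le> 255) xs) L"
    and L_sorted: "sorted_wrt (<) L"
    and layered: "layered [] (L # Os)"
    and cover: "let D = concat (L # Os) in
        list_all (\<lambda>ys. ys \<in> set D \<and> list_all (\<lambda>zs. zs \<in> set D) (state_succs ys)) (state_succs seed)"
    and layer_length: "list_all (\<lambda>B. length B < length L) Os"
    and succs_E: "list_all (\<lambda>(i, xs).
        let ys = state_succs xs; zs = map (\<lambda>e. L ! snd e) (filter (\<lambda>e. fst e = i) E) in
        list_all (\<lambda>z. z \<in> set ys) zs \<and>
        list_all (\<lambda>y. y \<in> set zs \<or> y = xs \<or> y \<notin> set L) ys) (zip [0..<length L] L)"
    and E_irrefl: "list_all (\<lambda>(i, j). i < length L \<and> j < length L \<and> i \<noteq> j) E"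
    and forward: "(grow (length L) (map prod.swap E) ^^ 2) [i0] = [0..<length L]"
    and backward: "(grow (length L) E ^^ 3) [i0] = [0..<length L]"
    and signatures: "(0, 1) \<in> set E \<and> filter is_rule (L ! 0) \<noteq> filter is_rule (L ! 1) \<and>
        \<not> list_all (\<lambda>xs. filter (\<lambda>t. \<not> is_rule t) xs = filter (\<lambda>t. \<not> is_rule t) (L ! 0)) L"
begin

abbreviation "R \<equiv> parcs (explored (mset seed))"
abbreviation "C \<equiv> mset ` set L"

lemma core_image: "C = (\<lambda>i. mset (L ! i)) ` {..<length L}"
proof -
  have "set L = (!) L ` {..<length L}"
    by (auto simp: set_conv_nth)
  then show ?thesis by (simp add: image_image)
qed

lemma seed_in: "seed \<in> set L"
  using seed_nth by auto

lemma all_sorted: "xs \<in> set (concat (L # Os)) \<Longrightarrow> sorted xs"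
  and all_valid: "xs \<in> set (concat (L # Os)) \<Longrightarrow> list_all valid_component xs"
  using well_formed by (auto simp: list_all_iff)

lemma mset_inject: "sorted xs \<Longrightarrow> sorted ys \<Longrightarrow> mset xs = mset ys \<longleftrightarrow> xs = ys"
  by (metis properties_for_sort)

text \<open>Arcs start at distance 0, 1 or 2, the range that \<open>cover\<close> checks by
  expanding the seed twice.\<close>

lemma source_in_layers:
  assumes "(S, T) \<in> R"
  obtains xs where "xs \<in> set (concat (L # Os))" "S = mset xs"
proof -
  obtain n where "n < 3" and n: "(mset seed, S) \<in> retained ^^ n"
    using assms by (auto simp: explored_def)
  from \<open>n < 3\<close> consider "n = 0" | "n = 1" | "n = 2" by linarith
  then show ?thesis
  proof cases
    case 1
    with n that[of seed] seed_in show ?thesis by auto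
  next
    case 2
    with n have "(mset seed, S) \<in> retained" by simp
    then obtain ys where "ys \<in> set (state_succs seed)" "S = mset ys"
      using retained_imp_state_succs all_valid seed_in by (metis UnCI concat.simps(2) set_append)
    with that[of ys] cover show ?thesis
      by (auto simp: list_all_iff Let_def)
  next
    case 3
    with n obtain T where T: "(mset seed, T) \<in> retained" "(T, S) \<in> retained"
      by (auto simp: numeral_2_eq_2)
    then obtain ys where ys: "ys \<in> set (state_succs seed)" "T = mset ys"
      using retained_imp_state_succs all_valid seed_in by (metis UnCI concat.simps(2) set_append)
    then have "ys \<in> set (concat (L # Os))"
      using cover by (auto simp: list_all_iff Let_def)
    with T(2) ys(2) obtain zs where "zs \<in> set (state_succs ys)" "S = mset zs"
      using retained_imp_state_succs all_valid by metis
    with that[of zs] cover ys show ?thesis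
      by (auto simp: list_all_iff Let_def)
  qed
qed

text \<open>The core counts as the first layer. The complement of each of these sets is closed under
  arcs, which confines every component to one layer.\<close>

definition "initial k = mset ` set (concat (take k (L # Os)))"

lemma no_return:
  assumes "(S, T) \<in> R" "S \<notin> initial k"
  shows "T \<notin> initial k"
proof
  assume "T \<in> initial k"
  then obtain zs where zs: "zs \<in> set (concat (take k (L # Os)))" "T = mset zs"
    by (auto simp: initial_def)
  obtain xs where xs: "xs \<in> set (concat (L # Os))" "S = mset xs"
    using assms(1) by (rule source_in_layers)
  have "xs \<notin> set (concat (take k (L # Os)))"
    using xs assms(2) unfolding initial_def by blast
  with xs(1) have *: "xs \<in> set (concat (drop k (L # Os)))"
    by (metis UnE append_take_drop_id concat_append set_append)
  have "(mset xs, T) \<in> retained"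
    using assms(1) xs by (auto simp: explored_def)
  then obtain ys where ys: "ys \<in> set (state_succs xs)" "T = mset ys"
    using retained_imp_state_succs all_valid xs by metis
  then have "sorted ys"
    using sorted_state_succs all_sorted xs by metis
  moreover have "sorted zs"
    using zs(1) all_sorted set_take_subset[of k "L # Os"] by fastforce
  ultimately have "ys = zs"
    using ys zs mset_inject by metis
  with layered_no_return[OF layered * ys(1)] zs(1) show False by simp
qed

lemma reach_initial: "(S, T) \<in> R\<^sup>* \<Longrightarrow> T \<in> initial k \<Longrightarrow> S \<in> initial k"
  using rel_inv_rtrancl[of S T R "\<lambda>S. S \<notin> initial k"] no_return by blast

lemma initial_1: "initial 1 = C"
  by (simp add: initial_def)

lemma E_succs:
  "(i, j) \<in> set E \<longleftrightarrow> i < length L \<and> j < length L \<and> i \<noteq> j \<and> L ! j \<in> set (state_succs (L ! i))"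
proof -
  have dist: "distinct L"
    using L_sorted by (simp add: strict_sorted_iff)
  have zip: "(i, L ! i) \<in> set (zip [0..<length L] L)" if "i < length L"
    using that by (force simp: set_zip)
  have "i < length L \<and> j < length L \<and> i \<noteq> j" if "(i, j) \<in> set E"
    using that E_irrefl by (auto simp: list_all_iff)
  moreover have "L ! j \<in> set (state_succs (L ! i))" if "(i, j) \<in> set E" "i < length L"
    using succs_E zip[OF that(2)] that(1)
    by (fastforce simp: list_all_iff Let_def)
  moreover have "(i, j) \<in> set E"
    if ij: "i < length L" "j < length L" "i \<noteq> j" "L ! j \<in> set (state_succs (L ! i))"
  proof -
    have "L ! j \<noteq> L ! i"
      using ij dist by (simp add: nth_eq_iff_index_eq)
    then obtain e where "e \<in> set E" "fst e = i" "L ! j = L ! snd e"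
      using succs_E zip[OF ij(1)] ij(2,4) by (fastforce simp: list_all_iff Let_def)
    moreover then have "snd e < length L"
      using E_irrefl by (auto simp: list_all_iff)
    ultimately show ?thesis
      using dist ij(2) by (metis nth_eq_iff_index_eq prod.collapse)
  qed
  ultimately show ?thesis by blast
qed

lemma E_retained: "(i, j) \<in> set E \<Longrightarrow> (mset (L ! i), mset (L ! j)) \<in> retained"
  unfolding E_succs using core_shape all_valid[of "L ! i"]
  by (intro state_succs_imp_retained) (auto simp: list_all_iff)

lemma relpow_map: "(i, j) \<in> set E ^^ n \<Longrightarrow> (mset (L ! i), mset (L ! j)) \<in> retained ^^ n"
  by (induction n arbitrary: j) (auto intro: E_retained relcompI)

text \<open>Two rounds of forward search reach the whole core, so every core state is expanded. A
  rewrite starting at distance 3 would not be an arc of the explored graph.\<close>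

lemma core_source:
  assumes "i < length L"
  shows "\<exists>n < 3. (mset seed, mset (L ! i)) \<in> retained ^^ n"
proof -
  have "i \<in> set ((grow (length L) (map prod.swap E) ^^ 2) [i0])"
    using forward assms by simp
  then obtain m where "m \<le> 2" "(i, i0) \<in> set (map prod.swap E) ^^ m"
    using grow_relpow by blast
  moreover have "set (map prod.swap E) = (set E)\<inverse>"
    by auto
  ultimately have "(i0, i) \<in> set E ^^ m"
    by (simp add: relpow_converse_iff)
  from relpow_map[OF this] \<open>m \<le> 2\<close> seed_nth show ?thesis
    by (intro exI[of _ m]) auto
qed

lemma core_arcs:
  assumes "i < length L" "j < length L" "i \<noteq> j"
  shows "(mset (L ! i), mset (L ! j)) \<in> R \<longleftrightarrow> (i, j) \<in> set E"
proof
  assume "(mset (L ! i), mset (L ! j)) \<in> R"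
  then have "(mset (L ! i), mset (L ! j)) \<in> retained"
    by (simp add: explored_def)
  then obtain ys where ys: "ys \<in> set (state_succs (L ! i))" "mset (L ! j) = mset ys"
    using retained_imp_state_succs all_valid[of "L ! i"] assms(1) by (metis UnCI concat.simps(2) nth_mem set_append)
  moreover have "sorted (L ! i)" "sorted (L ! j)"
    using all_sorted assms by auto
  ultimately have "ys = L ! j"
    using sorted_state_succs mset_inject by metis
  with ys assms show "(i, j) \<in> set E"
    by (simp add: E_succs)
next
  assume "(i, j) \<in> set E"
  with E_retained core_source assms show "(mset (L ! i), mset (L ! j)) \<in> R"
    by (auto simp: explored_def)
qed

lemma E_arcs: "(i, j) \<in> set E \<Longrightarrow> (mset (L ! i), mset (L ! j)) \<in> R"
  using core_arcs E_succs by blast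

lemma rtrancl_map: "(i, j) \<in> (set E)\<^sup>* \<Longrightarrow> (mset (L ! i), mset (L ! j)) \<in> R\<^sup>*"
  by (induction rule: rtrancl_induct) (auto intro: E_arcs rtrancl_into_rtrancl)

lemma core_connected:
  assumes "S \<in> C" "T \<in> C"
  shows "(S, T) \<in> R\<^sup>*"
proof -
  obtain i j where ij: "i < length L" "S = mset (L ! i)" "j < length L" "T = mset (L ! j)"
    using assms by (auto simp: in_set_conv_nth)
  \<comment> \<open>Only the existence of a path back to the seed matters here, not its length, in
    contrast to the forward search.\<close>
  have "i \<in> set ((grow (length L) E ^^ 3) [i0])"
    using backward ij by simp
  then have "(i, i0) \<in> (set E)\<^sup>*"
    using grow_relpow relpow_imp_rtrancl by blast
  moreover have "j \<in> set ((grow (length L) (map prod.swap E) ^^ 2) [i0])"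
    using forward ij by simp
  then have "(j, i0) \<in> (set (map prod.swap E))\<^sup>*"
    using grow_relpow relpow_imp_rtrancl by blast
  moreover have "set (map prod.swap E) = (set E)\<inverse>"
    by auto
  ultimately have "(i, j) \<in> (set E)\<^sup>*"
    by (simp add: rtrancl_converse)
  with ij show ?thesis
    using rtrancl_map by blast
qed

lemma core_verts: "C \<subseteq> pverts (explored (mset seed))"
proof
  fix S
  assume "S \<in> C"
  then obtain i where "i < length L" "S = mset (L ! i)"
    by (auto simp: in_set_conv_nth)
  with core_source show "S \<in> pverts (explored (mset seed))"
    by (auto simp: explored_def intro: less_imp_le)
qed

text \<open>Since no path enters the first layer from outside, no further state can be mutually
  reachable with a core state.\<close>

lemma core_scc: "C \<in> pre_digraph.sccs_verts (with_proj (explored (mset seed)))"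
proof -
  have "\<not> (v, u) \<in> R\<^sup>*" if "u \<in> C" "v \<notin> C" for u v
    using that reach_initial[of v u 1] unfolding initial_1 by blast
  moreover have "C \<noteq> {}"
    using seed_in by auto
  ultimately show ?thesis
    using core_connected core_verts unfolding pre_digraph.sccs_verts_def reachable_explored by blast
qed

lemma signature_mset:
  assumes "xs \<in> set L"
  shows "rule_signature (mset xs) = filter is_rule xs" "data_signature (mset xs) = filter (\<lambda>t. \<not> is_rule t) xs"
  using all_sorted[of xs] assms by (auto simp: rule_signature_def data_signature_def sorted_sort_id)

lemma core_qualifies: "qualifying_core (mset seed) C"
proof -
  have E: "(0, 1) \<in> set E"
    using signatures by simp
  then have len: "0 < length L" "1 < length L"
    using E_succs by blast+
  then have L01: "L ! 0 \<in> set L" "L ! 1 \<in> set L"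
    by auto
  have arc: "(mset (L ! 0), mset (L ! 1)) \<in> R"
    using E_arcs E by blast
  have "(mset (L ! 1), mset (L ! 0)) \<in> R\<^sup>*"
    using core_connected L01 by blast
  with arc have "(mset (L ! 0), mset (L ! 0)) \<in> R\<^sup>+"
    by (meson rtrancl_into_trancl2)
  moreover have rules: "rule_signature (mset (L ! 0)) \<noteq> rule_signature (mset (L ! 1))"
    using signatures L01 by (simp add: signature_mset)
  moreover obtain xs where "xs \<in> set L" "data_signature (mset xs) \<noteq> data_signature (mset (L ! 0))"
    using signatures L01 by (auto simp: list_all_iff signature_mset)
  ultimately show ?thesis
    unfolding qualifying_core_def using core_scc L01 arc by blast
qed

lemma inj_on_mset: "inj_on mset (set (concat (L # Os)))"
  using mset_inject all_sorted by (meson inj_onI)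

lemma card_core: "card C = length L"
proof -
  have "distinct L"
    using L_sorted by (simp add: strict_sorted_iff)
  moreover have "inj_on mset (set L)"
    by (rule inj_on_subset[OF inj_on_mset]) auto
  ultimately show ?thesis
    by (simp add: card_image distinct_card)
qed

text \<open>In a cyclic component every state has an outgoing arc and so is expanded, and mutual
  reachability keeps the component inside one layer. If this is the first layer, maximality makes
  the component equal to the core; every other layer is shorter than the core.\<close>

lemma other_core_smaller:
  assumes "qualifying_core (mset seed) C'" "C' \<noteq> C"
  shows "card C' < card C"
proof -
  have mutual: "(S, T) \<in> R\<^sup>*" if "S \<in> C'" "T \<in> C'" for S T
    using assms(1) that unfolding qualifying_core_def pre_digraph.sccs_verts_def reachable_explored by blast
  have maximal: "T \<in> C'" if "S \<in> C'" "(S, T) \<in> R\<^sup>*" "(T, S) \<in> R\<^sup>*" for S T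
  proof -
    have "S \<in> pverts (explored (mset seed))"
      using assms(1) that(1) unfolding qualifying_core_def pre_digraph.sccs_verts_def reachable_explored by blast
    moreover have "T \<in> pverts (explored (mset seed))"
    proof -
      interpret pair_wf_digraph "explored (mset seed)"
        by (rule pair_wf_explored)
      have "S \<rightarrow>\<^sup>*\<^bsub>with_proj (explored (mset seed))\<^esub> T"
        using that calculation reachable_explored by blast
      then show ?thesis using reachable_in_verts(2) by fastforce
    qed
    ultimately show ?thesis
      using assms(1) that unfolding qualifying_core_def pre_digraph.sccs_verts_def reachable_explored by blast
  qed
  obtain S0 where S0: "S0 \<in> C'" "(S0, S0) \<in> R\<^sup>+"
    using assms(1) unfolding qualifying_core_def by blast
  \<comment> \<open>This excludes the unexpanded states. \<open>S0\<close> lies on a cycle, and any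
    other state of the component must leave itself in order to reach \<open>S0\<close>.\<close>
  have "\<exists>T. (S, T) \<in> R" if "S \<in> C'" for S
  proof (cases "S = S0")
    case True
    with S0(2) show ?thesis by (meson tranclD)
  next
    case False
    with mutual[OF that S0(1)] show ?thesis by (meson converse_rtranclE)
  qed
  then have expanded: "C' \<subseteq> mset ` set (concat (L # Os))"
    using source_in_layers by (metis image_eqI subsetI)
  then have "S0 \<in> initial (length (L # Os))"
    using S0(1) by (auto simp: initial_def)
  \<comment> \<open>\<open>k\<close> counts the layers up to and including that of
    \<open>S0\<close>, whose index is therefore \<open>k - 1\<close>.\<close>
  moreover define k where "k = (LEAST k. S0 \<in> initial k)"
  ultimately have "S0 \<in> initial k"
    by (auto intro: LeastI)
  moreover from this have "k \<noteq> 0"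
    by (cases k) (auto simp: initial_def)
  moreover from this have "S0 \<notin> initial (k - 1)"
    unfolding k_def by (metis diff_less not_less_Least zero_less_one gr0I)
  ultimately have C'_initial: "S \<in> initial k - initial (k - 1)" if "S \<in> C'" for S
    using mutual S0(1) that reach_initial by blast
  from \<open>S0 \<in> initial k\<close> \<open>S0 \<notin> initial (k - 1)\<close> \<open>k \<noteq> 0\<close> have k: "k - 1 < length (L # Os)"
    unfolding initial_def by (cases "k - 1 < length (L # Os)") auto
  with \<open>k \<noteq> 0\<close> have "take k (L # Os) = take (k - 1) (L # Os) @ [(L # Os) ! (k - 1)]"
    using take_Suc_conv_app_nth[OF k] by simp
  then have sub: "C' \<subseteq> mset ` set ((L # Os) ! (k - 1))"
    using C'_initial by (auto simp: initial_def image_Un)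
  show ?thesis
  proof (cases "k = 1")
    case True
    with sub have "C' \<subseteq> C" by simp
    moreover have "C \<subseteq> C'"
    proof
      fix T
      assume "T \<in> C"
      moreover have "S0 \<in> C"
        using \<open>C' \<subseteq> C\<close> S0(1) by blast
      ultimately show "T \<in> C'"
        using core_connected maximal[OF S0(1)] by metis
    qed
    ultimately show ?thesis using assms(2) by blast
  next
    case False
    then obtain j where j: "k - 1 = Suc j"
      using \<open>k \<noteq> 0\<close> by (metis One_nat_def Suc_pred gr0I)
    with k have "(L # Os) ! (k - 1) \<in> set Os"
      by simp
    then have "length ((L # Os) ! (k - 1)) < length L"
      using layer_length by (auto simp: list_all_iff)
    moreover have "card C' \<le> length ((L # Os) ! (k - 1))"
      using sub by (meson List.finite_set card_image_le card_length card_mono finite_imageI le_trans)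
    ultimately show ?thesis
      by (simp add: card_core)
  qed
qed

lemma selected: "selected_core (mset seed) = C"
  unfolding selected_core_def
  using core_qualifies other_core_smaller by (intro the_equality) (blast, metis less_asym)

lemma state_number_nth:
  assumes "i < length L"
  shows "state_number C (mset (L ! i)) = i"
proof -
  have dist: "distinct L"
    using L_sorted by (simp add: strict_sorted_iff)
  have "state_string (mset (L ! j)) < state_string (mset (L ! i)) \<longleftrightarrow> j < i" if "j < length L" for j
  proof -
    have "length (L ! j) = length (L ! i)" "sorted (L ! i)" "sorted (L ! j)"
      using core_shape all_sorted that assms by (auto simp: list_all_iff)
    then have "state_string (mset (L ! j)) < state_string (mset (L ! i)) \<longleftrightarrow> L ! j < L ! i"
      by (simp add: state_string_mset join_less_iff)
    also have "\<dots> \<longleftrightarrow> j < i"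
      using L_sorted assms that by (metis not_less_iff_gr_or_eq sorted_wrt_iff_nth_less)
    finally show ?thesis .
  qed
  then have "{j \<in> {..<length L}. state_string (mset (L ! j)) < state_string (mset (L ! i))} = {..<i}"
    using assms by auto
  then have "{S' \<in> C. state_string S' < state_string (mset (L ! i))} = (\<lambda>j. mset (L ! j)) ` {..<i}"
    unfolding core_image by blast
  moreover have "inj_on (\<lambda>j. mset (L ! j)) {..<i}"
  proof (rule inj_onI)
    fix x y
    assume *: "x \<in> {..<i}" "y \<in> {..<i}" "mset (L ! x) = mset (L ! y)"
    then have "L ! x \<in> set (concat (L # Os))" "L ! y \<in> set (concat (L # Os))"
      using assms by simp_all
    then have "L ! x = L ! y"
      using all_sorted mset_inject *(3) by metis
    with * dist assms show "x = y"
      by (simp add: nth_eq_iff_index_eq)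
  qed
  ultimately show ?thesis
    by (simp add: state_number_def card_image)
qed

lemma core_graph: "core_graph (mset seed) = \<lparr>pverts = {..<length L}, parcs = set E\<rparr>"
proof -
  have "state_number C ` C = {..<length L}"
  proof -
    have "state_number C ` C = (\<lambda>i. state_number C (mset (L ! i))) ` {..<length L}"
      by (subst (2) core_image) (simp add: image_image)
    also have "\<dots> = {..<length L}"
      using state_number_nth by simp
    finally show ?thesis .
  qed
  moreover have "{(state_number C S, state_number C S') |S S'. S \<in> C \<and> S' \<in> C \<and> S \<noteq> S' \<and> (S, S') \<in> R} = set E"
    (is "?A = _")
  proof (intro set_eqI iffI)
    fix e
    assume "e \<in> ?A"
    then obtain i j where ij: "i < length L" "j < length L" "mset (L ! i) \<noteq> mset (L ! j)"
      "(mset (L ! i), mset (L ! j)) \<in> R" "e = (state_number C (mset (L ! i)), state_number C (mset (L ! j)))"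
      by (auto simp: in_set_conv_nth)
    then have "i \<noteq> j" by auto
    with ij show "e \<in> set E"
      using core_arcs state_number_nth by auto
  next
    fix e
    assume e: "e \<in> set E"
    obtain i j where [simp]: "e = (i, j)" by fastforce
    have ij: "i < length L" "j < length L" "i \<noteq> j"
      using e E_succs by auto
    then have "e = (state_number C (mset (L ! i)), state_number C (mset (L ! j)))"
      using state_number_nth by simp
    moreover have "mset (L ! i) \<noteq> mset (L ! j)"
      using ij state_number_nth by metis
    moreover have "mset (L ! i) \<in> C" "mset (L ! j) \<in> C"
      using ij by simp_all
    moreover have "(mset (L ! i), mset (L ! j)) \<in> R"
      using E_arcs e by simp
    ultimately show "e \<in> ?A"
      by blast
  qed
  ultimately show ?thesis
    unfolding core_graph_def selected Let_def by simp
qed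

end

section \<open>Opposite-diamond partitions and role assignments\<close>

definition nbr_lists :: "nat \<Rightarrow> (nat \<times> nat) list \<Rightarrow> nat list list" where
  "nbr_lists n E = map (\<lambda>u. map snd (filter (\<lambda>e. fst e = u) E)) [0..<n]"

lemma set_nbr_lists: "u < n \<Longrightarrow> v \<in> set (nbr_lists n E ! u) \<longleftrightarrow> (u, v) \<in> set E"
  by (force simp: nbr_lists_def)

text \<open>Here \<open>e = (x, a)\<close> leaves the source of the diamond and
  \<open>f = (b, y)\<close> enters its sink. The relation is not symmetric, hence the two orders
  wherever \<open>Omega\<close> is meant.\<close>

definition opposite :: "nat list list \<Rightarrow> nat \<times> nat \<Rightarrow> nat \<times> nat \<Rightarrow> bool" where
  "opposite A e f \<longleftrightarrow> fst e \<noteq> fst f \<and> snd e \<noteq> snd f \<and> fst e \<noteq> snd f \<and> fst f \<noteq> snd e \<and>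
     fst e \<noteq> snd e \<and> fst f \<noteq> snd f \<and> fst f \<in> set (A ! fst e) \<and> snd f \<in> set (A ! snd e)"

text \<open>Enumerates only diamonds in which the edge of \<open>B\<close> leaves the source. The
  other position is covered once all blocks are closed in this sense and pairwise disjoint.\<close>

definition opposite_closed :: "nat list list \<Rightarrow> (nat \<times> nat) list \<Rightarrow> bool" where
  "opposite_closed A B \<longleftrightarrow> list_all (\<lambda>(x, a).
     let ya = A ! a in
     list_all (\<lambda>b. b = a \<or> b = x \<or>
       list_all (\<lambda>y. y = x \<or> y = a \<or> y = b \<or> y \<notin> set ya \<or> (b, y) \<in> set B) (A ! b))
     (A ! x)) B"

text \<open>Every edge is attached to an earlier one, so the list order encodes a spanning tree.
  This dictates the order of the edges inside the blocks listed below.\<close>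

fun opposite_chain :: "nat list list \<Rightarrow> (nat \<times> nat) list \<Rightarrow> (nat \<times> nat) list \<Rightarrow> bool" where
  "opposite_chain A fs [] \<longleftrightarrow> True"
| "opposite_chain A fs (e # es) \<longleftrightarrow>
     list_ex (\<lambda>f. opposite A e f \<or> opposite A f e) fs \<and> opposite_chain A (fs @ [e]) es"

lemma opposite_chain_connected:
  assumes "opposite_chain A fs es" "\<And>e f. e \<in> set fs \<Longrightarrow> f \<in> set fs \<Longrightarrow> (e, f) \<in> r\<^sup>*"
    and "\<And>e f. e \<in> set (fs @ es) \<Longrightarrow> f \<in> set (fs @ es) \<Longrightarrow> opposite A e f \<Longrightarrow> (e, f) \<in> r \<and> (f, e) \<in> r"
    and "e \<in> set (fs @ es)" "f \<in> set (fs @ es)"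
  shows "(e, f) \<in> r\<^sup>*"
  using assms
proof (induction A fs es rule: opposite_chain.induct)
  case (1 A fs)
  then show ?case by simp
next
  case (2 A fs g es)
  from "2.prems"(1) obtain h where h: "h \<in> set fs" "opposite A g h \<or> opposite A h g"
    by (auto simp: list_ex_iff)
  then have gh: "(g, h) \<in> r" "(h, g) \<in> r"
    using "2.prems"(3)[of g h] "2.prems"(3)[of h g] by auto
  have "(e, f) \<in> r\<^sup>*" if "e \<in> set (fs @ [g])" "f \<in> set (fs @ [g])" for e f
  proof -
    have "(e, h) \<in> r\<^sup>*"
      using that(1) "2.prems"(2)[of e h] h(1) gh(1) by auto
    also have "(h, f) \<in> r\<^sup>*"
      using that(2) "2.prems"(2)[of h f] h(1) gh(2) by auto
    finally show ?thesis .
  qed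
  then show ?case
    using "2.prems" by (intro "2.IH") auto
qed

text \<open>Closedness keeps components of \<open>Omega\<close> inside blocks and the chains keep
  each block inside one component.\<close>

locale diamond_blocks =
  fixes n :: nat and Bs :: "(nat \<times> nat) list list"
  assumes distinct_edges: "distinct (concat Bs)"
    and blocks_nonempty: "list_all (\<lambda>B. B \<noteq> []) Bs"
    and edges_in: "list_all (\<lambda>(u, v). u < n \<and> v < n) (concat Bs)"
    and blocks_closed: "let A = nbr_lists n (concat Bs) in list_all (opposite_closed A) Bs"
    and blocks_connected: "let A = nbr_lists n (concat Bs) in
        list_all (\<lambda>B. opposite_chain A [hd B] (tl B)) Bs"
begin

abbreviation "E \<equiv> concat Bs"
abbreviation "A \<equiv> nbr_lists n E"

definition graph :: "nat pair_pre_digraph" where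
  "graph = \<lparr>pverts = {..<n}, parcs = set E\<rparr>"

lemma graph_simps [simp]: "pverts graph = {..<n}" "parcs graph = set E"
  by (simp_all add: graph_def)

lemma edge_less: "(u, v) \<in> set E \<Longrightarrow> u < n \<and> v < n"
  using edges_in by (simp only: list_all_iff) auto

lemma opposite_iff:
  assumes "(x, a) \<in> set E"
  shows "opposite A (x, a) (b, y) \<longleftrightarrow> distinct [x, a, b, y] \<and> (x, b) \<in> set E \<and> (a, y) \<in> set E"
proof -
  have "x < n" "a < n"
    using edge_less[OF assms] by auto
  then show ?thesis
    unfolding opposite_def by (simp only: fst_conv snd_conv set_nbr_lists) auto
qed

lemma diamond_graph:
  "diamond graph x a b y \<longleftrightarrow> (x, a) \<in> set E \<and> (b, y) \<in> set E \<and> opposite A (x, a) (b, y)"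
proof (cases "(x, a) \<in> set E")
  case True
  then show ?thesis
    using edge_less unfolding diamond_def opposite_iff[OF True] graph_simps insert_subset lessThan_iff by blast
next
  case False
  then show ?thesis
    unfolding diamond_def graph_simps by blast
qed

text \<open>Exchanging \<open>a\<close> and \<open>b\<close> exchanges the two opposite pairs of a
  pattern, so one of them is enough in what follows.\<close>

lemma diamond_swap: "diamond G x a b y \<longleftrightarrow> diamond G x b a y"
  unfolding diamond_def by auto

lemma Omega_graph:
  "(e, f) \<in> Omega graph \<longleftrightarrow> e \<in> set E \<and> f \<in> set E \<and> (opposite A e f \<or> opposite A f e)"
proof
  assume "(e, f) \<in> Omega graph"
  then obtain x a b y where "diamond graph x a b y" "{e, f} = {(x, a), (b, y)} \<or> {e, f} = {(x, b), (a, y)}"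
    unfolding Omega_def by auto
  then obtain a b where "diamond graph x a b y" "{e, f} = {(x, a), (b, y)}"
    by (metis diamond_swap)
  then show "e \<in> set E \<and> f \<in> set E \<and> (opposite A e f \<or> opposite A f e)"
    unfolding diamond_graph doubleton_eq_iff by metis
next
  have *: "\<exists>x a b y. diamond graph x a b y \<and> e = (x, a) \<and> f = (b, y)"
    if "e \<in> set E" "f \<in> set E" "opposite A e f" for e f
    using that unfolding diamond_graph by (metis prod.collapse)
  assume "e \<in> set E \<and> f \<in> set E \<and> (opposite A e f \<or> opposite A f e)"
  then consider "e \<in> set E" "f \<in> set E" "opposite A e f" | "e \<in> set E" "f \<in> set E" "opposite A f e"
    by blast
  then obtain x a b y where xy: "diamond graph x a b y" "{e, f} = {(x, a), (b, y)}"
  proof cases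
    case 1
    from *[OF 1] that show ?thesis by blast
  next
    case 2
    from *[OF 2(2,1,3)] that show ?thesis by blast
  qed
  show "(e, f) \<in> Omega graph"
    unfolding Omega_def mem_Collect_eq case_prod_conv
    using xy by (intro exI[of _ x] exI[of _ a] exI[of _ b] exI[of _ y] conjI disjI1)
qed

lemma Omega_block:
  assumes "(e, f) \<in> Omega graph" "B \<in> set Bs" "e \<in> set B"
  shows "f \<in> set B"
proof -
  have closed: "f \<in> set B" if "opposite A e f" "B \<in> set Bs" "e \<in> set B" "f \<in> set E" for e f B
  proof -
    obtain x a b y where ef: "e = (x, a)" "f = (b, y)" by (cases e, cases f)
    have "(x, a) \<in> set E"
      using that(2,3) ef by auto
    from that(1)[unfolded ef opposite_iff[OF this]]
    have d: "distinct [x, a, b, y]" and xb: "(x, b) \<in> set E" and ay: "(a, y) \<in> set E"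
      by blast+
    have "b \<in> set (A ! x)" "y \<in> set (A ! a)" "y \<in> set (A ! b)"
      using xb ay that(4) ef edge_less set_nbr_lists by metis+
    moreover have "list_all (\<lambda>(x, a). let ya = A ! a in
        list_all (\<lambda>b. b = a \<or> b = x \<or>
          list_all (\<lambda>y. y = x \<or> y = a \<or> y = b \<or> y \<notin> set ya \<or> (b, y) \<in> set B) (A ! b)) (A ! x)) B"
      using blocks_closed that(2) by (simp add: Let_def list_all_iff[of "opposite_closed _"] opposite_closed_def)
    ultimately show ?thesis
      using d that(3) unfolding ef list_all_iff Let_def by fastforce
  qed
  from assms(1) have "e \<in> set E" "f \<in> set E" "opposite A e f \<or> opposite A f e"
    using Omega_graph by blast+
  then show ?thesis
  proof (elim disjE)
    \<comment> \<open>Now \<open>f\<close> leaves the source: closedness of the block of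
      \<open>f\<close> puts \<open>e\<close> into it, and disjointness identifies that block with
      \<open>B\<close>.\<close>
    assume "opposite A f e"
    moreover obtain B' where B': "B' \<in> set Bs" "f \<in> set B'"
      using \<open>f \<in> set E\<close> by auto
    ultimately have "e \<in> set B'"
      using closed \<open>e \<in> set E\<close> by blast
    with assms(2,3) B' have "B' = B"
      using distinct_edges unfolding distinct_concat_iff by (metis IntI empty_iff)
    with B' show ?thesis by simp
  next
    assume "opposite A e f"
    then show ?thesis
      using closed assms(2,3) \<open>f \<in> set E\<close> by metis
  qed
qed

lemma Omega_rtrancl_iff:
  assumes "B \<in> set Bs" "e \<in> set B"
  shows "(e, f) \<in> (Omega graph)\<^sup>* \<longleftrightarrow> f \<in> set B"
proof
  assume "(e, f) \<in> (Omega graph)\<^sup>*"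
  then show "f \<in> set B"
    using assms(2) by (induction rule: rtrancl_induct) (auto intro: Omega_block assms(1))
next
  assume f: "f \<in> set B"
  have B: "set B = set ([hd B] @ tl B)"
    using assms(2) by (cases B) auto
  have chain: "opposite_chain A [hd B] (tl B)"
    using blocks_connected assms(1) by (simp only: Let_def list_all_iff)
  have "set ([hd B] @ tl B) \<subseteq> set E"
    unfolding B[symmetric] using assms(1) by auto
  then have "(e, f) \<in> Omega graph \<and> (f, e) \<in> Omega graph"
    if "e \<in> set ([hd B] @ tl B)" "f \<in> set ([hd B] @ tl B)" "opposite A e f" for e f
    using that unfolding Omega_graph by blast
  then show "(e, f) \<in> (Omega graph)\<^sup>*"
    using opposite_chain_connected[OF chain, of "Omega graph" e f] f assms(2) unfolding B by auto
qed

lemma opp_partition_graph: "opp_partition graph = set ` set Bs"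
proof -
  let ?r = "{(e, f) \<in> set E \<times> set E. (e, f) \<in> (Omega graph)\<^sup>*}"
  have cls: "?r `` {e} = set B" if "B \<in> set Bs" "e \<in> set B" for e B
  proof -
    have "set B \<subseteq> set E"
      using that by auto
    with that show ?thesis
      using Omega_rtrancl_iff[OF that] by blast
  qed
  have "set E // ?r = set ` set Bs"
  proof (intro equalityI subsetI)
    fix X
    assume "X \<in> set E // ?r"
    then obtain e where "e \<in> set E" "X = ?r `` {e}"
      by (rule quotientE)
    moreover from this(1) obtain B where "B \<in> set Bs" "e \<in> set B"
      by auto
    ultimately show "X \<in> set ` set Bs"
      using cls by blast
  next
    fix X
    assume "X \<in> set ` set Bs"
    then obtain B where B: "B \<in> set Bs" "X = set B" by blast
    then have hd: "hd B \<in> set B"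
      using blocks_nonempty by (simp add: list_all_iff)
    then have "hd B \<in> set E"
      using B(1) by auto
    from quotientI[OF this, of ?r] show "X \<in> set E // ?r"
      using cls[OF B(1) hd] B(2) by simp
  qed
  then show ?thesis
    by (simp only: opp_partition_def graph_simps)
qed

abbreviation "k \<equiv> length Bs"

lemma card_opp_partition: "card (opp_partition graph) = k"
proof -
  have "inj_on set (set Bs)"
    using distinct_edges blocks_nonempty unfolding distinct_concat_iff inj_on_def list_all_iff
    by (metis Int_absorb set_empty)
  moreover have "distinct Bs"
    using distinct_edges blocks_nonempty unfolding distinct_concat_iff list_all_iff
    by (metis removeAll_id)
  ultimately show ?thesis
    unfolding opp_partition_graph by (simp add: card_image distinct_card)
qed

lemma role_labels_graph: "role_labels graph = {..<k}"
  by (simp add: role_labels_def card_opp_partition)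

end

locale labelled_blocks = diamond_blocks +
  fixes c :: "nat \<times> nat \<Rightarrow> nat"
  assumes role_assignment: "opp_role_assignment graph c"
begin

text \<open>The label that the arbitrary assignment \<open>c\<close> puts on block \<open>i\<close>;
  it is a permutation of the block numbers.\<close>

definition "\<rho> i = c (hd (Bs ! i))"

lemma c_block: "i < k \<Longrightarrow> e \<in> set (Bs ! i) \<Longrightarrow> c e = \<rho> i"
  and bij_\<rho>: "bij_betw \<rho> {..<k} {..<k}"
proof -
  obtain lab where lab: "bij_betw lab (set ` set Bs) {..<k}" "\<And>C e. C \<in> set ` set Bs \<Longrightarrow> e \<in> C \<Longrightarrow> c e = lab C"
    using role_assignment
    unfolding opp_role_assignment_def labels_blocks_def opp_partition_graph role_labels_graph by blast
  have \<rho>: "\<rho> i = lab (set (Bs ! i))" if "i < k" for i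
    using that blocks_nonempty lab(2)[of "set (Bs ! i)" "hd (Bs ! i)"] by (simp add: \<rho>_def list_all_iff)
  show "c e = \<rho> i" if "i < k" "e \<in> set (Bs ! i)" for i e
    using lab(2)[of "set (Bs ! i)" e] that \<rho> by simp
  have "\<rho> ` {..<k} = (\<lambda>i. lab (set (Bs ! i))) ` {..<k}"
    using \<rho> by (intro image_cong) auto
  also have "\<dots> = lab ` set ` (!) Bs ` {..<k}"
    by (simp add: image_image)
  also have "(!) Bs ` {..<k} = set Bs"
    by (auto simp: set_conv_nth)
  also have "lab ` set ` set Bs = {..<k}"
    using lab(1) by (simp add: bij_betw_def)
  finally have "\<rho> ` {..<k} = {..<k}" .
  then show "bij_betw \<rho> {..<k} {..<k}"
    by (simp add: bij_betw_def eq_card_imp_inj_on)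
qed

lemma \<rho>_eq_iff [simp]: "i < k \<Longrightarrow> j < k \<Longrightarrow> \<rho> i = \<rho> j \<longleftrightarrow> i = j"
  using bij_\<rho> by (auto simp: bij_betw_def inj_on_def)

lemma \<rho>_less: "i < k \<Longrightarrow> \<rho> i < k"
  using bij_\<rho> by (auto simp: bij_betw_def)

lemma block_cases:
  assumes "e \<in> set E"
  obtains i where "i < k" "e \<in> set (Bs ! i)" "c e = \<rho> i"
proof -
  from assms obtain B where "B \<in> set Bs" "e \<in> set B"
    by auto
  moreover from this obtain i where "i < k" "Bs ! i = B"
    by (metis in_set_conv_nth)
  ultimately show ?thesis
    using that c_block by blast
qed

lemma c_eq_iff: "i < k \<Longrightarrow> e \<in> set E \<Longrightarrow> c e = \<rho> i \<longleftrightarrow> e \<in> set (Bs ! i)"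
  using c_block \<rho>_eq_iff by (metis block_cases)

lemma c_extensional: "c \<in> extensional (set E)"
  using role_assignment by (simp add: opp_role_assignment_def labels_blocks_def)

lemma c_in_fibre: "c \<in> incidence_fibre graph {..<k} c"
proof -
  have "c e \<in> {..<k}" if "e \<in> set E" for e
    using block_cases[OF that] \<rho>_less by (metis lessThan_iff)
  then show ?thesis
    using c_extensional unfolding incidence_fibre_def PiE_iff graph_simps by blast
qed

end

section \<open>Weights of roles at endpoints\<close>

lemma sum_role_weights:
  fixes f :: "'r \<Rightarrow> 'v \<Rightarrow> nat"
  assumes "finite A" "finite V" "finite R" "\<And>e. e \<in> A \<Longrightarrow> g e \<in> V" "\<And>e. e \<in> A \<Longrightarrow> c e \<in> R"
  shows "(\<Sum>e\<in>A. f (c e) (g e)) = (\<Sum>v\<in>V. \<Sum>r\<in>R. f r v * card {e \<in> A. g e = v \<and> c e = r})"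
proof -
  have "(\<Sum>e\<in>A. f (c e) (g e)) = (\<Sum>x\<in>V \<times> R. \<Sum>e\<in>{e \<in> A. (g e, c e) = x}. f (c e) (g e))"
    using assms by (intro sum.group[symmetric]) auto
  also have "\<dots> = (\<Sum>x\<in>V \<times> R. f (snd x) (fst x) * card {e \<in> A. g e = fst x \<and> c e = snd x})"
    by (intro sum.cong) (auto simp: mult.commute intro!: sum.cong)
  also have "\<dots> = (\<Sum>v\<in>V. \<Sum>r\<in>R. f r v * card {e \<in> A. g e = v \<and> c e = r})"
    by (simp add: sum.cartesian_product case_prod_beta)
  finally show ?thesis .
qed

text \<open>
  The total weight \<open>\<Sum>e. \<alpha> (c e) (fst e) + \<beta> (c e) (snd e)\<close> depends only on the incidence
  numbers, so an assignment choosing the strictly heaviest role on every edge is alone in its fibre.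
\<close>

lemma incidence_fibre_unique:
  fixes G :: "'v pair_pre_digraph" and \<alpha> \<beta> :: "'r \<Rightarrow> 'v \<Rightarrow> nat"
  assumes "finite (parcs G)" "finite (pverts G)" "finite R"
    and ends: "\<And>e. e \<in> parcs G \<Longrightarrow> fst e \<in> pverts G \<and> snd e \<in> pverts G"
    and c: "c \<in> incidence_fibre G R c"
    and heaviest: "\<And>e r. e \<in> parcs G \<Longrightarrow> r \<in> R \<Longrightarrow> r \<noteq> c e \<Longrightarrow>
      \<alpha> r (fst e) + \<beta> r (snd e) < \<alpha> (c e) (fst e) + \<beta> (c e) (snd e)"
  shows "incidence_fibre G R c = {c}"
proof (intro equalityI subsetI)
  fix c'
  assume c': "c' \<in> incidence_fibre G R c"
  let ?w = "\<lambda>r e. \<alpha> r (fst e) + \<beta> r (snd e)"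
  have weight: "(\<Sum>e\<in>parcs G. ?w (d e) e) = (\<Sum>v\<in>pverts G. \<Sum>r\<in>R. \<alpha> r v * role_outdegree G d r v)
      + (\<Sum>v\<in>pverts G. \<Sum>r\<in>R. \<beta> r v * role_indegree G d r v)" if "d \<in> incidence_fibre G R c" for d
  proof -
    have "d e \<in> R" if "e \<in> parcs G" for e
      using that \<open>d \<in> _\<close> by (auto simp: incidence_fibre_def)
    then show ?thesis
      unfolding sum.distrib role_outdegree_def role_indegree_def
      using assms(1-3) ends by (intro arg_cong2[where f = "(+)"] sum_role_weights) auto
  qed
  have c'_R: "c' e \<in> R" if "e \<in> parcs G" for e
    using c' that by (auto simp: incidence_fibre_def)
  have "(\<Sum>e\<in>parcs G. ?w (c' e) e) = (\<Sum>e\<in>parcs G. ?w (c e) e)"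
    unfolding weight[OF c'] weight[OF c]
    using c' by (intro arg_cong2[where f = "(+)"] sum.cong refl) (auto simp: incidence_fibre_def)
  moreover have le: "?w (c' e) e \<le> ?w (c e) e" if "e \<in> parcs G" for e
    using heaviest[OF that c'_R[OF that]] by (cases "c' e = c e") auto
  ultimately have eq: "?w (c' e) e = ?w (c e) e" if "e \<in> parcs G" for e
    using sum_mono_inv[of "\<lambda>e. ?w (c' e) e" "parcs G" "\<lambda>e. ?w (c e) e"] that assms(1) by blast
  have "c' e = c e" if "e \<in> parcs G" for e
    using heaviest[OF that c'_R[OF that]] eq[OF that] by force
  moreover have "c' \<in> extensional (parcs G)" "c \<in> extensional (parcs G)"
    using c c' by (auto simp: incidence_fibre_def PiE_iff)
  ultimately show "c' \<in> {c}"
    using extensionalityI by blast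
qed (use c in simp)

section \<open>Exchanges of two roles that preserve all incidence numbers\<close>

lemma count_mset_map_distinct:
  assumes "distinct xs"
  shows "count (mset (map g xs)) v = card {x \<in> set xs. g x = v}"
proof -
  have "count (mset (map g xs)) v = length (filter (\<lambda>x. g x = v) xs)"
    by (induction xs) auto
  also have "\<dots> = card (set (filter (\<lambda>x. g x = v) xs))"
    using assms by (metis distinct_card distinct_filter)
  finally show ?thesis by simp
qed

text \<open>Meant for \<open>g = fst\<close> and \<open>g = snd\<close>: at \<open>v\<close> the
  role \<open>a\<close> loses the edges of \<open>S\<close> and gains those of \<open>T\<close>, the
  role \<open>b\<close> conversely, and the equal counts cancel.\<close>

lemma card_exchange:
  assumes "finite A" "S \<subseteq> A" "T \<subseteq> A" "S \<inter> T = {}"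
    and S: "\<And>e. e \<in> S \<Longrightarrow> c e = a \<and> c' e = b"
    and T: "\<And>e. e \<in> T \<Longrightarrow> c e = b \<and> c' e = a"
    and rest: "\<And>e. e \<notin> S \<Longrightarrow> e \<notin> T \<Longrightarrow> c' e = c e"
    and eq: "card {e \<in> S. g e = v} = card {e \<in> T. g e = v}"
  shows "card {e \<in> A. g e = v \<and> c' e = r} = card {e \<in> A. g e = v \<and> c e = r}"
proof -
  let ?U = "{e \<in> A - S - T. g e = v \<and> c e = r}"
  have fin: "finite A" "finite S" "finite T"
    using assms(1-3) finite_subset by auto
  have split: "{e \<in> A. P e} = {e \<in> A - S - T. P e} \<union> ({e \<in> S. P e} \<union> {e \<in> T. P e})" for P
    using assms(2,3) by auto
  have card_split: "card {e \<in> A. P e} = card {e \<in> A - S - T. P e} + (card {e \<in> S. P e} + card {e \<in> T. P e})" for P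
    unfolding split[of P] using assms(4) fin by (subst card_Un_disjoint; (subst card_Un_disjoint)?; auto)+
  have sub: "card {e \<in> B. g e = v \<and> d e = r} = (if r = x then card {e \<in> B. g e = v} else 0)"
    if "\<And>e. e \<in> B \<Longrightarrow> d e = x" for B d x
  proof -
    have "{e \<in> B. g e = v \<and> d e = r} = (if r = x then {e \<in> B. g e = v} else {})"
      using that by auto
    then show ?thesis by simp
  qed
  have "{e \<in> A - S - T. g e = v \<and> c' e = r} = ?U"
    using rest by auto
  moreover have "card {e \<in> S. g e = v \<and> c' e = r} = (if r = b then card {e \<in> S. g e = v} else 0)"
    "card {e \<in> S. g e = v \<and> c e = r} = (if r = a then card {e \<in> S. g e = v} else 0)"
    "card {e \<in> T. g e = v \<and> c' e = r} = (if r = a then card {e \<in> T. g e = v} else 0)"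
    "card {e \<in> T. g e = v \<and> c e = r} = (if r = b then card {e \<in> T. g e = v} else 0)"
    using S T by (intro sub; blast)+
  ultimately show ?thesis
    unfolding card_split using eq by simp
qed

text \<open>The base 10 rewards a role for occurring at the endpoint. With the preferences used
  later, all at most 3, a role missing at one end of an edge stays below the 20 of its own role;
  preferences only have to settle competitors present at both ends.\<close>

definition role_weight :: "(nat \<times> nat \<Rightarrow> nat) \<Rightarrow> (nat \<times> nat) list list \<Rightarrow> (nat \<Rightarrow> nat \<Rightarrow> nat) \<Rightarrow> nat \<Rightarrow> nat \<Rightarrow> nat"
  where "role_weight end Bs p j v = (if v \<in> set (map end (Bs ! j)) then 10 + p j v else 0)"

definition block_heaviest ::
  "(nat \<times> nat) list list \<Rightarrow> (nat \<Rightarrow> nat \<Rightarrow> nat) \<Rightarrow> (nat \<Rightarrow> nat \<Rightarrow> nat) \<Rightarrow> bool" where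
  "block_heaviest Bs p q \<longleftrightarrow> list_all (\<lambda>i. list_all (\<lambda>e. list_all (\<lambda>j. j = i \<or>
     role_weight fst Bs p j (fst e) + role_weight snd Bs q j (snd e)
       < role_weight fst Bs p i (fst e) + role_weight snd Bs q i (snd e)) [0..<length Bs]) (Bs ! i)) [0..<length Bs]"

context labelled_blocks
begin

text \<open>The weights are indexed by blocks and the fibre by labels, so the inverse
  \<open>ix\<close> of \<open>\<rho>\<close> transports them; a single evaluation then serves every
  labelling.\<close>

lemma fibre_singleton:
  assumes "block_heaviest Bs p q"
  shows "card (incidence_fibre graph (role_labels graph) c) = 1"
proof -
  define ix where "ix = inv_into {..<k} \<rho>"
  have ix: "ix r < k" "\<rho> (ix r) = r" if "r < k" for r
    using that bij_\<rho> unfolding ix_def bij_betw_def by (metis inv_into_into lessThan_iff, metis f_inv_into_f lessThan_iff)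
  have "incidence_fibre graph {..<k} c = {c}"
  proof (rule incidence_fibre_unique[OF _ _ _ _ c_in_fibre])
    show "fst e \<in> pverts graph \<and> snd e \<in> pverts graph" if "e \<in> parcs graph" for e
      using that edges_in by (fastforce simp: list_all_iff)
  next
    fix e r
    assume e: "e \<in> parcs graph" and r: "r \<in> {..<k}" "r \<noteq> c e"
    from e have "e \<in> set E"
      by (simp only: graph_simps)
    then obtain i where i: "i < k" "e \<in> set (Bs ! i)" "c e = \<rho> i"
      by (rule block_cases)
    have "ix (c e) = i"
      using ix[of "c e"] i \<rho>_less by simp
    moreover have "ix r \<noteq> i"
      using ix[of r] i r by auto
    moreover have "i \<in> set [0..<k]" "ix r \<in> set [0..<k]"
      using i ix(1)[of r] r(1) by simp_all
    ultimately show "role_weight fst Bs p (ix r) (fst e) + role_weight snd Bs q (ix r) (snd e)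
        < role_weight fst Bs p (ix (c e)) (fst e) + role_weight snd Bs q (ix (c e)) (snd e)"
      using assms i(2) unfolding block_heaviest_def list_all_iff by blast
  qed simp_all
  then show ?thesis
    by (simp add: role_labels_graph)
qed

lemma exchange_in_fibre:
  assumes ij: "i < k" "j < k" "i \<noteq> j"
    and S: "set S \<subseteq> set (Bs ! i)" and T: "set T \<subseteq> set (Bs ! j)" and "distinct S" "distinct T"
    and bal: "mset (map fst S) = mset (map fst T)" "mset (map snd S) = mset (map snd T)"
  shows "exchange_roles (\<rho> i) (\<rho> j) (set S \<union> set T) c \<in> incidence_fibre graph {..<k} c"
    and "{e \<in> set E. exchange_roles (\<rho> i) (\<rho> j) (set S \<union> set T) c e \<noteq> c e} = set S \<union> set T"
proof -
  let ?c = "exchange_roles (\<rho> i) (\<rho> j) (set S \<union> set T) c"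
  have in_E: "set S \<subseteq> set E" "set T \<subseteq> set E"
    using S T ij nth_mem[of i Bs] nth_mem[of j Bs] by (auto simp del: nth_mem)
  have cS: "c e = \<rho> i" if "e \<in> set S" for e
    using that S c_block ij by blast
  have cT: "c e = \<rho> j" if "e \<in> set T" for e
    using that T c_block ij by blast
  have ne: "\<rho> i \<noteq> \<rho> j"
    using ij by simp
  have c_S: "?c e = \<rho> j" if "e \<in> set S" for e
    using that cS ne by (simp add: exchange_roles_def)
  have c_T: "?c e = \<rho> i" if "e \<in> set T" for e
    using that cT ne by (simp add: exchange_roles_def)
  have c_else: "?c e = c e" if "e \<notin> set S" "e \<notin> set T" for e
    using that by (simp add: exchange_roles_def)
  show "{e \<in> set E. ?c e \<noteq> c e} = set S \<union> set T"
  proof -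
    have "e \<in> set E \<and> ?c e \<noteq> c e \<longleftrightarrow> e \<in> set S \<union> set T" for e
    proof (cases "e \<in> set S \<union> set T")
      case True
      then have "?c e \<noteq> c e"
        using cS cT c_S c_T ne by (metis UnE)
      with True in_E show ?thesis by blast
    next
      case False
      with c_else[of e] show ?thesis by blast
    qed
    then show ?thesis by blast
  qed
  have deg: "card {e \<in> set E. g e = v \<and> ?c e = r} = card {e \<in> set E. g e = v \<and> c e = r}"
    if "mset (map g S) = mset (map g T)" for g :: "nat \<times> nat \<Rightarrow> nat" and v r
  proof -
    have eq: "card {e \<in> set S. g e = v} = card {e \<in> set T. g e = v}"
      unfolding count_mset_map_distinct[OF assms(6), symmetric]
        count_mset_map_distinct[OF assms(7), symmetric] that by (rule refl)
    have disj: "set S \<inter> set T = {}"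
    proof -
      have False if "e \<in> set S" "e \<in> set T" for e
        using cS[OF that(1)] cT[OF that(2)] ne by simp
      then show ?thesis by blast
    qed
    show ?thesis
      by (rule card_exchange[OF finite_set in_E disj, where a = "\<rho> i" and b = "\<rho> j"])
        (use cS cT c_S c_T c_else eq in blast)+
  qed
  have range: "?c e \<in> {..<k}" if "e \<in> set E" for e
  proof (cases "e \<in> set S \<union> set T")
    case True
    then show ?thesis
      using c_S c_T \<rho>_less ij(1,2) by (metis UnE lessThan_iff)
  next
    case False
    with c_else[of e] have "?c e = c e" by blast
    then show ?thesis
      using block_cases[OF that] \<rho>_less by (metis lessThan_iff)
  qed
  have "?c e = undefined" if "e \<notin> set E" for e
  proof -
    have "?c e = c e"
      using in_E that c_else by blast
    then show ?thesis
      using extensional_arb[OF c_extensional that] by simp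
  qed
  then have ext: "?c \<in> extensional (set E)"
    unfolding extensional_def by blast
  show "?c \<in> incidence_fibre graph {..<k} c"
    unfolding incidence_fibre_def role_outdegree_def role_indegree_def PiE_iff graph_simps
    by (intro CollectI conjI ballI range ext deg bal)
qed

end

text \<open>Equality of the sorted lists is an executable form of equality of the multisets of tails
  and of heads.\<close>

definition balanced_exchange ::
  "(nat \<times> nat) list \<Rightarrow> (nat \<times> nat) list \<Rightarrow> (nat \<times> nat) list \<times> (nat \<times> nat) list \<Rightarrow> bool" where
  "balanced_exchange B C ST \<longleftrightarrow>
     list_all (\<lambda>e. e \<in> set B) (fst ST) \<and> list_all (\<lambda>e. e \<in> set C) (snd ST) \<and>
     distinct (fst ST) \<and> distinct (snd ST) \<and>
     sort (map fst (fst ST)) = sort (map fst (snd ST)) \<and>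
     sort (map snd (fst ST)) = sort (map snd (snd ST))"

text \<open>Blocks keep their positions, so that the new block \<open>m\<close> still carries the
  label \<open>\<rho> m\<close>.\<close>

definition exchange_blocks ::
  "nat \<Rightarrow> nat \<Rightarrow> (nat \<times> nat) list \<times> (nat \<times> nat) list \<Rightarrow> (nat \<times> nat) list list \<Rightarrow> (nat \<times> nat) list list" where
  "exchange_blocks i j ST Bs = Bs[
     i := filter (\<lambda>e. e \<notin> set (fst ST)) (Bs ! i) @ snd ST,
     j := filter (\<lambda>e. e \<notin> set (snd ST)) (Bs ! j) @ fst ST]"

lemma exchange_roles_commute: "exchange_roles a b S c = exchange_roles b a S c"
  by (auto simp: exchange_roles_def)

context labelled_blocks
begin

lemma block_subset: "m < k \<Longrightarrow> set (Bs ! m) \<subseteq> set E"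
  by (metis UN_upper nth_mem set_concat)

lemma block_disjoint: "m < k \<Longrightarrow> m' < k \<Longrightarrow> e \<in> set (Bs ! m) \<Longrightarrow> e \<in> set (Bs ! m') \<Longrightarrow> m = m'"
  using c_block \<rho>_eq_iff by metis

definition "exchanged i j ST = exchange_roles (\<rho> i) (\<rho> j) (set (fst ST) \<union> set (snd ST)) c"

context
  fixes i j ST
  assumes ij: "i < k" "j < k" "i \<noteq> j" and balanced: "balanced_exchange (Bs ! i) (Bs ! j) ST"
begin

lemma exchange_subsets: "set (fst ST) \<subseteq> set (Bs ! i)" "set (snd ST) \<subseteq> set (Bs ! j)"
  using balanced by (auto simp: balanced_exchange_def list_all_iff)

lemma exchanged_in_fibre: "exchanged i j ST \<in> incidence_fibre graph {..<k} c"
  and exchanged_diff: "{e \<in> set E. exchanged i j ST e \<noteq> c e} = set (fst ST) \<union> set (snd ST)"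
proof -
  have "mset (map fst (fst ST)) = mset (map fst (snd ST))" "mset (map snd (fst ST)) = mset (map snd (snd ST))"
    "distinct (fst ST)" "distinct (snd ST)"
    using balanced unfolding balanced_exchange_def by (metis mset_sort)+
  from exchange_in_fibre[OF ij exchange_subsets this(3,4,1,2)]
  show "exchanged i j ST \<in> incidence_fibre graph {..<k} c"
    "{e \<in> set E. exchanged i j ST e \<noteq> c e} = set (fst ST) \<union> set (snd ST)"
    unfolding exchanged_def by blast+
qed

lemma exchanged_cases:
  shows "e \<in> set (fst ST) \<Longrightarrow> exchanged i j ST e = \<rho> j"
    and "e \<in> set (snd ST) \<Longrightarrow> exchanged i j ST e = \<rho> i"
    and "e \<notin> set (fst ST) \<Longrightarrow> e \<notin> set (snd ST) \<Longrightarrow> exchanged i j ST e = c e"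
proof -
  have "c e = \<rho> i" if "e \<in> set (fst ST)"
    using that exchange_subsets(1) c_block[OF ij(1)] by blast
  moreover have "c e = \<rho> j" if "e \<in> set (snd ST)"
    using that exchange_subsets(2) c_block[OF ij(2)] by blast
  moreover have "\<rho> i \<noteq> \<rho> j"
    using ij by simp
  ultimately show "e \<in> set (fst ST) \<Longrightarrow> exchanged i j ST e = \<rho> j"
    "e \<in> set (snd ST) \<Longrightarrow> exchanged i j ST e = \<rho> i"
    "e \<notin> set (fst ST) \<Longrightarrow> e \<notin> set (snd ST) \<Longrightarrow> exchanged i j ST e = c e"
    unfolding exchanged_def exchange_roles_def by simp_all
qed

lemma exchanged_class:
  assumes "m < k"
  shows "{e \<in> set E. exchanged i j ST e = \<rho> m} = set (exchange_blocks i j ST Bs ! m)"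
proof -
  have iff: "e \<in> set E \<and> exchanged i j ST e = \<rho> m \<longleftrightarrow> e \<in> set (exchange_blocks i j ST Bs ! m)" for e
  proof -
    consider "e \<in> set (fst ST)" | "e \<in> set (snd ST)" | "e \<notin> set (fst ST)" "e \<notin> set (snd ST)"
      by blast
    then show ?thesis
    proof cases
      case 1
      then have e: "e \<in> set (Bs ! i)" "e \<in> set E"
        using exchange_subsets(1) block_subset[OF ij(1)] by blast+
      have "e \<notin> set (Bs ! m)" if "m \<noteq> i"
        using that block_disjoint[OF assms ij(1)] e by blast
      moreover have "e \<notin> set (snd ST)"
        using exchange_subsets(2) block_disjoint[OF ij(1,2)] e ij(3) by blast
      ultimately show ?thesis
        using 1 e(2) exchanged_cases(1)[OF 1] ij assms
        by (simp only: exchange_blocks_def nth_list_update length_list_update) auto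
    next
      case 2
      then have e: "e \<in> set (Bs ! j)" "e \<in> set E"
        using exchange_subsets(2) block_subset[OF ij(2)] by blast+
      have "e \<notin> set (Bs ! m)" if "m \<noteq> j"
        using that block_disjoint[OF assms ij(2)] e by blast
      moreover have "e \<notin> set (fst ST)"
        using exchange_subsets(1) block_disjoint[OF ij(1,2)] e ij(3) by blast
      ultimately show ?thesis
        using 2 e(2) exchanged_cases(2)[OF 2] ij assms
        by (simp only: exchange_blocks_def nth_list_update length_list_update) auto
    next
      case 3
      have "e \<in> set E \<and> c e = \<rho> m \<longleftrightarrow> e \<in> set (Bs ! m)"
        using c_eq_iff[OF assms] block_subset[OF assms] by blast
      then show ?thesis
        using 3 exchanged_cases(3)[OF 3] ij assms
        by (simp only: exchange_blocks_def nth_list_update length_list_update) auto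
    qed
  qed
  show ?thesis
    by (rule set_eqI) (simp only: mem_Collect_eq iff)
qed

text \<open>\<open>fibre_partition\<close> has a block only for labels that occur; nonemptiness
  guarantees that no label is lost by the exchange.\<close>

lemma exchanged_partition:
  assumes "[] \<notin> set (exchange_blocks i j ST Bs)"
  shows "fibre_partition (set E) (exchanged i j ST) = set ` set (exchange_blocks i j ST Bs)"
proof -
  have len: "length (exchange_blocks i j ST Bs) = k"
    by (simp add: exchange_blocks_def)
  have nonempty: "exchange_blocks i j ST Bs ! m \<noteq> []" if "m < k" for m
    using assms that len nth_mem by metis
  have range: "exchanged i j ST ` set E = \<rho> ` {..<k}"
  proof (intro equalityI subsetI)
    fix r
    assume "r \<in> exchanged i j ST ` set E"
    then have "r \<in> {..<k}"
      using exchanged_in_fibre unfolding incidence_fibre_def graph_simps by blast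
    then show "r \<in> \<rho> ` {..<k}"
      using bij_\<rho> unfolding bij_betw_def by blast
  next
    fix r
    assume "r \<in> \<rho> ` {..<k}"
    then obtain m where m: "m < k" "r = \<rho> m" by blast
    with nonempty have "set (exchange_blocks i j ST Bs ! m) \<noteq> {}" by simp
    then obtain e where "e \<in> set E" "exchanged i j ST e = \<rho> m"
      unfolding exchanged_class[OF m(1), symmetric] by blast
    then show "r \<in> exchanged i j ST ` set E"
      unfolding m(2) by (metis imageI)
  qed
  have "fibre_partition (set E) (exchanged i j ST) = (\<lambda>r. {e \<in> set E. exchanged i j ST e = r}) ` \<rho> ` {..<k}"
    unfolding fibre_partition_def range by blast
  also have "\<dots> = (\<lambda>m. set (exchange_blocks i j ST Bs ! m)) ` {..<k}"
    unfolding image_image by (intro image_cong refl exchanged_class) simp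
  also have "\<dots> = set ` (!) (exchange_blocks i j ST Bs) ` {..<length (exchange_blocks i j ST Bs)}"
    by (simp only: image_image len)
  also have "(!) (exchange_blocks i j ST Bs) ` {..<length (exchange_blocks i j ST Bs)} = set (exchange_blocks i j ST Bs)"
    unfolding set_conv_nth by blast
  finally show ?thesis .
qed

end

text \<open>On block \<open>i\<close> an exchanged assignment differs from \<open>c\<close> exactly
  at \<open>fst ST\<close>, so these edges alone tell exchanges apart. Filtering the block lists
  them in a fixed order, which turns different sets into different lists.\<close>

lemma card_fibre_ge:
  assumes ij: "i < k" "j < k" "i \<noteq> j"
    and balanced: "list_all (balanced_exchange (Bs ! i) (Bs ! j)) STs"
    and dist: "distinct (map (\<lambda>ST. filter (\<lambda>e. e \<in> set (fst ST)) (Bs ! i)) STs)"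
  shows "length STs \<le> card (incidence_fibre graph (role_labels graph) c)"
proof -
  have bal: "balanced_exchange (Bs ! i) (Bs ! j) ST" if "ST \<in> set STs" for ST
    using balanced that by (simp add: list_all_iff)
  have "filter (\<lambda>e. exchanged i j ST e \<noteq> c e) (Bs ! i) = filter (\<lambda>e. e \<in> set (fst ST)) (Bs ! i)"
    if "ST \<in> set STs" for ST
  proof (rule filter_cong[OF refl])
    fix e
    assume e: "e \<in> set (Bs ! i)"
    then have "e \<notin> set (snd ST)"
      using exchange_subsets(2)[OF ij bal[OF that]] block_disjoint[OF ij(1,2)] ij(3) by blast
    moreover have "e \<in> set E"
      using e block_subset[OF ij(1)] by blast
    ultimately show "exchanged i j ST e \<noteq> c e \<longleftrightarrow> e \<in> set (fst ST)"
      using exchanged_diff[OF ij bal[OF that]] by blast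
  qed
  then have "map (\<lambda>ST. filter (\<lambda>e. e \<in> set (fst ST)) (Bs ! i)) STs =
      map (\<lambda>c'. filter (\<lambda>e. c' e \<noteq> c e) (Bs ! i)) (map (exchanged i j) STs)"
    by simp
  with dist have "distinct (map (\<lambda>c'. filter (\<lambda>e. c' e \<noteq> c e) (Bs ! i)) (map (exchanged i j) STs))"
    by (simp only:)
  then have "distinct (map (exchanged i j) STs)"
    by (rule conjunct1[OF iffD1[OF distinct_map]])
  then have "length STs = card (set (map (exchanged i j) STs))"
    by (metis distinct_card length_map)
  also have "\<dots> \<le> card (incidence_fibre graph {..<k} c)"
  proof (rule card_mono)
    have "incidence_fibre graph {..<k} c \<subseteq> set E \<rightarrow>\<^sub>E {..<k}"
      unfolding incidence_fibre_def graph_simps by blast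
    then show "finite (incidence_fibre graph {..<k} c)"
      by (rule finite_subset) (simp add: finite_PiE)
    show "set (map (exchanged i j) STs) \<subseteq> incidence_fibre graph {..<k} c"
      using exchanged_in_fibre[OF ij bal] by auto
  qed
  finally show ?thesis
    by (simp only: role_labels_graph)
qed

end

section \<open>The behavioural quotient\<close>

lemma Q_approx_equiv: "equiv (pverts G) (Q_approx G \<P> t)"
proof (cases t)
  case 0
  then show ?thesis
    by (auto intro!: equivI refl_onI symI transI)
next
  case (Suc s)
  have "equiv V {(u, v) \<in> V \<times> V. \<forall>C \<in> \<P>. f C u = f C v}" for V and f :: "_ \<Rightarrow> _ \<Rightarrow> 'b"
    by (auto intro!: equivI refl_onI symI transI)
  then show ?thesis
    unfolding Suc Q_approx.simps .
qed

text \<open>By induction each class of the finer equivalence determines the coarser class around it,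
  so equal sets of finer classes give equal sets of coarser ones.\<close>

lemma Q_approx_Suc_subset:
  assumes "\<And>C. C \<in> \<P> \<Longrightarrow> C \<subseteq> pverts G \<times> pverts G"
  shows "Q_approx G \<P> (Suc t) \<subseteq> Q_approx G \<P> t"
proof (induction t)
  case 0
  then show ?case by auto
next
  case (Suc t)
  let ?Q = "Q_approx G \<P>"
  have sub: "(\<lambda>w. ?Q t `` {w}) ` (C `` {u}) \<subseteq> (\<lambda>w. ?Q t `` {w}) ` (C `` {v})"
    if "C \<in> \<P>" and eq: "(\<lambda>w. ?Q (Suc t) `` {w}) ` (C `` {u}) = (\<lambda>w. ?Q (Suc t) `` {w}) ` (C `` {v})"
    for C u v
  proof
    fix X
    assume "X \<in> (\<lambda>w. ?Q t `` {w}) ` (C `` {u})"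
    then obtain w where w: "w \<in> C `` {u}" "X = ?Q t `` {w}" by blast
    then obtain w' where w': "w' \<in> C `` {v}" "?Q (Suc t) `` {w} = ?Q (Suc t) `` {w'}"
      using eq by blast
    have "w' \<in> pverts G"
      using assms[OF that(1)] w' by blast
    then have "w' \<in> ?Q (Suc t) `` {w}"
      unfolding w'(2) by (rule equiv_class_self[OF Q_approx_equiv])
    then have "(w, w') \<in> ?Q t"
      using subsetD[OF Suc.IH] by (simp only: Image_singleton_iff)
    then have "?Q t `` {w} = ?Q t `` {w'}"
      by (rule equiv_class_eq[OF Q_approx_equiv])
    with w(2) have "X = ?Q t `` {w'}" by simp
    then show "X \<in> (\<lambda>w. ?Q t `` {w}) ` (C `` {v})"
      using w'(1) by (rule image_eqI)
  qed
  show ?case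
  proof
    fix e
    assume e_in: "e \<in> ?Q (Suc (Suc t))"
    obtain u v where e: "e = (u, v)" by (cases e)
    note * = e_in[unfolded e Q_approx.simps(2)[of G \<P> "Suc t"] mem_Collect_eq case_prod_conv]
    have step: "(\<lambda>w. ?Q t `` {w}) ` (C `` {u}) = (\<lambda>w. ?Q t `` {w}) ` (C `` {v})" if "C \<in> \<P>" for C
    proof -
      have eq: "(\<lambda>w. ?Q (Suc t) `` {w}) ` (C `` {u}) = (\<lambda>w. ?Q (Suc t) `` {w}) ` (C `` {v})"
        using * that by (rule bspec[OF conjunct2])
      from sub[OF that eq] sub[OF that eq[symmetric]] show ?thesis
        by (rule equalityI)
    qed
    show "e \<in> ?Q (Suc t)"
      unfolding e Q_approx.simps(2)[of G \<P> t] mem_Collect_eq case_prod_conv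
      by (intro conjI ballI step conjunct1[OF *])
  qed
qed

text \<open>Strict refinement forever would make the cardinalities decrease without end. This gives
  the \<open>LEAST\<close> in \<open>Q_stable\<close> its meaning.\<close>

lemma Q_approx_stabilizes:
  assumes "\<And>C. C \<in> \<P> \<Longrightarrow> C \<subseteq> pverts G \<times> pverts G" "finite (pverts G)"
  shows "\<exists>t. Q_approx G \<P> (Suc t) = Q_approx G \<P> t"
proof (rule ccontr)
  assume "\<not> ?thesis"
  then have strict: "Q_approx G \<P> (Suc t) \<subset> Q_approx G \<P> t" for t
    using Q_approx_Suc_subset[OF assms(1)] by blast
  have fin: "finite (Q_approx G \<P> t)" for t
    by (rule finite_subset[OF equiv_type[OF Q_approx_equiv]]) (simp add: assms(2))
  have "card (Q_approx G \<P> t) + t \<le> card (Q_approx G \<P> 0)" for t :: nat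
  proof (induction t)
    case (Suc t)
    with psubset_card_mono[OF fin[of t] strict[of t]] show ?case by linarith
  qed simp
  from this[of "Suc (card (Q_approx G \<P> 0))"] show False by linarith
qed

lemma Q_stable_equiv: "equiv (pverts G) (Q_stable G \<P>)"
  unfolding Q_stable_def by (rule Q_approx_equiv)

text \<open>The stable equivalence is a bisimulation; this is all that is ever used about it besides
  being an equivalence.\<close>

lemma Q_stable_step:
  assumes "\<And>C. C \<in> \<P> \<Longrightarrow> C \<subseteq> pverts G \<times> pverts G" "finite (pverts G)"
    and "(u, v) \<in> Q_stable G \<P>" "C \<in> \<P>" "(u, w) \<in> C"
  obtains w' where "(v, w') \<in> C" "(w, w') \<in> Q_stable G \<P>"
proof -
  define T where "T = (LEAST t. Q_approx G \<P> (Suc t) = Q_approx G \<P> t)"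
  have stable: "Q_stable G \<P> = Q_approx G \<P> T"
    by (simp only: Q_stable_def T_def)
  have "Q_approx G \<P> (Suc T) = Q_approx G \<P> T"
    unfolding T_def using Q_approx_stabilizes[OF assms(1,2)] by (rule LeastI_ex)
  with assms(3) have "(u, v) \<in> Q_approx G \<P> (Suc T)"
    by (simp only: stable)
  note * = this[unfolded Q_approx.simps(2)[of G \<P> T] mem_Collect_eq case_prod_conv]
  have eq: "(\<lambda>w. Q_approx G \<P> T `` {w}) ` (C `` {u}) = (\<lambda>w. Q_approx G \<P> T `` {w}) ` (C `` {v})"
    using * assms(4) by (rule bspec[OF conjunct2])
  have "Q_approx G \<P> T `` {w} \<in> (\<lambda>w. Q_approx G \<P> T `` {w}) ` (C `` {u})"
    using assms(5) by (intro imageI) simp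
  then obtain w' where w': "w' \<in> C `` {v}" "Q_approx G \<P> T `` {w} = Q_approx G \<P> T `` {w'}"
    unfolding eq by (rule imageE)
  have "w' \<in> pverts G"
    using assms(1)[OF assms(4)] w'(1) by blast
  then have "w' \<in> Q_approx G \<P> T `` {w}"
    unfolding w'(2) by (rule equiv_class_self[OF Q_approx_equiv])
  with w'(1) that show ?thesis
    unfolding stable by simp
qed

lemma kappa_eq_iff: "u \<in> pverts G \<Longrightarrow> v \<in> pverts G \<Longrightarrow> kappa G \<P> u = kappa G \<P> v \<longleftrightarrow> v \<in> kappa G \<P> u"
  unfolding kappa_def using eq_equiv_class_iff[OF Q_stable_equiv] by fast

lemma word_rel_Image: "word_rel G [] `` S = pverts G \<inter> S" "word_rel G (C # w) `` S = word_rel G w `` (C `` S)"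
  by (auto simp: word_rel_def)

lemma word_rel_append_Image: "word_rel G (v @ w) `` S = word_rel G w `` (word_rel G v `` S)"
  if "S \<subseteq> pverts G" "\<And>C. C \<in> set v \<Longrightarrow> C \<subseteq> pverts G \<times> pverts G"
  using that
proof (induction v arbitrary: S)
  case Nil
  then show ?case by (simp add: word_rel_Image(1) Int_absorb1)
next
  case (Cons C v)
  have "C \<subseteq> pverts G \<times> pverts G"
    by (rule Cons.prems(2)) simp
  then have "C `` S \<subseteq> pverts G" by blast
  then have "word_rel G (v @ w) `` (C `` S) = word_rel G w `` (word_rel G v `` (C `` S))"
    by (rule Cons.IH) (rule Cons.prems(2), simp)
  then show ?case
    by (simp only: append_Cons word_rel_Image(2))
qed

lemma word_image_nonempty:
  assumes "\<And>C. C \<in> \<P> \<Longrightarrow> C \<subseteq> pverts G \<times> pverts G" "finite (pverts G)"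
    and "(u, v) \<in> Q_stable G \<P>" "is_word \<P> w" "word_rel G w `` {u} \<noteq> {}"
  shows "word_rel G w `` {v} \<noteq> {}"
  using assms(3-)
proof (induction w arbitrary: u v)
  case Nil
  have "v \<in> pverts G"
    using Nil(1) equiv_type[OF Q_stable_equiv] by blast
  then show ?case by (simp add: word_rel_Image(1))
next
  case (Cons C w)
  have C: "C \<in> \<P>" and w: "is_word \<P> w"
    using Cons.prems(2) by (simp_all add: is_word_def)
  obtain u' where u': "(u, u') \<in> C" "word_rel G w `` {u'} \<noteq> {}"
    using Cons.prems(3) unfolding word_rel_Image(2) by blast
  obtain v' where v': "(v, v') \<in> C" "(u', v') \<in> Q_stable G \<P>"
    using Q_stable_step[OF assms(1,2) Cons.prems(1) C u'(1)] by metis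
  from Cons.IH[OF v'(2) w u'(2)] v'(1) show ?case
    unfolding word_rel_Image(2) by blast
qed

text \<open>Bisimilar states can execute the same words, so a word dead at \<open>u\<close> but
  alive at \<open>v\<close> separates their classes.\<close>

lemma kappa_neqI:
  assumes "\<And>C. C \<in> \<P> \<Longrightarrow> C \<subseteq> pverts G \<times> pverts G" "finite (pverts G)"
    and "u \<in> pverts G" "v \<in> pverts G" "is_word \<P> w" "word_rel G w `` {u} = {}" "word_rel G w `` {v} \<noteq> {}"
  shows "kappa G \<P> u \<noteq> kappa G \<P> v"
proof
  assume "kappa G \<P> u = kappa G \<P> v"
  then have "u \<in> kappa G \<P> v"
    using kappa_eq_iff[OF assms(4,3), of \<P>] by simp
  then have "(v, u) \<in> Q_stable G \<P>"
    by (simp add: kappa_def)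
  from word_image_nonempty[OF assms(1,2) this assms(5,7)] assms(6) show False by simp
qed

section \<open>Certificates whose orbit swaps two states\<close>

text \<open>A swap of \<open>p\<close> and \<open>q\<close> yields an orbit of period 2 with support
  \<open>{p, q}\<close>. The use word makes \<open>beta\<close> empty at \<open>p\<close> and
  nonempty at \<open>q\<close>, so the use condition holds whatever the classes are.\<close>

locale swap_certificate =
  fixes G :: "'v pair_pre_digraph" and \<P> :: "'v rel set" and c :: "'v certificate"
  assumes fork: "fork_ok G \<P> c" and offload: "offload_ok G \<P> c"
    and words: "is_word \<P> (orbit_word c)" "orbit_word c \<noteq> []" "is_word \<P> (use_word c)" "use_word c \<noteq> []"
    and states: "off_p c \<in> pverts G" "off_q c \<in> pverts G"
    and swap: "word_rel G (orbit_word c) `` {off_p c} = {off_q c}" "word_rel G (orbit_word c) `` {off_q c} = {off_p c}"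
    and use_p: "word_rel G (use_word c) `` {off_p c} = {}" and use_q: "word_rel G (use_word c) `` {off_q c} \<noteq> {}"
begin

lemma kappa_neq: "kappa G \<P> (off_p c) \<noteq> kappa G \<P> (off_q c)" and neq: "off_p c \<noteq> off_q c"
  using offload by (auto simp: offload_ok_def)

lemma orbit: "orbit_iterate G c n = Some (if even n then (off_p c, off_q c) else (off_q c, off_p c))"
  unfolding orbit_iterate_def by (induction n) (auto simp: pair_map_def swap)

lemma pair_orbit: "pair_orbit G c n = (if even n then (off_p c, off_q c) else (off_q c, off_p c))"
  by (simp add: pair_orbit_def orbit)

lemma wpu: "wpu_certificate G \<P> c"
proof -
  have "word_rel G (orbit_word c) \<noteq> Id_on (pverts G)"
    using swap(1) neq by (metis Image_singleton_iff Id_on_iff singletonI)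
  moreover have "\<exists>a b. orbit_iterate G c n = Some (a, b) \<and> kappa G \<P> a \<noteq> kappa G \<P> b" for n
    using kappa_neq by (cases "even n") (auto simp: orbit)
  moreover have "orbit_iterate G c (Suc 0) \<noteq> orbit_iterate G c 0"
    using neq by (simp add: orbit)
  ultimately have "persistent_ok G \<P> c"
    using words unfolding persistent_ok_def by blast
  moreover have "word_rel G (use_word c) \<noteq> Id_on (pverts G)"
    using use_p states(1) by (metis Image_singleton_iff Id_on_iff empty_iff)
  then have "use_ok G \<P> c"
    using words use_p use_q by (simp add: use_ok_def beta_def)
  ultimately show ?thesis
    using fork offload by (simp add: wpu_certificate_def)
qed

lemma support: "sys_support G {c} = {off_p c, off_q c}"
proof -
  have range: "range (\<lambda>n::nat. if even n then a else b) = {a, b}" for a b :: 'v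
  proof
    have "{a, b} = (\<lambda>n::nat. if even n then a else b) ` {0, 1}"
      by auto
    then show "{a, b} \<subseteq> range (\<lambda>n::nat. if even n then a else b)"
      by blast
  qed auto
  have "sys_support G {c} = range (fst \<circ> pair_orbit G c) \<union> range (snd \<circ> pair_orbit G c)"
    by (simp add: sys_support_def cert_support_def)
  moreover have "fst \<circ> pair_orbit G c = (\<lambda>n. if even n then off_p c else off_q c)"
    "snd \<circ> pair_orbit G c = (\<lambda>n. if even n then off_q c else off_p c)"
    by (auto simp: pair_orbit)
  ultimately show ?thesis
    by (simp only: range) blast
qed

lemma class_pair: "sys_class_pair G \<P> {c} = {kappa G \<P> (off_p c), kappa G \<P> (off_q c)}"
  by (simp add: sys_class_pair_def cert_class_pair_def)

text \<open>The two support states lie in different classes, so each class has one representative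
  and a translation amounts to two word images.\<close>

lemma representatives:
  "representatives G {c} (kappa G \<P> (off_p c)) = {off_p c}"
  "representatives G {c} (kappa G \<P> (off_q c)) = {off_q c}"
proof -
  have "off_q c \<notin> kappa G \<P> (off_p c)" "off_p c \<notin> kappa G \<P> (off_q c)"
    "off_p c \<in> kappa G \<P> (off_p c)" "off_q c \<in> kappa G \<P> (off_q c)"
    using kappa_eq_iff states kappa_neq by metis+
  then show "representatives G {c} (kappa G \<P> (off_p c)) = {off_p c}"
    "representatives G {c} (kappa G \<P> (off_q c)) = {off_q c}"
    unfolding representatives_def support by blast+
qed

lemma record_system: "record_system G \<P> {c}"
  unfolding record_system_def class_pair using wpu by (auto simp: representatives)

lemma eventual_period: "eventual_period (pair_orbit G c) = 2"
  unfolding eventual_period_def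
proof (rule Least_equality)
  show "2 > (0::nat) \<and> (\<exists>N. \<forall>n\<ge>N. pair_orbit G c (n + 2) = pair_orbit G c n)"
    by (simp add: pair_orbit)
next
  fix m :: nat
  assume m: "m > 0 \<and> (\<exists>N. \<forall>n\<ge>N. pair_orbit G c (n + m) = pair_orbit G c n)"
  have "m \<noteq> 1"
  proof
    assume "m = 1"
    with m obtain N where "pair_orbit G c (N + 1) = pair_orbit G c N" by blast
    then show False
      using neq by (auto simp: pair_orbit split: if_splits)
  qed
  with m show "2 \<le> m" by linarith
qed

lemma preperiod: "preperiod (pair_orbit G c) = 0"
  unfolding preperiod_def eventual_period by (rule Least_equality) (simp_all add: pair_orbit)

end

text \<open>One channel serves both branches of the fork. Offloading carries \<open>l\<close> to
  \<open>p\<close> and \<open>r\<close> to \<open>q\<close>, so the offload word followed by the use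
  word already separates \<open>l\<close> from \<open>r\<close>.\<close>

lemma swap_certificateI:
  assumes \<P>: "\<And>C. C \<in> \<P> \<Longrightarrow> C \<subseteq> pverts G \<times> pverts G" "finite (pverts G)"
    and states: "s \<in> pverts G" "p \<in> pverts G" "q \<in> pverts G"
    and A: "A \<in> \<P>" "l \<in> A `` {s}" "r \<in> A `` {s}" "A `` {p} \<noteq> {}" "A `` {q} \<noteq> {}"
    and words: "is_word \<P> o'" "is_word \<P> z" "z \<noteq> []" "is_word \<P> u" "u \<noteq> []"
    and offload: "word_rel G o' `` {l} = {p}" "word_rel G o' `` {r} = {q}"
    and swap: "word_rel G z `` {p} = {q}" "word_rel G z `` {q} = {p}"
    and use: "word_rel G u `` {p} = {}" "word_rel G u `` {q} \<noteq> {}"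
  shows "swap_certificate G \<P> \<lparr>fork_state = s, chan_A = A, chan_B = A, fork_l = l, fork_r = r,
    offload_word = o', off_p = p, off_q = q, orbit_word = z, use_word = u\<rparr>"
proof -
  have lr: "l \<in> pverts G" "r \<in> pverts G"
    using \<P>(1)[OF A(1)] A(2,3) by auto
  have sub: "C \<subseteq> pverts G \<times> pverts G" if "C \<in> set o'" for C
    using that words(1) \<P>(1) unfolding is_word_def by blast
  have "word_rel G (o' @ u) `` {l} = {}" "word_rel G (o' @ u) `` {r} \<noteq> {}"
    using lr use by (simp_all add: word_rel_append_Image[OF _ sub] offload)
  moreover have "is_word \<P> (o' @ u)"
    using words by (simp add: is_word_def)
  ultimately have "kappa G \<P> l \<noteq> kappa G \<P> r"
    using kappa_neqI[OF \<P> lr] by blast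
  moreover have "kappa G \<P> p \<noteq> kappa G \<P> q"
    using kappa_neqI[OF \<P> states(2,3) words(4) use] .
  moreover from this have "p \<noteq> q" by blast
  ultimately show ?thesis
    using states A words offload swap use
    by unfold_locales (simp_all add: fork_ok_def offload_ok_def)
qed

text \<open>All record systems used consist of one certificate, and \<open>the_elem\<close> recovers
  it.\<close>

definition class_presentation :: "'v pair_pre_digraph \<Rightarrow> 'v rel set \<Rightarrow> 'v record_sys \<Rightarrow> 'v set \<times> 'v set" where
  "class_presentation G \<P> X = (kappa G \<P> (off_p (the_elem X)), kappa G \<P> (off_q (the_elem X)))"

lemma translationI:
  assumes c: "swap_certificate G \<P> c" and d: "swap_certificate G \<P> d"
    and "c \<noteq> d" "is_word \<P> t" "t \<noteq> []" "\<pi> permutes {0, 1}"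
    and p: "word_rel G t `` {off_p c} = {v}" "v \<in> {off_p d, off_q d}"
      "kappa G \<P> v = entry (class_presentation G \<P> {d}) (\<pi> 0)"
    and q: "word_rel G t `` {off_q c} = {w}" "w \<in> {off_p d, off_q d}"
      "kappa G \<P> w = entry (class_presentation G \<P> {d}) (\<pi> 1)"
  shows "induces_translation G \<P> (class_presentation G \<P>) {c} t \<pi> {d}"
proof -
  have reps: "representatives G {c} (entry (class_presentation G \<P> {c}) 0) = {off_p c}"
    "representatives G {c} (entry (class_presentation G \<P> {c}) 1) = {off_q c}"
    using swap_certificate.representatives[OF c] by (simp_all add: entry_def class_presentation_def)
  have "\<exists>w. word_rel G t `` {v} = {w} \<and> w \<in> sys_support G {d} \<and>
      kappa G \<P> w = entry (class_presentation G \<P> {d}) (\<pi> i)"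
    if "i \<in> {0, 1}" "v \<in> representatives G {c} (entry (class_presentation G \<P> {c}) i)" for i v
    using that(1)
  proof
    assume "i = 0"
    with that(2) have "v = off_p c"
      by (simp only: reps) simp
    with p \<open>i = 0\<close> show ?thesis
      unfolding swap_certificate.support[OF d] by blast
  next
    assume "i \<in> {1}"
    then have "i = 1" by simp
    with that(2) have "v = off_q c"
      by (simp only: reps) simp
    with q \<open>i = 1\<close> show ?thesis
      unfolding swap_certificate.support[OF d] by blast
  qed
  with assms(3-6) show ?thesis
    unfolding induces_translation_def by blast
qed

lemma swap_translation:
  assumes "swap_certificate G \<P> c" "swap_certificate G \<P> d" "c \<noteq> d" "is_word \<P> t" "t \<noteq> []"
  shows "word_rel G t `` {off_p c} = {off_p d} \<Longrightarrow> word_rel G t `` {off_q c} = {off_q d} \<Longrightarrow>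
      induces_translation G \<P> (class_presentation G \<P>) {c} t id {d}"
    and "word_rel G t `` {off_p c} = {off_q d} \<Longrightarrow> word_rel G t `` {off_q c} = {off_p d} \<Longrightarrow>
      induces_translation G \<P> (class_presentation G \<P>) {c} t (transpose 0 1) {d}"
proof -
  have entries: "entry (class_presentation G \<P> {d}) 0 = kappa G \<P> (off_p d)"
    "entry (class_presentation G \<P> {d}) 1 = kappa G \<P> (off_q d)"
    by (simp_all add: entry_def class_presentation_def)
  show "induces_translation G \<P> (class_presentation G \<P>) {c} t id {d}"
    if "word_rel G t `` {off_p c} = {off_p d}" "word_rel G t `` {off_q c} = {off_q d}"
    by (rule translationI[OF assms permutes_id that(1) _ _ that(2)]) (simp_all only: entries id_apply insert_iff simp_thms)
  have "(transpose 0 1 :: nat \<Rightarrow> nat) permutes {0, 1}"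
    by (rule permutes_swap_id) simp_all
  then show "induces_translation G \<P> (class_presentation G \<P>) {c} t (transpose 0 1) {d}"
    if "word_rel G t `` {off_p c} = {off_q d}" "word_rel G t `` {off_q c} = {off_p d}"
    by (rule translationI[OF assms _ that(1) _ _ that(2)])
      (simp_all only: entries transpose_apply_first transpose_apply_second insert_iff simp_thms)
qed

text \<open>
  \<open>t\<close> and \<open>t'\<close> translate in opposite directions; \<open>t''\<close> translates back with the two classes
  exchanged, so \<open>t\<close> followed by \<open>t''\<close> is an odd closed walk.
\<close>

lemma property_H_swap:
  assumes c: "swap_certificate G \<P> c" and d: "swap_certificate G \<P> d" and e: "swap_certificate G \<P> e"
    and supports: "off_p e = off_p c" "off_q e \<noteq> off_q c" "off_p d \<noteq> off_p c"
    and words: "is_word \<P> t" "t \<noteq> []" "is_word \<P> t'" "t' \<noteq> []" "is_word \<P> t''" "t'' \<noteq> []"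
    and t: "word_rel G t `` {off_p c} = {off_p d}" "word_rel G t `` {off_q c} = {off_q d}"
    and t': "word_rel G t' `` {off_p d} = {off_p c}" "word_rel G t' `` {off_q d} = {off_q c}"
    and t'': "word_rel G t'' `` {off_p d} = {off_q c}" "word_rel G t'' `` {off_q d} = {off_p c}"
  shows "property_H G \<P> = 1"
proof -
  let ?F = "{{c}, {d}, {e}}" and ?pres = "class_presentation G \<P>"
  have neq: "c \<noteq> d" "d \<noteq> e" "c \<noteq> e"
    using supports by auto
  have cd: "induces_translation G \<P> ?pres {c} t id {d}"
    using swap_translation(1)[OF c d neq(1)] words t by blast
  have dc: "induces_translation G \<P> ?pres {d} t' id {c}"
    using swap_translation(1)[OF d c] neq words t' by metis
  have dc': "induces_translation G \<P> ?pres {d} t'' (transpose 0 1) {c}"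
    using swap_translation(2)[OF d c] neq words t'' by metis
  have E1: "cond_E1 ?F"
    using neq by (simp add: cond_E1_def)
  have E2: "cond_E2 G \<P> ?pres ?F"
    unfolding cond_E2_def using cd dc neq by blast
  \<comment> \<open>Both supports have two elements and share \<open>off_p c\<close> only, a proper
    overlap.\<close>
  have "off_p c \<noteq> off_q c" "off_p e \<noteq> off_q e"
    using swap_certificate.neq c e by metis+
  then have "\<not> {off_p c, off_q c} \<subseteq> {off_p e, off_q e}" "\<not> {off_p e, off_q e} \<subseteq> {off_p c, off_q c}"
    "{off_p c, off_q c} \<inter> {off_p e, off_q e} \<noteq> {}"
    using supports by auto
  then have E3: "cond_E3 G ?F"
    unfolding cond_E3_def
    using swap_certificate.support[OF c] swap_certificate.support[OF e] by (metis insertCI)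
  \<comment> \<open>The orbit of \<open>c\<close> alternates from the start, so its first coordinate
    runs through \<open>off_p c\<close> and \<open>off_q c\<close>; \<open>t\<close> sends these to
    the two states of \<open>d\<close>, whose classes differ.\<close>
  have E4: "cond_E4 G \<P> ?F"
    unfolding cond_E4_def
  proof (intro bexI exI conjI)
    show "{c} \<noteq> {d}" "is_word \<P> t" "t \<noteq> []"
      using neq words by auto
    have kappa: "kappa G \<P> (off_p d) \<noteq> kappa G \<P> (off_q d)"
      using swap_certificate.kappa_neq[OF d] .
    show "let m = eventual_period (pair_orbit G c); N = preperiod (pair_orbit G c)
      in 1 < m \<and>
         (\<forall>h<m. word_rel G t `` {entry (pair_orbit G c (N + h)) 0} = {if h = 0 then off_p d else off_q d} \<and>
                (if h = 0 then off_p d else off_q d) \<in> sys_support G {d} \<and>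
                kappa G \<P> (if h = 0 then off_p d else off_q d) \<in> sys_class_pair G \<P> {d}) \<and>
         (\<exists>h<m. \<exists>h'<m. kappa G \<P> (if h = 0 then off_p d else off_q d) \<noteq> kappa G \<P> (if h' = 0 then off_p d else off_q d))"
      unfolding Let_def swap_certificate.eventual_period[OF c] swap_certificate.preperiod[OF c]
      using t kappa
      by (auto simp: less_2_cases_iff swap_certificate.pair_orbit[OF c] entry_def swap_certificate.support[OF d]
          swap_certificate.class_pair[OF d] intro!: exI[of _ 0] exI[of _ 1])
  qed auto
  have E5: "cond_E5 G \<P> ?pres ?F"
    unfolding cond_E5_def
  proof (intro exI conjI)
    show "pre_digraph.awalk (translation_multigraph G \<P> ?pres ?F) {c}
        [({c}, t, id, {d}), ({d}, t'', transpose 0 1, {c})] {c}"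
      using cd dc' by (simp add: pre_digraph.awalk_def pre_digraph.cas.simps translation_multigraph_def)
    show "odd (\<Sum>(Y, t, \<pi>, Z)\<leftarrow>[({c}, t, id, {d}), ({d}, t'', transpose 0 1, {c})]. gain \<pi>)"
      by (simp add: gain_def evenperm_swap evenperm_id)
  qed
  have systems: "record_system G \<P> X" if "X \<in> ?F" for X
    using that swap_certificate.record_system c d e by blast
  have pres: "{fst (?pres X), snd (?pres X)} = sys_class_pair G \<P> X" if "X \<in> ?F" for X
    using that swap_certificate.class_pair[OF c] swap_certificate.class_pair[OF d] swap_certificate.class_pair[OF e]
    by (auto simp: class_presentation_def)
  have fin: "finite ?F" by simp
  show ?thesis
    unfolding property_H_def
    by (rule if_P, intro exI[of _ ?F] exI[of _ ?pres] conjI ballI fin systems pres E1 E2 E3 E4 E5)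
qed

section \<open>The four catalogue graphs\<close>

definition states_226 :: "trm list list" where
  "states_226 = [
    [TA, TR TA (TR TA TA), TR TV TA], [TA, TR TA (TR TA (TR TA TA)), TR TV TA],
    [TA, TR TA (TR TA (TR TA (TR TA (TR TA TA)))), TR TV TA],
    [TA, TR TA (TR TA (TR (TR TA (TR TA TA)) TA)), TR TV TA],
    [TA, TR TA (TR (TR TA TA) TA), TR TV TA],
    [TA, TR TA (TR (TR TA TA) (TR (TR TA TA) TA)), TR TV TA],
    [TA, TR TA (TR (TR TA (TR TA TA)) (TR TA TA)), TR TV TA],
    [TA, TR TA (TR (TR TA (TR (TR TA TA) TA)) TA), TR TV TA],
    [TA, TR TA (TR (TR (TR (TR TA TA) TA) TA) TA), TR TV TA],
    [TA, TR (TR TA TA) (TR TA TA), TR TV TA],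
    [TA, TR (TR TA (TR TA TA)) (TR TA (TR TA TA)), TR TV TA],
    [TA, TR (TR (TR TA TA) TA) (TR (TR TA TA) TA), TR TV TA],
    [TR TA TA, TR TA (TR TA TA), TR TV TA], [TR TA TA, TR TA (TR TA (TR TA TA)), TR TV TA],
    [TR TA TA, TR TA (TR (TR TA TA) TA), TR TV TA],
    [TR TA TA, TR (TR TA TA) (TR TA TA), TR TV TA],
    [TR TA (TR TA TA), TR TA (TR TA TA), TR TV TA],
    [TR TA (TR TA TA), TR TA (TR TA (TR TA TA)), TR TV TA],
    [TR TA (TR TA TA), TR (TR TA TA) TA, TR TV TA],
    [TR TA (TR (TR TA TA) TA), TR (TR TA TA) TA, TR TV TA]]"

text \<open>The expanded states outside the core outnumber it, in this row and in the other three,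
  so one layer would not be short enough.\<close>

definition layers_226 :: "trm list list list" where
  "layers_226 = [
   [[TA, TR (TR TA TA) TA, TR TV TA], [TR TA TA, TR TA TA, TR TV TA], [TA, TR TA TA, TR TV TA],
    [TA, TA, TR TA TA], [TA, TR TA (TR TA (TR TA TA)), TR TV (TR TA TA)],
    [TA, TR TA TA, TR TV (TR TA TA)], [TA, TR (TR TA TA) (TR TA TA), TR TV (TR TA TA)],
    [TA, TR TA (TR TA TA), TR TV (TR TA TA)], [TA, TR TA (TR (TR TA TA) TA), TR TV (TR TA TA)],
    [TA, TR TA (TR TA TA), TR TV (TR (TR TA TA) TA)],
    [TA, TR TA (TR (TR TA TA) TA), TR TV (TR (TR TA TA) TA)],
    [TR TA TA, TR TA (TR TA TA), TR TV (TR TA TA)],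
    [TA, TR TA (TR TA TA), TR TV (TR TA (TR TA TA))],
    [TA, TR TA (TR TA (TR TA TA)), TR TV (TR TA (TR TA TA))], [TA, TA, TR TV TA], [TA, TA, TA],
    [TA, TA, TR TA (TR TA TA)], [TA, TA, TR (TR TA TA) (TR TA TA)],
    [TA, TA, TR TA (TR TA (TR TA TA))]],
   [[TA, TA, TR TA (TR (TR TA TA) TA)], [TA, TR TA TA, TR TA (TR TA TA)]]]"

text \<open>Blocks are numbered by their least edge, in all four rows; inside a block the order is
  an \<open>opposite_chain\<close>.\<close>

definition blocks_226 :: "(nat \<times> nat) list list" where
  "blocks_226 = [
   [(0, 1), (12, 13), (16, 17), (17, 13), (0, 12), (12, 0), (16, 12), (1, 17), (17, 16), (13, 1),
    (14, 4), (15, 9), (17, 1), (17, 0), (2, 0), (3, 0), (1, 0), (13, 12), (16, 0), (1, 2), (1, 3),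
    (17, 12), (12, 18)],
   [(0, 4), (12, 14), (18, 19)],
   [(0, 9), (12, 15)],
   [(1, 6)],
   [(1, 10)],
   [(2, 1)],
   [(3, 1)],
   [(4, 0), (14, 12), (19, 18)],
   [(4, 5)],
   [(4, 7), (8, 0)],
   [(4, 8), (7, 0)],
   [(4, 11)],
   [(4, 19)],
   [(5, 4)],
   [(6, 1)],
   [(7, 4)],
   [(8, 4)],
   [(9, 0), (15, 12)],
   [(10, 1)],
   [(11, 4)],
   [(12, 16), (18, 0), (19, 4)],
   [(18, 12), (19, 14)]]"

definition states_3388 :: "trm list list" where
  "states_3388 = [
    [TP TA TA, TR TA (TP TA TA), TR TV (TP TA TA)],
    [TP TA TA, TR TA (TP TA (TP TA TA)), TR TV (TP TA TA)],
    [TP TA TA, TR TA (TP TA (TP TA (TP TA TA))), TR TV (TP TA TA)],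
    [TP TA TA, TR TA (TP TA (TP TA (TP TA (TP TA TA)))), TR TV (TP TA TA)],
    [TP TA TA, TR TA (TP TA (TP (TP TA TA) TA)), TR TV (TP TA TA)],
    [TP TA TA, TR TA (TP TA (TP (TP TA (TP TA TA)) TA)), TR TV (TP TA TA)],
    [TP TA TA, TR TA (TP (TP TA TA) TA), TR TV (TP TA TA)],
    [TP TA TA, TR TA (TP (TP TA TA) (TP TA TA)), TR TV (TP TA TA)],
    [TP TA TA, TR TA (TP (TP TA TA) (TP (TP TA TA) TA)), TR TV (TP TA TA)],
    [TP TA TA, TR TA (TP (TP TA (TP TA TA)) TA), TR TV (TP TA TA)],
    [TP TA TA, TR TA (TP (TP TA (TP TA TA)) (TP TA TA)), TR TV (TP TA TA)],
    [TP TA TA, TR TA (TP (TP TA (TP (TP TA TA) TA)) TA), TR TV (TP TA TA)],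
    [TP TA TA, TR TA (TP (TP (TP TA TA) TA) TA), TR TV (TP TA TA)],
    [TP TA TA, TR TA (TP (TP (TP (TP TA TA) TA) TA) TA), TR TV (TP TA TA)],
    [TP TA (TP TA TA), TR TA (TP TA TA), TR TV (TP TA TA)],
    [TP TA (TP TA TA), TR TA (TP TA (TP TA TA)), TR TV (TP TA TA)],
    [TP TA (TP TA TA), TR TA (TP (TP TA TA) TA), TR TV (TP TA TA)],
    [TP TA (TP TA (TP TA TA)), TR TA (TP TA TA), TR TV (TP TA TA)],
    [TP TA (TP TA (TP TA TA)), TR TA (TP TA (TP TA TA)), TR TV (TP TA TA)],
    [TP TA (TP (TP TA TA) TA), TR TA (TP TA TA), TR TV (TP TA TA)],
    [TP TA (TP (TP TA TA) TA), TR TA (TP (TP TA TA) TA), TR TV (TP TA TA)],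
    [TP (TP TA TA) TA, TR TA (TP TA TA), TR TV (TP TA TA)],
    [TP (TP TA TA) TA, TR TA (TP TA (TP TA TA)), TR TV (TP TA TA)],
    [TP (TP TA TA) TA, TR TA (TP (TP TA TA) TA), TR TV (TP TA TA)],
    [TP (TP TA TA) (TP TA TA), TR TA (TP TA TA), TR TV (TP TA TA)],
    [TP (TP TA (TP TA TA)) TA, TR TA (TP TA TA), TR TV (TP TA TA)],
    [TP (TP TA (TP TA TA)) TA, TR TA (TP TA (TP TA TA)), TR TV (TP TA TA)],
    [TP (TP (TP TA TA) TA) TA, TR TA (TP TA TA), TR TV (TP TA TA)],
    [TP (TP (TP TA TA) TA) TA, TR TA (TP (TP TA TA) TA), TR TV (TP TA TA)]]"

definition layers_3388 :: "trm list list list" where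
  "layers_3388 = [
   [[TP TA TA, TP TA TA, TR TA (TP TA TA)], [TP TA TA, TP TA TA, TR TA (TP (TP TA TA) TA)],
    [TP TA TA, TP TA TA, TR TA (TP TA (TP TA TA))],
    [TP TA TA, TR TA (TP TA TA), TR TV (TP TA (TP TA TA))],
    [TP TA TA, TR TA (TP (TP TA TA) TA), TR TV (TP TA (TP TA TA))],
    [TP (TP TA TA) TA, TR TA (TP TA TA), TR TV (TP TA (TP TA TA))],
    [TP TA TA, TR TA (TP TA TA), TR TV (TP TA (TP (TP TA TA) TA))],
    [TP TA TA, TR TA (TP (TP TA TA) TA), TR TV (TP TA (TP (TP TA TA) TA))],
    [TP TA TA, TP TA (TP TA TA), TR TA (TP TA TA)],
    [TP (TP TA (TP TA TA)) TA, TR TA (TP TA TA), TR TV (TP TA (TP TA TA))],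
    [TP TA (TP TA TA), TR TA (TP TA TA), TR TV (TP TA (TP TA TA))],
    [TP TA (TP TA (TP TA TA)), TR TA (TP TA TA), TR TV (TP TA (TP TA TA))],
    [TP TA TA, TR TA (TP TA TA), TR TV (TP TA (TP TA (TP TA TA)))],
    [TP TA TA, TR TA (TP TA TA), TR TV (TP TA (TP TA (TP TA (TP TA TA))))],
    [TP TA TA, TR TA (TP TA TA), TR TV (TP TA (TP (TP TA (TP TA TA)) TA))],
    [TP TA TA, TR TA (TP (TP TA (TP TA TA)) TA), TR TV (TP TA (TP TA TA))],
    [TP TA TA, TR TA (TP TA (TP TA TA)), TR TV (TP TA (TP TA TA))],
    [TP TA TA, TR TA (TP TA (TP TA (TP TA TA))), TR TV (TP TA (TP TA TA))],
    [TP TA TA, TR TA (TP TA (TP TA TA)), TR TV (TP TA (TP TA (TP TA TA)))],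
    [TP TA TA, TR TA (TP TA TA), TR TV (TP (TP TA TA) TA)],
    [TP TA (TP TA TA), TR TA (TP TA TA), TR TV (TP (TP TA TA) TA)],
    [TP TA TA, TR TA (TP TA (TP TA TA)), TR TV (TP (TP TA TA) TA)],
    [TP TA TA, TR TA (TP TA (TP (TP TA TA) TA)), TR TV (TP (TP TA TA) TA)],
    [TP TA TA, TR TA (TP TA TA), TR TV (TP (TP (TP TA TA) TA) TA)]],
   [[TP TA (TP TA TA), TR (TP TA TA) (TP TA TA), TR TV (TP TA TA)],
    [TP TA TA, TR (TP TA (TP TA TA)) (TP TA (TP TA TA)), TR TV (TP TA TA)],
    [TP TA TA, TR (TP TA TA) (TP TA TA), TR TV (TP TA (TP TA TA))],
    [TP TA TA, TR (TP TA TA) (TP TA TA), TR TV (TP (TP TA TA) TA)],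
    [TP TA TA, TR (TP (TP TA TA) TA) (TP TA TA), TR TV (TP (TP TA TA) TA)],
    [TP TA TA, TR (TP TA TA) (TP (TP TA TA) TA), TR TV (TP TA TA)],
    [TP TA TA, TR (TP TA TA) (TP TA TA), TR TV (TP TA TA)],
    [TP TA TA, TR (TP (TP TA TA) TA) (TP (TP TA TA) TA), TR TV (TP TA TA)],
    [TP TA TA, TR (TP (TP TA TA) TA) (TP TA TA), TR TV (TP TA TA)],
    [TP TA TA, TR (TP TA (TP TA TA)) (TP TA TA), TR TV (TP TA (TP TA TA))],
    [TP (TP TA TA) TA, TR (TP TA TA) (TP TA TA), TR TV (TP TA TA)],
    [TP TA TA, TR (TP TA (TP TA TA)) (TP TA TA), TR TV (TP TA TA)],
    [TP TA TA, TR (TP TA TA) (TP TA (TP TA TA)), TR TV (TP TA TA)],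
    [TP TA TA, TP TA TA, TR (TP TA TA) (TP TA TA)], [TP TA TA, TP TA TA, TR TV (TP TA TA)],
    [TP TA TA, TP TA (TP TA TA), TR TV (TP TA TA)],
    [TP TA TA, TP (TP TA TA) TA, TR TV (TP TA TA)],
    [TP TA TA, TP TA TA, TR TV (TP (TP TA TA) TA)],
    [TP TA TA, TP TA TA, TR TV (TP TA (TP TA TA))], [TP TA TA, TP TA TA, TP TA TA],
    [TP TA TA, TP TA (TP TA TA), TR TV (TP TA (TP TA TA))],
    [TP TA (TP (TP TA TA) TA), TR TA (TP TA TA), TR TV (TP (TP TA TA) TA)],
    [TP TA TA, TP (TP TA TA) TA, TR TA (TP TA TA)],
    [TP TA TA, TR TA (TP TA TA), TR TV (TP (TP (TP (TP TA TA) TA) TA) TA)],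
    [TP TA TA, TR TA (TP (TP (TP TA TA) TA) TA), TR TV (TP (TP TA TA) TA)],
    [TP TA TA, TR TA (TP (TP TA TA) TA), TR TV (TP (TP TA TA) TA)],
    [TP TA TA, TR TA (TP (TP TA TA) TA), TR TV (TP (TP (TP TA TA) TA) TA)],
    [TP TA TA, TP (TP TA TA) TA, TR TV (TP (TP TA TA) TA)]],
   [[TP (TP TA TA) TA, TR TA (TP TA TA), TR TV (TP (TP TA TA) TA)],
    [TP (TP (TP TA TA) TA) TA, TR TA (TP TA TA), TR TV (TP (TP TA TA) TA)],
    [TP TA TA, TR TA (TP TA TA), TR TV (TP (TP TA TA) (TP TA TA))],
    [TP TA TA, TR TA (TP TA TA), TR TV (TP (TP TA TA) (TP (TP TA TA) TA))],
    [TP TA TA, TR TA (TP TA TA), TR TV (TP (TP TA (TP TA TA)) TA)],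
    [TP TA TA, TR TA (TP TA TA), TR TV (TP (TP TA (TP TA TA)) (TP TA TA))],
    [TP TA TA, TR TA (TP TA (TP TA TA)), TR TV (TP (TP TA (TP TA TA)) TA)],
    [TP TA TA, TR TA (TP TA TA), TR TV (TP (TP TA (TP (TP TA TA) TA)) TA)]]]"

definition blocks_3388 :: "(nat \<times> nat) list list" where
  "blocks_3388 = [
   [(0, 1), (2, 3), (3, 2), (4, 5), (5, 4), (6, 7), (14, 15), (17, 18), (21, 22), (25, 26),
    (1, 0), (8, 0), (9, 0), (9, 10), (11, 0), (12, 0), (13, 0), (4, 8), (15, 14), (18, 17),
    (22, 21), (26, 25), (4, 1), (6, 9), (6, 11), (6, 12), (6, 13), (7, 10), (6, 8), (11, 6),
    (6, 0), (9, 6), (13, 6), (12, 6), (1, 7), (5, 0), (8, 7), (7, 0), (9, 11), (11, 9), (12, 13),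
    (13, 12), (16, 14), (20, 19), (23, 21), (28, 27), (10, 0), (10, 7), (0, 6), (2, 0), (3, 0),
    (4, 0), (1, 2), (1, 3), (1, 4), (1, 10), (1, 5), (7, 8), (14, 16), (19, 20), (21, 23),
    (27, 28), (3, 1), (2, 1), (5, 1)],
   [(0, 14), (1, 15), (6, 16), (21, 24), (25, 0), (27, 0), (21, 27), (26, 1), (21, 25), (28, 6),
    (23, 28), (24, 0), (22, 26), (14, 17), (14, 19), (15, 18), (19, 0), (16, 20), (17, 0),
    (14, 24), (20, 6), (18, 1), (0, 21), (1, 22), (6, 23)],
   [(1, 18)],
   [(1, 26)],
   [(6, 20)],
   [(6, 28)],
   [(14, 0), (15, 1), (16, 6)],
   [(17, 14), (18, 15)],
   [(19, 14), (20, 16)],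
   [(21, 0), (22, 1), (23, 6)],
   [(25, 21), (26, 22)],
   [(27, 21), (28, 23)]]"

definition states_4390 :: "trm list list" where
  "states_4390 = [
    [TA, TR (TP TA TV) TV, TR TV (TP TA (TP TA TV))], [TA, TR (TP TA TV) TV, TR TV (TP TA TV)],
    [TA, TR (TP TA TV) TV, TR TV (TP (TP TA TA) TV)],
    [TP TA TA, TR (TP TA TV) TV, TR TV (TP TA (TP TA TV))],
    [TP TA TA, TR (TP TA TV) TV, TR TV (TP TA TV)],
    [TP TA TA, TR (TP TA TV) TV, TR TV (TP (TP TA TA) TV)],
    [TP TA (TP TA TA), TR (TP TA TV) TV, TR TV (TP TA (TP TA TV))],
    [TP TA (TP TA TA), TR (TP TA TV) TV, TR TV (TP TA TV)],
    [TP TA (TP TA TA), TR (TP TA TV) TV, TR TV (TP (TP TA TA) TV)],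
    [TP TA (TP TA (TP TA TA)), TR (TP TA TV) TV, TR TV (TP TA (TP TA TV))],
    [TP TA (TP TA (TP TA TA)), TR (TP TA TV) TV, TR TV (TP TA TV)],
    [TP TA (TP (TP TA TA) TA), TR (TP TA TV) TV, TR TV (TP TA TV)],
    [TP TA (TP (TP TA TA) TA), TR (TP TA TV) TV, TR TV (TP (TP TA TA) TV)],
    [TP (TP TA TA) TA, TR (TP TA TV) TV, TR TV (TP TA (TP TA TV))],
    [TP (TP TA TA) TA, TR (TP TA TV) TV, TR TV (TP TA TV)],
    [TP (TP TA TA) TA, TR (TP TA TV) TV, TR TV (TP (TP TA TA) TV)],
    [TP (TP TA TA) (TP TA TA), TR (TP TA TV) TV, TR TV (TP TA TV)],
    [TP (TP TA TA) (TP TA TA), TR (TP TA TV) TV, TR TV (TP (TP TA TA) TV)],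
    [TP (TP TA (TP TA TA)) TA, TR (TP TA TV) TV, TR TV (TP TA (TP TA TV))],
    [TP (TP TA (TP TA TA)) TA, TR (TP TA TV) TV, TR TV (TP TA TV)],
    [TP (TP (TP TA TA) TA) TA, TR (TP TA TV) TV, TR TV (TP TA TV)],
    [TP (TP (TP TA TA) TA) TA, TR (TP TA TV) TV, TR TV (TP (TP TA TA) TV)]]"

definition layers_4390 :: "trm list list list" where
  "layers_4390 = [
   [[TP TA (TP TA TA), TR (TP TA TV) TV, TR TV TV],
    [TP TA TA, TR (TP TA TV) TV, TR TV (TP TA (TP (TP TA (TP TA TA)) TV))],
    [TP TA TA, TR (TP TA TV) TV, TR TV (TP TA (TP TA (TP TA (TP TA TV))))],
    [TP TA TA, TR (TP TA TV) TV, TR TV (TP (TP TA (TP TA TA)) (TP TA TV))],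
    [TP TA TA, TR (TP TA TV) TV, TR TV (TP (TP (TP (TP TA TA) TA) TA) TV)],
    [TP TA TA, TR (TP TA TV) TV, TR TV (TP (TP TA (TP (TP TA TA) TA)) TV)],
    [TP TA TA, TR (TP TA TV) TV, TR TV (TP (TP (TP TA TA) (TP TA TA)) TV)],
    [TP TA TA, TR (TP TA TV) TV, TR TV (TP (TP TA TA) (TP (TP TA TA) TV))],
    [TP (TP TA TA) TA, TR (TP TA TV) TV, TR TV TV],
    [TA, TR (TP (TP TA TA) TV) TV, TR TV (TP TA TV)],
    [TP (TP TA TA) TA, TR (TP (TP TA TA) TV) TV, TR TV (TP TA TV)],
    [TP TA TA, TR (TP (TP TA TA) TV) TV, TR TV (TP TA TV)],
    [TP TA TA, TR (TP (TP TA TA) TV) TV, TR TV (TP (TP TA TA) TV)],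
    [TP TA TA, TR (TP (TP TA (TP TA TA)) TV) TV, TR TV (TP TA TV)],
    [TP TA TA, TR (TP (TP TA (TP TA TA)) TV) TV, TR TV (TP TA (TP TA TV))],
    [TP TA TA, TR (TP (TP (TP TA TA) TA) TV) TV, TR TV (TP TA TV)],
    [TP TA TA, TR (TP (TP (TP TA TA) TA) TV) TV, TR TV (TP (TP TA TA) TV)],
    [TP TA (TP TA TA), TR (TP (TP TA TA) TV) TV, TR TV (TP TA TV)],
    [TP TA TA, TR (TP (TP TA TA) TV) TV, TR TV (TP TA (TP TA TV))],
    [TP TA TA, TR (TP TA TV) TV, TR TV TV], [TP TA TA, TR TV TV, TR TV TV]],
   [[TA, TR (TP TA TV) TV, TR TV TV], [TP TA TA, TR (TP TA (TP TA TV)) TV, TR TV (TP TA TV)],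
    [TP TA (TP TA TA), TR (TP TA (TP TA TV)) TV, TR TV (TP TA TV)],
    [TA, TR (TP TA (TP TA TV)) TV, TR TV (TP TA TV)],
    [TP TA TA, TR (TP (TP TA TA) (TP TA TV)) TV, TR TV (TP TA TV)],
    [TP TA TA, TR (TP (TP TA TA) (TP TA TV)) TV, TR TV (TP (TP TA TA) TV)],
    [TP (TP TA TA) TA, TR (TP TA (TP TA TV)) TV, TR TV (TP TA TV)],
    [TP TA TA, TR (TP TA (TP TA TV)) TV, TR TV (TP TA (TP TA TV))],
    [TA, TR TV (TP TA TV), TR TV TV],
    [TP TA TA, TR (TP TA (TP TA TV)) TV, TR TV (TP (TP TA TA) TV)],
    [TP TA TA, TR (TP TA (TP TA (TP TA TV))) TV, TR TV (TP TA TV)],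
    [TP TA TA, TR (TP TA (TP TA (TP TA TV))) TV, TR TV (TP TA (TP TA TV))],
    [TP TA TA, TR (TP TA (TP (TP TA TA) TV)) TV, TR TV (TP TA TV)],
    [TP TA TA, TR TV (TP TA TV), TR TV TV], [TP TA TA, TR TV (TP TA (TP TA TV)), TR TV TV],
    [TP TA (TP TA TA), TR TV (TP TA TV), TR TV TV],
    [TP (TP TA TA) TA, TR TV (TP TA TV), TR TV TV], [TP TA TA, TR TV (TP (TP TA TA) TV), TR TV TV]]]"

definition blocks_4390 :: "(nat \<times> nat) list list" where
  "blocks_4390 = [
   [(0, 1), (3, 4), (6, 7), (13, 14), (9, 10), (18, 19)],
   [(0, 6), (3, 9)],
   [(1, 0), (4, 3), (7, 6), (14, 13), (10, 9), (19, 18)],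
   [(1, 2), (4, 5), (7, 8), (14, 15), (11, 12), (16, 17), (20, 21)],
   [(1, 4)],
   [(2, 1), (5, 4), (8, 7), (15, 14), (12, 11), (17, 16), (21, 20)],
   [(2, 15), (5, 12), (5, 17), (5, 21), (17, 8), (17, 15), (21, 15), (12, 8), (12, 15), (15, 5),
    (16, 7), (5, 2), (8, 5), (16, 14), (20, 14), (11, 7), (11, 14), (14, 4), (14, 11), (4, 1),
    (7, 4), (7, 11), (14, 16), (7, 16), (13, 3), (4, 7), (3, 0), (6, 3), (4, 14), (9, 6), (10, 7)],
   [(3, 18)],
   [(7, 10)],
   [(14, 19)],
   [(14, 20)],
   [(18, 13), (19, 14)]]"

definition states_4986 :: "trm list list" where
  "states_4986 = [
    [TA, TR (TP TV TA) TV, TR TV (TP (TP TV TA) TA)], [TA, TR (TP TV TA) TV, TR TV (TP TV TA)],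
    [TA, TR (TP TV TA) TV, TR TV (TP TV (TP TA TA))],
    [TP TA TA, TR (TP TV TA) TV, TR TV (TP (TP TV TA) TA)],
    [TP TA TA, TR (TP TV TA) TV, TR TV (TP TV TA)],
    [TP TA TA, TR (TP TV TA) TV, TR TV (TP TV (TP TA TA))],
    [TP TA (TP TA TA), TR (TP TV TA) TV, TR TV (TP (TP TV TA) TA)],
    [TP TA (TP TA TA), TR (TP TV TA) TV, TR TV (TP TV TA)],
    [TP TA (TP TA TA), TR (TP TV TA) TV, TR TV (TP TV (TP TA TA))],
    [TP TA (TP TA (TP TA TA)), TR (TP TV TA) TV, TR TV (TP TV TA)],
    [TP TA (TP TA (TP TA TA)), TR (TP TV TA) TV, TR TV (TP TV (TP TA TA))],
    [TP TA (TP (TP TA TA) TA), TR (TP TV TA) TV, TR TV (TP (TP TV TA) TA)],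
    [TP TA (TP (TP TA TA) TA), TR (TP TV TA) TV, TR TV (TP TV TA)],
    [TP (TP TA TA) TA, TR (TP TV TA) TV, TR TV (TP (TP TV TA) TA)],
    [TP (TP TA TA) TA, TR (TP TV TA) TV, TR TV (TP TV TA)],
    [TP (TP TA TA) TA, TR (TP TV TA) TV, TR TV (TP TV (TP TA TA))],
    [TP (TP TA TA) (TP TA TA), TR (TP TV TA) TV, TR TV (TP TV TA)],
    [TP (TP TA TA) (TP TA TA), TR (TP TV TA) TV, TR TV (TP TV (TP TA TA))],
    [TP (TP TA (TP TA TA)) TA, TR (TP TV TA) TV, TR TV (TP TV TA)],
    [TP (TP TA (TP TA TA)) TA, TR (TP TV TA) TV, TR TV (TP TV (TP TA TA))],
    [TP (TP (TP TA TA) TA) TA, TR (TP TV TA) TV, TR TV (TP (TP TV TA) TA)],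
    [TP (TP (TP TA TA) TA) TA, TR (TP TV TA) TV, TR TV (TP TV TA)]]"

definition layers_4986 :: "trm list list list" where
  "layers_4986 = [
   [[TP TA (TP TA TA), TR (TP TV TA) TV, TR TV TV],
    [TP TA TA, TR (TP TV TA) TV, TR TV (TP (TP TV TA) (TP (TP TA TA) TA))],
    [TP TA TA, TR (TP TV TA) TV, TR TV (TP (TP (TP (TP TV TA) TA) TA) TA)],
    [TP TA TA, TR (TP TV TA) TV, TR TV (TP (TP TV (TP (TP TA TA) TA)) TA)],
    [TP (TP TA TA) TA, TR (TP TV TA) TV, TR TV TV],
    [TP TA TA, TR (TP TV TA) TV, TR TV (TP (TP TV (TP TA TA)) (TP TA TA))],
    [TP TA TA, TR (TP TV TA) TV, TR TV (TP TV (TP TA (TP TA (TP TA TA))))],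
    [TP TA TA, TR (TP TV TA) TV, TR TV (TP TV (TP (TP TA (TP TA TA)) TA))],
    [TP TA TA, TR (TP TV TA) TV, TR TV (TP TV (TP (TP TA TA) (TP TA TA)))],
    [TP TA TA, TR (TP TV TA) TV, TR TV TV], [TA, TR (TP TV TA) TV, TR TV TV],
    [TP TA TA, TR TV TV, TR TV TV], [TP TA TA, TR (TP TV (TP TA TA)) TV, TR TV (TP TV TA)],
    [TP TA (TP TA TA), TR (TP TV (TP TA TA)) TV, TR TV (TP TV TA)],
    [TA, TR (TP TV (TP TA TA)) TV, TR TV (TP TV TA)],
    [TP TA TA, TR (TP TV (TP TA (TP TA TA))) TV, TR TV (TP TV TA)],
    [TP TA TA, TR (TP TV (TP TA (TP TA TA))) TV, TR TV (TP TV (TP TA TA))],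
    [TP TA TA, TR (TP TV (TP TA TA)) TV, TR TV (TP (TP TV TA) TA)],
    [TP TA TA, TR (TP TV (TP (TP TA TA) TA)) TV, TR TV (TP TV TA)],
    [TP TA TA, TR (TP TV (TP (TP TA TA) TA)) TV, TR TV (TP (TP TV TA) TA)],
    [TP TA TA, TR (TP TV (TP TA TA)) TV, TR TV (TP TV (TP TA TA))]],
   [[TP (TP TA TA) TA, TR (TP TV (TP TA TA)) TV, TR TV (TP TV TA)],
    [TP (TP TA TA) TA, TR (TP (TP TV TA) TA) TV, TR TV (TP TV TA)],
    [TP TA TA, TR (TP (TP TV TA) TA) TV, TR TV (TP TV TA)],
    [TA, TR (TP (TP TV TA) TA) TV, TR TV (TP TV TA)],
    [TP TA (TP TA TA), TR (TP (TP TV TA) TA) TV, TR TV (TP TV TA)],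
    [TP TA TA, TR (TP (TP (TP TV TA) TA) TA) TV, TR TV (TP TV TA)],
    [TP TA TA, TR (TP (TP (TP TV TA) TA) TA) TV, TR TV (TP (TP TV TA) TA)],
    [TP TA TA, TR (TP (TP TV TA) (TP TA TA)) TV, TR TV (TP TV TA)],
    [TP TA TA, TR (TP (TP TV TA) (TP TA TA)) TV, TR TV (TP TV (TP TA TA))],
    [TA, TR TV (TP TV TA), TR TV TV],
    [TP TA TA, TR (TP (TP TV (TP TA TA)) TA) TV, TR TV (TP TV TA)],
    [TP TA TA, TR TV (TP TV TA), TR TV TV], [TP (TP TA TA) TA, TR TV (TP TV TA), TR TV TV],
    [TP TA (TP TA TA), TR TV (TP TV TA), TR TV TV],
    [TP TA TA, TR (TP (TP TV TA) TA) TV, TR TV (TP (TP TV TA) TA)],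
    [TP TA TA, TR TV (TP (TP TV TA) TA), TR TV TV],
    [TP TA TA, TR (TP (TP TV TA) TA) TV, TR TV (TP TV (TP TA TA))],
    [TP TA TA, TR TV (TP TV (TP TA TA)), TR TV TV]]]"

definition blocks_4986 :: "(nat \<times> nat) list list" where
  "blocks_4986 = [
   [(0, 1), (3, 4), (6, 7), (13, 14), (11, 12), (20, 21)],
   [(0, 13), (3, 20)],
   [(1, 0), (4, 3), (7, 6), (14, 13), (12, 11), (21, 20)],
   [(1, 2), (4, 5), (7, 8), (14, 15), (9, 10), (16, 17), (18, 19)],
   [(1, 4)],
   [(2, 1), (5, 4), (8, 7), (15, 14), (10, 9), (17, 16), (19, 18)],
   [(2, 8), (5, 10), (5, 17), (5, 19), (17, 8), (19, 8), (10, 8), (19, 15), (17, 15), (5, 2),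
    (15, 5), (16, 7), (18, 7), (9, 7), (8, 5), (18, 14), (16, 14), (4, 1), (14, 4), (14, 18),
    (14, 16), (7, 4), (7, 16), (7, 18), (3, 0), (13, 3), (4, 7), (6, 3), (4, 14), (20, 13),
    (21, 14)],
   [(3, 11)],
   [(7, 9)],
   [(7, 12)],
   [(11, 6), (12, 7)],
   [(14, 21)]]"

lemma catalogue_226: "catalogue_graph 226 = \<lparr>pverts = {..<20}, parcs = set (concat blocks_226)\<rparr>"
proof -
  have core: "explored_core [TA, TR TA (TR TA TA), TR TV TA] 0 states_226 layers_226 (concat blocks_226)"
    by (rule explored_core.intro; code_simp)
  have "length states_226 = 20"
    by code_simp
  with explored_core.core_graph[OF core] show ?thesis
    by (simp add: catalogue_graph_def catalogue_seed_def)
qed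

lemma catalogue_3388: "catalogue_graph 3388 = \<lparr>pverts = {..<29}, parcs = set (concat blocks_3388)\<rparr>"
proof -
  have core: "explored_core [TP TA TA, TR TA (TP TA TA), TR TV (TP TA TA)] 0
      states_3388 layers_3388 (concat blocks_3388)"
    by (rule explored_core.intro; code_simp)
  have "length states_3388 = 29"
    by code_simp
  with explored_core.core_graph[OF core] show ?thesis
    by (simp add: catalogue_graph_def catalogue_seed_def)
qed

lemma catalogue_4390: "catalogue_graph 4390 = \<lparr>pverts = {..<22}, parcs = set (concat blocks_4390)\<rparr>"
proof -
  have core: "explored_core [TP TA TA, TR (TP TA TV) TV, TR TV (TP TA TV)] 4
      states_4390 layers_4390 (concat blocks_4390)"
    by (rule explored_core.intro; code_simp)
  have "length states_4390 = 22"
    by code_simp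
  with explored_core.core_graph[OF core] show ?thesis
    by (simp add: catalogue_graph_def catalogue_seed_def)
qed

lemma catalogue_4986: "catalogue_graph 4986 = \<lparr>pverts = {..<22}, parcs = set (concat blocks_4986)\<rparr>"
proof -
  have core: "explored_core [TP TA TA, TR (TP TV TA) TV, TR TV (TP TV TA)] 4
      states_4986 layers_4986 (concat blocks_4986)"
    by (rule explored_core.intro; code_simp)
  have "length states_4986 = 22"
    by code_simp
  with explored_core.core_graph[OF core] show ?thesis
    by (simp add: catalogue_graph_def catalogue_seed_def)
qed

section \<open>The incidence fibres\<close>

lemma diamond_226: "diamond_blocks 20 blocks_226"
  by (rule diamond_blocks.intro; code_simp)

lemma diamond_3388: "diamond_blocks 29 blocks_3388"
  by (rule diamond_blocks.intro; code_simp)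

lemma diamond_4390: "diamond_blocks 22 blocks_4390"
  by (rule diamond_blocks.intro; code_simp)

lemma diamond_4986: "diamond_blocks 22 blocks_4986"
  by (rule diamond_blocks.intro; code_simp)

lemma labelled_blocksI:
  assumes "diamond_blocks n Bs" "G = \<lparr>pverts = {..<n}, parcs = set (concat Bs)\<rparr>"
    and "opp_role_assignment G c"
  shows "labelled_blocks n Bs c" "diamond_blocks.graph n Bs = G"
proof -
  show "diamond_blocks.graph n Bs = G"
    by (simp only: diamond_blocks.graph_def[OF assms(1)] assms(2))
  with assms show "labelled_blocks n Bs c"
    by (intro labelled_blocks.intro labelled_blocks_axioms.intro) simp_all
qed

text \<open>
  The largest block (0 in row 226, 6 in the other two rows) gets a small weight; in row 226 the edges
  \<open>(12, 0)\<close> and \<open>(12, 16)\<close> of blocks 0 and 20 require opposite preferences, hence the bonus at the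
  vertex 16.
\<close>

lemma heaviest_226:
  "block_heaviest blocks_226 (\<lambda>j v. if j \<in> set [0, 9, 10] then 1 else if j = 20 then 0 else 2)
     (\<lambda>j v. if j \<in> set [0, 9, 10] then 1 else if j = 20 then if v = 16 then 3 else 0 else 2)"
  by code_simp

lemma heaviest_4390:
  "block_heaviest blocks_4390 (\<lambda>j v. if j = 6 then 0 else 1) (\<lambda>j v. if j = 6 then 0 else 1)"
  by code_simp

lemma heaviest_4986:
  "block_heaviest blocks_4986 (\<lambda>j v. if j = 6 then 0 else 1) (\<lambda>j v. if j = 6 then 0 else 1)"
  by code_simp

lemma card_fibre_eq_1:
  assumes "diamond_blocks n Bs" "G = \<lparr>pverts = {..<n}, parcs = set (concat Bs)\<rparr>"
    and "opp_role_assignment G c" "block_heaviest Bs p q"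
  shows "card (incidence_fibre G (role_labels G) c) = 1"
  using labelled_blocks.fibre_singleton[OF labelled_blocksI(1)[OF assms(1-3)] assms(4)]
  unfolding labelled_blocksI(2)[OF assms(1-3)] .

text \<open>
  An alternating closed walk through blocks 0 and 1 of row 3388, as its edges in block 0 and in
  block 1. It enters and leaves vertex 0 through \<open>a\<close>, \<open>d\<close> and \<open>b'\<close>, where \<open>b\<close> and \<open>b'\<close> are 14 or
  21 and \<open>a\<close>, \<open>d\<close> and \<open>e\<close> are 1 or 6; all 32 choices occur.
\<close>

definition near :: "nat \<Rightarrow> nat \<Rightarrow> nat" where
  "near b a = (if b = 14 then if a = 1 then 15 else 16 else if a = 1 then 22 else 23)"

definition far :: "nat \<Rightarrow> nat \<Rightarrow> nat" where
  "far b a = (if b = 14 then if a = 1 then 17 else 19 else if a = 1 then 25 else 27)"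

definition far' :: "nat \<Rightarrow> nat \<Rightarrow> nat" where
  "far' b a = (if b = 14 then if a = 1 then 18 else 20 else if a = 1 then 26 else 28)"

definition alternating :: "nat \<Rightarrow> nat \<Rightarrow> nat \<Rightarrow> nat \<Rightarrow> nat \<Rightarrow> (nat \<times> nat) list \<times> (nat \<times> nat) list" where
  "alternating a b d b' e =
    ([(0, a), (far' b a, far b a), (b, near b d), (d, 0), (far b' e, far' b' e), (near b' e, b')],
     [(far' b a, a), (b, far b a), (d, near b d), (far b' e, 0), (near b' e, far' b' e), (0, b')])"

text \<open>The empty exchange stands for \<open>c\<close> itself. Besides the 32 single walks there
  are 16 unions of two: one uses 1 and 14 at vertex 0, the other 6 and 21, which makes them
  edge-disjoint. This gives 49 exchanges.\<close>

definition exchanges :: "((nat \<times> nat) list \<times> (nat \<times> nat) list) list" where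
  "exchanges = ([], []) #
     [alternating a b d b' e. a \<leftarrow> [1, 6], b \<leftarrow> [14, 21], d \<leftarrow> [1, 6], b' \<leftarrow> [14, 21], e \<leftarrow> [1, 6]] @
     [(fst X @ fst Y, snd X @ snd Y).
       b \<leftarrow> [14, 21], e \<leftarrow> [1, 6], X \<leftarrow> [alternating 1 b 1 14 e],
       b' \<leftarrow> [14, 21], e' \<leftarrow> [1, 6], Y \<leftarrow> [alternating 6 b' 6 21 e']]"

lemma exchanges_balanced:
  "list_all (balanced_exchange (blocks_3388 ! 0) (blocks_3388 ! 1)) exchanges"
  by code_simp

lemma exchanges_distinct:
  "distinct (map (\<lambda>ST. filter (\<lambda>e. e \<in> set (fst ST)) (blocks_3388 ! 0)) exchanges)"
  by code_simp

lemma length_exchanges: "length exchanges \<ge> 43"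
  by code_simp

section \<open>Record systems of the exchanged partition\<close>

definition block_image :: "(nat \<times> nat) list \<Rightarrow> nat list \<Rightarrow> nat list" where
  "block_image B vs = map snd (filter (\<lambda>e. fst e \<in> set vs) B)"

text \<open>\<open>remdups\<close> turns a singleton image into a one-element list, so
  single-valuedness is tested by comparison with \<open>[p]\<close>.\<close>

definition word_image :: "(nat \<times> nat) list list \<Rightarrow> nat list \<Rightarrow> nat list \<Rightarrow> nat list" where
  "word_image Bs ws vs = remdups (fold (\<lambda>i. block_image (Bs ! i)) ws vs)"

definition block_word :: "(nat \<times> nat) list list \<Rightarrow> nat list \<Rightarrow> (nat \<times> nat) set list" where
  "block_word Bs ws = map (\<lambda>i. set (Bs ! i)) ws"

lemma block_word_eq_Nil: "block_word Bs ws = [] \<longleftrightarrow> ws = []"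
  by (simp add: block_word_def)

lemma word_rel_block_word:
  assumes "\<And>B. B \<in> set Bs \<Longrightarrow> set B \<subseteq> pverts G \<times> pverts G" "set ws \<subseteq> {..<length Bs}" "set vs \<subseteq> pverts G"
  shows "word_rel G (block_word Bs ws) `` set vs = set (word_image Bs ws vs)"
  using assms(2,3)
proof (induction ws arbitrary: vs)
  case Nil
  then show ?case
    by (simp add: block_word_def word_image_def word_rel_Image(1) Int_absorb1)
next
  case (Cons i ws)
  have image: "set (block_image (Bs ! i) vs) = set (Bs ! i) `` set vs"
    by (force simp: block_image_def)
  have "Bs ! i \<in> set Bs"
    using Cons.prems(1) by simp
  with assms(1) image have "set (block_image (Bs ! i) vs) \<subseteq> pverts G"
    by fastforce
  with Cons.IH[of "block_image (Bs ! i) vs"] Cons.prems(1) show ?case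
    by (simp add: block_word_def word_image_def word_rel_Image(2) image)
qed

definition "inc_exchange = alternating 1 14 1 14 1"

definition "inc_blocks = exchange_blocks 0 1 inc_exchange blocks_3388"

definition inc_certificate ::
  "nat \<Rightarrow> nat \<Rightarrow> nat \<Rightarrow> nat list \<Rightarrow> nat \<Rightarrow> nat \<Rightarrow> nat list \<Rightarrow> nat list \<Rightarrow> nat certificate" where
  "inc_certificate s l r o' p q z u =
    \<lparr>fork_state = s, chan_A = set (inc_blocks ! 0), chan_B = set (inc_blocks ! 0),
     fork_l = l, fork_r = r, offload_word = block_word inc_blocks o', off_p = p, off_q = q,
     orbit_word = block_word inc_blocks z, use_word = block_word inc_blocks u\<rparr>"

definition swap_data ::
  "(nat \<times> nat) list list \<Rightarrow> nat \<Rightarrow> nat \<Rightarrow> nat \<Rightarrow> nat list \<Rightarrow> nat \<Rightarrow> nat \<Rightarrow> nat list \<Rightarrow> nat list \<Rightarrow> bool" where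
  "swap_data Bs s l r o' p q z u \<longleftrightarrow>
     list_all (\<lambda>v. v < 29) [s, l, r, p, q] \<and> list_all (\<lambda>i. i < 12) (o' @ z @ u) \<and> z \<noteq> [] \<and> u \<noteq> [] \<and>
     l \<in> set (word_image Bs [0] [s]) \<and> r \<in> set (word_image Bs [0] [s]) \<and>
     word_image Bs [0] [p] \<noteq> [] \<and> word_image Bs [0] [q] \<noteq> [] \<and>
     word_image Bs o' [l] = [p] \<and> word_image Bs o' [r] = [q] \<and>
     word_image Bs z [p] = [q] \<and> word_image Bs z [q] = [p] \<and>
     word_image Bs u [p] = [] \<and> word_image Bs u [q] \<noteq> []"

text \<open>Words, classes and certificates see the edges only through the blocks, so fixing the
  vertex set of \<open>G\<close> is enough.\<close>

context
  fixes G :: "nat pair_pre_digraph"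
  assumes verts: "pverts G = {..<29}"
begin

lemma length_inc_blocks: "length inc_blocks = 12"
  by code_simp

lemma inc_blocks_subset: "B \<in> set inc_blocks \<Longrightarrow> set B \<subseteq> pverts G \<times> pverts G"
proof -
  have "list_all (list_all (\<lambda>(u, v). u < 29 \<and> v < 29)) inc_blocks"
    by code_simp
  then show "B \<in> set inc_blocks \<Longrightarrow> set B \<subseteq> pverts G \<times> pverts G"
    by (auto simp: list_all_iff verts)
qed

lemma word_image_singleton:
  assumes "v < 29" "list_all (\<lambda>i. i < 12) ws"
  shows "word_rel G (block_word inc_blocks ws) `` {v} = set (word_image inc_blocks ws [v])"
  using word_rel_block_word[where Bs = inc_blocks and ws = ws and vs = "[v]", OF inc_blocks_subset] assms
  by (simp add: list_all_iff length_inc_blocks verts subset_eq)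

lemma is_word_block_word:
  "list_all (\<lambda>i. i < 12) ws \<Longrightarrow> is_word (set ` set inc_blocks) (block_word inc_blocks ws)"
  by (auto simp: is_word_def block_word_def list_all_iff length_inc_blocks)

lemma swap_certificate_inc:
  assumes "swap_data inc_blocks s l r o' p q z u"
  shows "swap_certificate G (set ` set inc_blocks) (inc_certificate s l r o' p q z u)"
proof -
  have image0: "set (inc_blocks ! 0) `` {v} = set (word_image inc_blocks [0] [v])" for v
    by (force simp: word_image_def block_image_def)
  show ?thesis
    unfolding inc_certificate_def
  proof (rule swap_certificateI)
    show "C \<subseteq> pverts G \<times> pverts G" if "C \<in> set ` set inc_blocks" for C
      using that inc_blocks_subset by blast
    show "set (inc_blocks ! 0) \<in> set ` set inc_blocks"
      using length_inc_blocks by (intro imageI nth_mem) simp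
  qed (use assms in \<open>simp_all add: swap_data_def verts image0 word_image_singleton is_word_block_word
      block_word_eq_Nil\<close>)
qed

text \<open>Blocks 6 and 7, \<open>{(14, 0), (15, 1), (16, 6)}\<close> and
  \<open>{(17, 14), (18, 15)}\<close>, act as filters that make many-valued images single. The
  exchange enters the first orbit word: 0 goes to 1, 15, 1 by the exchanged edges
  \<open>(0, 1)\<close> and \<open>(1, 15)\<close>, and 1 goes to 0, 14, 0 by \<open>(1, 0)\<close>
  and \<open>(0, 14)\<close>. Block 2 is \<open>{(1, 18)}\<close>, dead at 0 and alive at 1; for the
  pair 14, 15 block 6 is put in front of it. Block 4 is \<open>{(6, 20)}\<close> and separates 0
  from 6.\<close>

lemma swap_data_inc:
  "swap_data inc_blocks 2 0 1 [] 0 1 [1, 0, 6] [2]"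
  "swap_data inc_blocks 2 0 1 [0, 0, 7] 14 15 [0, 1, 7] [6, 2]"
  "swap_data inc_blocks 9 0 6 [] 0 6 [0, 0, 6] [4]"
  by code_simp+

text \<open>The way out is the offload word of the second certificate, the way back is block 6. The
  odd way back prefixes the second orbit word, which swaps 14 and 15.\<close>

lemma inc_translations:
  "word_image inc_blocks [0, 0, 7] [0] = [14] \<and> word_image inc_blocks [0, 0, 7] [1] = [15] \<and>
   word_image inc_blocks [6] [14] = [0] \<and> word_image inc_blocks [6] [15] = [1] \<and>
   word_image inc_blocks [0, 1, 7, 6] [14] = [1] \<and> word_image inc_blocks [0, 1, 7, 6] [15] = [0]"
  by code_simp

lemma property_H_inc: "property_H G (set ` set inc_blocks) = 1"
proof (rule property_H_swap)
  note swap_certificate_inc[OF swap_data_inc(1)] swap_certificate_inc[OF swap_data_inc(2)]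
    swap_certificate_inc[OF swap_data_inc(3)]
  then show "swap_certificate G (set ` set inc_blocks) (inc_certificate 2 0 1 [] 0 1 [1, 0, 6] [2])"
    "swap_certificate G (set ` set inc_blocks) (inc_certificate 2 0 1 [0, 0, 7] 14 15 [0, 1, 7] [6, 2])"
    "swap_certificate G (set ` set inc_blocks) (inc_certificate 9 0 6 [] 0 6 [0, 0, 6] [4])"
    by this+
  show "is_word (set ` set inc_blocks) (block_word inc_blocks [0, 0, 7])"
    "is_word (set ` set inc_blocks) (block_word inc_blocks [6])"
    "is_word (set ` set inc_blocks) (block_word inc_blocks [0, 1, 7, 6])"
    by (rule is_word_block_word; simp)+
qed (simp_all add: inc_certificate_def word_image_singleton inc_translations[unfolded One_nat_def]
    block_word_eq_Nil)

end

lemma inc_edges_eq: "inc_edges = set (fst inc_exchange) \<union> set (snd inc_exchange)"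
  unfolding inc_edges_def inc_exchange_def alternating_def near_def far_def far'_def by auto

text \<open>As the labelling is arbitrary, the convention that the two roles on
  \<open>inc_edges\<close> are called 0 and 1 becomes a premise of the last claim; that exactly two
  roles occur there is asserted before it, for every labelling.\<close>

theorem theorem7p2:
  fixes c226 c3388 c4390 c4986 :: "nat \<times> nat \<Rightarrow> nat"
  assumes "opp_role_assignment (catalogue_graph 226) c226"
    and "opp_role_assignment (catalogue_graph 3388) c3388"
    and "opp_role_assignment (catalogue_graph 4390) c4390"
    and "opp_role_assignment (catalogue_graph 4986) c4986"
  shows
    "card (incidence_fibre (catalogue_graph 226) (role_labels (catalogue_graph 226)) c226) = 1 \<and>
     card (incidence_fibre (catalogue_graph 4390) (role_labels (catalogue_graph 4390)) c4390) = 1 \<and>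
     card (incidence_fibre (catalogue_graph 4986) (role_labels (catalogue_graph 4986)) c4986) = 1 \<and>
     card (incidence_fibre (catalogue_graph 3388) (role_labels (catalogue_graph 3388)) c3388) \<ge> 43 \<and>
     inc_edges \<subseteq> parcs (catalogue_graph 3388) \<and>
     card (c3388 ` inc_edges) = 2 \<and>
     (c3388 ` inc_edges = {0, 1} \<longrightarrow>
       (\<exists>c_inc \<in> incidence_fibre (catalogue_graph 3388) (role_labels (catalogue_graph 3388)) c3388.
          c_inc \<noteq> c3388 \<and>
          property_H (catalogue_graph 3388)
            (fibre_partition (parcs (catalogue_graph 3388)) c_inc) = 1 \<and>
          card {e \<in> parcs (catalogue_graph 3388). c_inc e \<noteq> c3388 e} = 12 \<and>
          c_inc = exchange_roles 0 1 inc_edges c3388))"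
proof -
  note c226 = assms(1) and c3388 = assms(2) and c4390 = assms(3) and c4986 = assms(4)
  define G where "G = catalogue_graph 3388"
  have G: "G = \<lparr>pverts = {..<29}, parcs = set (concat blocks_3388)\<rparr>"
    by (simp only: G_def catalogue_3388)
  have c: "opp_role_assignment G c3388"
    using c3388 by (simp only: G_def)
  interpret labelled_blocks 29 blocks_3388 c3388
    by (rule labelled_blocksI(1)[OF diamond_3388 G c])
  have graph: "graph = G"
    by (rule labelled_blocksI(2)[OF diamond_3388 G c])
  have k: "k = 12"
    by code_simp
  have ij: "0 < k" "1 < k" "(0::nat) \<noteq> 1"
    by (simp_all add: k)
  have "length exchanges \<le> card (incidence_fibre G (role_labels G) c3388)"
    using card_fibre_ge[OF ij exchanges_balanced exchanges_distinct] by (simp only: graph)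
  then have large: "43 \<le> card (incidence_fibre G (role_labels G) c3388)"
    using length_exchanges by linarith
  have balanced: "balanced_exchange (blocks_3388 ! 0) (blocks_3388 ! 1) inc_exchange"
    unfolding inc_exchange_def by code_simp
  have parcs: "parcs G = set E"
    by (simp add: G)
  have subset: "inc_edges \<subseteq> parcs G"
    unfolding inc_edges_eq parcs using exchange_subsets[OF ij balanced] block_subset ij(1,2) by blast
  have "c3388 ` set (fst inc_exchange) = {\<rho> 0}" "c3388 ` set (snd inc_exchange) = {\<rho> 1}"
  proof -
    have "fst inc_exchange \<noteq> []" "snd inc_exchange \<noteq> []"
      by (simp_all add: inc_exchange_def alternating_def)
    moreover have "c3388 e = \<rho> 0" if "e \<in> set (fst inc_exchange)" for e
      using that exchange_subsets(1)[OF ij balanced] c_block[OF ij(1)] by blast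
    moreover have "c3388 e = \<rho> 1" if "e \<in> set (snd inc_exchange)" for e
      using that exchange_subsets(2)[OF ij balanced] c_block[OF ij(2)] by blast
    ultimately show "c3388 ` set (fst inc_exchange) = {\<rho> 0}" "c3388 ` set (snd inc_exchange) = {\<rho> 1}"
      by (metis image_cong image_constant_conv set_empty)+
  qed
  then have roles: "c3388 ` inc_edges = {\<rho> 0, \<rho> 1}"
    unfolding inc_edges_eq by (simp only: image_Un) blast
  have neq: "\<rho> 0 \<noteq> \<rho> 1"
    using ij by simp
  let ?c = "exchange_roles 0 1 inc_edges c3388"
  have inc: "?c \<in> incidence_fibre G (role_labels G) c3388 \<and> ?c \<noteq> c3388 \<and>
      property_H G (fibre_partition (parcs G) ?c) = 1 \<and> card {e \<in> parcs G. ?c e \<noteq> c3388 e} = 12"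
    if "c3388 ` inc_edges = {0, 1}"
  proof -
    \<comment> \<open>The premise leaves open which of the blocks 0 and 1 is labelled 0, and the
      exchange is symmetric in the two roles.\<close>
    have "\<rho> 0 = 0 \<and> \<rho> 1 = 1 \<or> \<rho> 0 = 1 \<and> \<rho> 1 = 0"
      using roles that by (metis doubleton_eq_iff)
    then have c_eq: "?c = exchanged 0 1 inc_exchange"
      unfolding exchanged_def inc_edges_eq by (metis exchange_roles_commute)
    have fibre: "?c \<in> incidence_fibre G (role_labels G) c3388"
      using exchanged_in_fibre[OF ij balanced] unfolding c_eq graph[symmetric] role_labels_graph .
    have diff: "{e \<in> parcs G. ?c e \<noteq> c3388 e} = inc_edges"
      by (simp only: c_eq parcs exchanged_diff[OF ij balanced] inc_edges_eq[symmetric])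
    have card: "card inc_edges = 12"
      by (simp add: inc_edges_def)
    have "?c \<noteq> c3388"
    proof
      assume "?c = c3388"
      with diff have "inc_edges = {}" by simp
      with card show False by simp
    qed
    moreover have "[] \<notin> set inc_blocks"
      by code_simp
    then have "fibre_partition (parcs G) ?c = set ` set inc_blocks"
      unfolding c_eq parcs inc_blocks_def by (rule exchanged_partition[OF ij balanced])
    then have "property_H G (fibre_partition (parcs G) ?c) = 1"
      using property_H_inc[of G] by (simp add: G)
    ultimately show ?thesis
      using fibre diff card by simp
  qed
  have "card (c3388 ` inc_edges) = 2"
    unfolding roles using neq by simp
  then show ?thesis
    using large subset inc card_fibre_eq_1[OF diamond_226 catalogue_226 c226 heaviest_226]
      card_fibre_eq_1[OF diamond_4390 catalogue_4390 c4390 heaviest_4390]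
      card_fibre_eq_1[OF diamond_4986 catalogue_4986 c4986 heaviest_4986]
    unfolding G_def by blast
qed

end
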